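(* The 2-category of 2-categories with contravariance, 2-functors preserving contravariance, and 2-natural transformations respecting contravariance is 2-equivalent to the 2-category of $\mathbf{V}$-enriched categories (with $\mathbf{V}$-functors and $\mathbf{V}$-natural transformations), where $\mathbf{V}$ is the monoidal category whose underlying category is $\mathbf{Cat}\times\mathbf{Cat}$, with objects written $A=(A^+,A^-)$, and whose tensor product and unit are $$(A\otimes B)^+=(A^+\times B^+)\amalg(A^-\times(B^-)^{\mathrm{op}}),\qquad (A\otimes B)^-=(A^+\times B^-)\amalg(A^-\times(B^+)^{\mathrm{op}}),\qquad \mathbb{1}=(1,0),$$ with $1$ the terminal category and $0$ the empty category.
   Context: The monoidal category $\mathbf{V}$ is not symmetric; a $\mathbf{V}$-category has hom-objects $\underline{A}(x,y)\in\mathbf{V}$ and composition $\underline{A}(y,z)\otimes\underline{A}(x,y)\to\underline{A}(x,z)$. A **2-category with contravariance** $\underline{A}$ consists of a collection of objects; for each pair $x,y$ two categories $\underline{A}^+(x,y)$ and $\underline{A}^-(x,y)$; an object $1_x\in\underline{A}^+(x,x)$ for each $x$; and composition functors $$\underline{A}^+(y,z)\times\underline{A}^+(x,y)\to\underline{A}^+(x,z),\qquad \underline{A}^-(y,z)\times\underline{A}^-(x,y)^{\mathrm{op}}\to\underline{A}^+(x,z),$$ $$\underline{A}^+(y,z)\times\underline{A}^-(x,y)\to\underline{A}^-(x,z),\qquad \underline{A}^-(y,z)\times\underline{A}^+(x,y)^{\mathrm{op}}\to\underline{A}^-(x,z),$$ which are strictly unital (left and right, for each variance) and strictly associative (for each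 of the eight triples of variances). A **2-functor preserving contravariance** $F:\underline{A}\to\underline{B}$ is a function on objects together with functors $\underline{A}^{\pm}(x,y)\to\underline{B}^{\pm}(Fx,Fy)$ strictly preserving units and all four compositions. A **2-natural transformation respecting contravariance** $\alpha:F\to F'$ consists of objects $\alpha_x\in\underline{B}^+(Fx,F'x)$ such that for each variance $\pm$ the functors $\underline{A}^\pm(x,y)\to\underline{B}^\pm(Fx,F'y)$ given by $f\mapsto\alpha_y\circ F(f)$ and $f\mapsto F'(f)\circ\alpha_x$ (on objects and morphisms) are equal. *)

theory Defs
  imports Main "HOL-Library.FuncSet"
begin

section \<open>Categories and functors\<close>

text \<open>
  All structure maps are required to be \<^term>\<open>undefined\<close> off their domain, so that
  two categories (functors, enriched categories, ...) are equal as HOL values exactly if they are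
  equal as mathematical structures.
\<close>

record ('o, 'm) cat =
  Ob  :: "'o set"
  Ar  :: "'m set"
  Dom :: "'m \<Rightarrow> 'o"
  Cod :: "'m \<Rightarrow> 'o"
  Idt :: "'o \<Rightarrow> 'm"
  Cmp :: "'m \<Rightarrow> 'm \<Rightarrow> 'm"  (infixl "\<cdot>\<index>" 70)

definition composable :: "('o, 'm) cat \<Rightarrow> 'm \<Rightarrow> 'm \<Rightarrow> bool" where
  "composable C g f \<longleftrightarrow> g \<in> Ar C \<and> f \<in> Ar C \<and> Dom C g = Cod C f"

definition category :: "('o, 'm) cat \<Rightarrow> bool" where
  "category C \<longleftrightarrow>
     Dom C \<in> Ar C \<rightarrow>\<^sub>E Ob C \<and> Cod C \<in> Ar C \<rightarrow>\<^sub>E Ob C \<and> Idt C \<in> Ob C \<rightarrow>\<^sub>E Ar C \<and>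
     (\<forall>a\<in>Ob C. Dom C (Idt C a) = a \<and> Cod C (Idt C a) = a) \<and>
     (\<forall>g f. composable C g f \<longrightarrow>
        g \<cdot>\<^bsub>C\<^esub> f \<in> Ar C \<and> Dom C (g \<cdot>\<^bsub>C\<^esub> f) = Dom C f \<and> Cod C (g \<cdot>\<^bsub>C\<^esub> f) = Cod C g) \<and>
     (\<forall>g f. \<not> composable C g f \<longrightarrow> g \<cdot>\<^bsub>C\<^esub> f = undefined) \<and>
     (\<forall>f\<in>Ar C. f \<cdot>\<^bsub>C\<^esub> Idt C (Dom C f) = f \<and> Idt C (Cod C f) \<cdot>\<^bsub>C\<^esub> f = f) \<and>
     (\<forall>h g f. composable C h g \<and> composable C g f \<longrightarrow>
        (h \<cdot>\<^bsub>C\<^esub> g) \<cdot>\<^bsub>C\<^esub> f = h \<cdot>\<^bsub>C\<^esub> (g \<cdot>\<^bsub>C\<^esub> f))"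

definition arr_between :: "('o, 'm) cat \<Rightarrow> 'm \<Rightarrow> 'o \<Rightarrow> 'o \<Rightarrow> bool" where
  "arr_between C f a b \<longleftrightarrow> f \<in> Ar C \<and> Dom C f = a \<and> Cod C f = b"

definition inverse_arrows :: "('o, 'm) cat \<Rightarrow> 'm \<Rightarrow> 'm \<Rightarrow> bool" where
  "inverse_arrows C f g \<longleftrightarrow>
     arr_between C f (Cod C g) (Cod C f) \<and> arr_between C g (Cod C f) (Cod C g) \<and>
     g \<cdot>\<^bsub>C\<^esub> f = Idt C (Dom C f) \<and> f \<cdot>\<^bsub>C\<^esub> g = Idt C (Cod C f)"

definition iso_between :: "('o, 'm) cat \<Rightarrow> 'm \<Rightarrow> 'o \<Rightarrow> 'o \<Rightarrow> bool" where
  "iso_between C f a b \<longleftrightarrow> arr_between C f a b \<and> (\<exists>g. inverse_arrows C f g)"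

definition inv_ar :: "('o, 'm) cat \<Rightarrow> 'm \<Rightarrow> 'm" where
  "inv_ar C f = (THE g. inverse_arrows C f g)"

record ('o, 'm, 'o2, 'm2) fctr =
  FOb :: "'o \<Rightarrow> 'o2"
  FAr :: "'m \<Rightarrow> 'm2"

definition is_functor :: "('o, 'm) cat \<Rightarrow> ('o2, 'm2) cat \<Rightarrow> ('o, 'm, 'o2, 'm2) fctr \<Rightarrow> bool" where
  "is_functor C D F \<longleftrightarrow>
     FOb F \<in> Ob C \<rightarrow>\<^sub>E Ob D \<and> FAr F \<in> Ar C \<rightarrow>\<^sub>E Ar D \<and>
     (\<forall>f\<in>Ar C. Dom D (FAr F f) = FOb F (Dom C f) \<and> Cod D (FAr F f) = FOb F (Cod C f)) \<and>
     (\<forall>a\<in>Ob C. FAr F (Idt C a) = Idt D (FOb F a)) \<and>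
     (\<forall>g f. composable C g f \<longrightarrow> FAr F (g \<cdot>\<^bsub>C\<^esub> f) = FAr F g \<cdot>\<^bsub>D\<^esub> FAr F f)"

text \<open>Smart constructors that cut the given maps down to the intended domains.\<close>

definition mk_cat ::
  "'o set \<Rightarrow> 'm set \<Rightarrow> ('m \<Rightarrow> 'o) \<Rightarrow> ('m \<Rightarrow> 'o) \<Rightarrow> ('o \<Rightarrow> 'm) \<Rightarrow> ('m \<Rightarrow> 'm \<Rightarrow> 'm) \<Rightarrow> ('o, 'm) cat" where
  "mk_cat X A d c i m =
     \<lparr>Ob = X, Ar = A, Dom = restrict d A, Cod = restrict c A, Idt = restrict i X,
      Cmp = (\<lambda>g f. if g \<in> A \<and> f \<in> A \<and> d g = c f then m g f else undefined)\<rparr>"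

definition mk_fun :: "('o, 'm) cat \<Rightarrow> ('o \<Rightarrow> 'o2) \<Rightarrow> ('m \<Rightarrow> 'm2) \<Rightarrow> ('o, 'm, 'o2, 'm2) fctr" where
  "mk_fun C p q = \<lparr>FOb = restrict p (Ob C), FAr = restrict q (Ar C)\<rparr>"

definition id_fun :: "('o, 'm) cat \<Rightarrow> ('o, 'm, 'o, 'm) fctr" where
  "id_fun C = mk_fun C (\<lambda>a. a) (\<lambda>f. f)"

definition comp_fun ::
  "('o, 'm) cat \<Rightarrow> ('o2, 'm2, 'o3, 'm3) fctr \<Rightarrow> ('o, 'm, 'o2, 'm2) fctr \<Rightarrow> ('o, 'm, 'o3, 'm3) fctr" where
  "comp_fun C G F = mk_fun C (FOb G \<circ> FOb F) (FAr G \<circ> FAr F)"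

definition op_cat :: "('o, 'm) cat \<Rightarrow> ('o, 'm) cat" where
  "op_cat C = mk_cat (Ob C) (Ar C) (Cod C) (Dom C) (Idt C) (\<lambda>g f. f \<cdot>\<^bsub>C\<^esub> g)"

definition prod_cat :: "('o, 'm) cat \<Rightarrow> ('o2, 'm2) cat \<Rightarrow> ('o \<times> 'o2, 'm \<times> 'm2) cat" where
  "prod_cat C D =
     mk_cat (Ob C \<times> Ob D) (Ar C \<times> Ar D)
       (map_prod (Dom C) (Dom D)) (map_prod (Cod C) (Cod D)) (map_prod (Idt C) (Idt D))
       (\<lambda>(g, g') (f, f'). (g \<cdot>\<^bsub>C\<^esub> f, g' \<cdot>\<^bsub>D\<^esub> f'))"

definition sum_cat :: "('o, 'm) cat \<Rightarrow> ('o2, 'm2) cat \<Rightarrow> ('o + 'o2, 'm + 'm2) cat" where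
  "sum_cat C D =
     mk_cat (Ob C <+> Ob D) (Ar C <+> Ar D)
       (map_sum (Dom C) (Dom D)) (map_sum (Cod C) (Cod D)) (map_sum (Idt C) (Idt D))
       (\<lambda>g f. case (g, f) of
                (Inl g', Inl f') \<Rightarrow> Inl (g' \<cdot>\<^bsub>C\<^esub> f')
              | (Inr g', Inr f') \<Rightarrow> Inr (g' \<cdot>\<^bsub>D\<^esub> f')
              | _ \<Rightarrow> undefined)"

definition empty_cat :: "('o, 'm) cat" where
  "empty_cat = mk_cat {} {} undefined undefined undefined undefined"

definition terminal_cat :: "'u \<Rightarrow> ('u, 'u) cat" where
  "terminal_cat u = mk_cat {u} {u} (\<lambda>_. u) (\<lambda>_. u) (\<lambda>_. u) (\<lambda>_ _. u)"

text \<open>The isomorphic copy of a category along an injection \<open>e\<close>.\<close>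

definition copy_cat :: "('x \<Rightarrow> 'u) \<Rightarrow> ('x, 'x) cat \<Rightarrow> ('u, 'u) cat" where
  "copy_cat e C =
     mk_cat (e ` Ob C) (e ` Ar C) (e \<circ> Dom C \<circ> inv e) (e \<circ> Cod C \<circ> inv e) (e \<circ> Idt C \<circ> inv e)
       (\<lambda>g f. e (inv e g \<cdot>\<^bsub>C\<^esub> inv e f))"

text \<open>Arrows that remember their source and target.\<close>

record ('x, 't) arrow =
  src :: 'x
  mor :: 't
  trg :: 'x

text \<open>
  The category of all categories whose objects and arrows are elements of \<^typ>\<open>'u\<close>; the
  type \<^typ>\<open>'u\<close> is the universe of smallness.
\<close>

type_synonym 'u scat = "('u, 'u) cat"
type_synonym 'u sfun = "('u scat, ('u, 'u, 'u, 'u) fctr) arrow"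

definition Cat :: "('u scat, 'u sfun) cat" where
  "Cat = mk_cat {C. category C}
     {F. category (src F) \<and> category (trg F) \<and> is_functor (src F) (trg F) (mor F)}
     src trg
     (\<lambda>C. \<lparr>src = C, mor = id_fun C, trg = C\<rparr>)
     (\<lambda>G F. \<lparr>src = src F, mor = comp_fun (src F) (mor G) (mor F), trg = trg G\<rparr>)"


section \<open>Strict 2-categories and 2-equivalence\<close>

record ('o, 'f, 't) twocat =
  TObj  :: "'o set"
  THom  :: "'o \<Rightarrow> 'o \<Rightarrow> ('f, 't) cat"
  TId   :: "'o \<Rightarrow> 'f"
  TComp :: "'o \<Rightarrow> 'o \<Rightarrow> 'o \<Rightarrow> ('f \<times> 'f, 't \<times> 't, 'f, 't) fctr"

text \<open>The composition \<open>TComp K x y z\<close> takes pairs \<open>(g, f)\<close> with \<open>f : x \<rightarrow> y\<close> and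
  \<open>g : y \<rightarrow> z\<close>.\<close>

definition two_category :: "('o, 'f, 't) twocat \<Rightarrow> bool" where
  "two_category K \<longleftrightarrow>
     (\<forall>x\<in>TObj K. \<forall>y\<in>TObj K. category (THom K x y)) \<and>
     (\<forall>x\<in>TObj K. TId K x \<in> Ob (THom K x x)) \<and>
     (\<forall>x\<in>TObj K. \<forall>y\<in>TObj K. \<forall>z\<in>TObj K.
        is_functor (prod_cat (THom K y z) (THom K x y)) (THom K x z) (TComp K x y z)) \<and>
     (\<forall>x\<in>TObj K. \<forall>y\<in>TObj K.
        (\<forall>f\<in>Ob (THom K x y).
           FOb (TComp K x y y) (TId K y, f) = f \<and> FOb (TComp K x x y) (f, TId K x) = f) \<and>
        (\<forall>\<phi>\<in>Ar (THom K x y).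
           FAr (TComp K x y y) (Idt (THom K y y) (TId K y), \<phi>) = \<phi> \<and>
           FAr (TComp K x x y) (\<phi>, Idt (THom K x x) (TId K x)) = \<phi>)) \<and>
     (\<forall>x\<in>TObj K. \<forall>y\<in>TObj K. \<forall>z\<in>TObj K. \<forall>w\<in>TObj K.
        (\<forall>h\<in>Ob (THom K z w). \<forall>g\<in>Ob (THom K y z). \<forall>f\<in>Ob (THom K x y).
           FOb (TComp K x z w) (h, FOb (TComp K x y z) (g, f)) =
           FOb (TComp K x y w) (FOb (TComp K y z w) (h, g), f)) \<and>
        (\<forall>\<theta>\<in>Ar (THom K z w). \<forall>\<psi>\<in>Ar (THom K y z). \<forall>\<phi>\<in>Ar (THom K x y).
           FAr (TComp K x z w) (\<theta>, FAr (TComp K x y z) (\<psi>, \<phi>)) =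
           FAr (TComp K x y w) (FAr (TComp K y z w) (\<theta>, \<psi>), \<phi>)))"

record ('o, 'f, 't, 'o2, 'f2, 't2) twofun =
  TFOb  :: "'o \<Rightarrow> 'o2"
  TFHom :: "'o \<Rightarrow> 'o \<Rightarrow> ('f, 't, 'f2, 't2) fctr"

definition two_functor ::
  "('o, 'f, 't) twocat \<Rightarrow> ('o2, 'f2, 't2) twocat \<Rightarrow> ('o, 'f, 't, 'o2, 'f2, 't2) twofun \<Rightarrow> bool" where
  "two_functor K L F \<longleftrightarrow>
     TFOb F \<in> TObj K \<rightarrow> TObj L \<and>
     (\<forall>x\<in>TObj K. \<forall>y\<in>TObj K. is_functor (THom K x y) (THom L (TFOb F x) (TFOb F y)) (TFHom F x y)) \<and>
     (\<forall>x\<in>TObj K. FOb (TFHom F x x) (TId K x) = TId L (TFOb F x)) \<and>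
     (\<forall>x\<in>TObj K. \<forall>y\<in>TObj K. \<forall>z\<in>TObj K.
        (\<forall>g\<in>Ob (THom K y z). \<forall>f\<in>Ob (THom K x y).
           FOb (TFHom F x z) (FOb (TComp K x y z) (g, f)) =
           FOb (TComp L (TFOb F x) (TFOb F y) (TFOb F z)) (FOb (TFHom F y z) g, FOb (TFHom F x y) f)) \<and>
        (\<forall>\<psi>\<in>Ar (THom K y z). \<forall>\<phi>\<in>Ar (THom K x y).
           FAr (TFHom F x z) (FAr (TComp K x y z) (\<psi>, \<phi>)) =
           FAr (TComp L (TFOb F x) (TFOb F y) (TFOb F z)) (FAr (TFHom F y z) \<psi>, FAr (TFHom F x y) \<phi>)))"

definition two_id :: "('o, 'f, 't) twocat \<Rightarrow> ('o, 'f, 't, 'o, 'f, 't) twofun" where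
  "two_id K = \<lparr>TFOb = (\<lambda>x. x), TFHom = (\<lambda>x y. id_fun (THom K x y))\<rparr>"

definition two_comp ::
  "('o, 'f, 't) twocat \<Rightarrow> ('o2, 'f2, 't2, 'o3, 'f3, 't3) twofun \<Rightarrow> ('o, 'f, 't, 'o2, 'f2, 't2) twofun
   \<Rightarrow> ('o, 'f, 't, 'o3, 'f3, 't3) twofun" where
  "two_comp K G F =
     \<lparr>TFOb = TFOb G \<circ> TFOb F,
      TFHom = (\<lambda>x y. comp_fun (THom K x y) (TFHom G (TFOb F x) (TFOb F y)) (TFHom F x y))\<rparr>"

definition two_nat ::
  "('o, 'f, 't) twocat \<Rightarrow> ('o2, 'f2, 't2) twocat \<Rightarrow> ('o, 'f, 't, 'o2, 'f2, 't2) twofun \<Rightarrow>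
   ('o, 'f, 't, 'o2, 'f2, 't2) twofun \<Rightarrow> ('o \<Rightarrow> 'f2) \<Rightarrow> bool" where
  "two_nat K L F F' \<alpha> \<longleftrightarrow>
     (\<forall>x\<in>TObj K. \<alpha> x \<in> Ob (THom L (TFOb F x) (TFOb F' x))) \<and>
     (\<forall>x\<in>TObj K. \<forall>y\<in>TObj K.
        (\<forall>f\<in>Ob (THom K x y).
           FOb (TComp L (TFOb F x) (TFOb F y) (TFOb F' y)) (\<alpha> y, FOb (TFHom F x y) f) =
           FOb (TComp L (TFOb F x) (TFOb F' x) (TFOb F' y)) (FOb (TFHom F' x y) f, \<alpha> x)) \<and>
        (\<forall>\<phi>\<in>Ar (THom K x y).
           FAr (TComp L (TFOb F x) (TFOb F y) (TFOb F' y))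
             (Idt (THom L (TFOb F y) (TFOb F' y)) (\<alpha> y), FAr (TFHom F x y) \<phi>) =
           FAr (TComp L (TFOb F x) (TFOb F' x) (TFOb F' y))
             (FAr (TFHom F' x y) \<phi>, Idt (THom L (TFOb F x) (TFOb F' x)) (\<alpha> x))))"

definition one_cell_iso :: "('o, 'f, 't) twocat \<Rightarrow> 'o \<Rightarrow> 'o \<Rightarrow> 'f \<Rightarrow> bool" where
  "one_cell_iso K x y f \<longleftrightarrow>
     f \<in> Ob (THom K x y) \<and>
     (\<exists>g\<in>Ob (THom K y x). FOb (TComp K x y x) (g, f) = TId K x \<and> FOb (TComp K y x y) (f, g) = TId K y)"

definition two_nat_iso ::
  "('o, 'f, 't) twocat \<Rightarrow> ('o2, 'f2, 't2) twocat \<Rightarrow> ('o, 'f, 't, 'o2, 'f2, 't2) twofun \<Rightarrow>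
   ('o, 'f, 't, 'o2, 'f2, 't2) twofun \<Rightarrow> ('o \<Rightarrow> 'f2) \<Rightarrow> bool" where
  "two_nat_iso K L F F' \<alpha> \<longleftrightarrow>
     two_nat K L F F' \<alpha> \<and> (\<forall>x\<in>TObj K. one_cell_iso L (TFOb F x) (TFOb F' x) (\<alpha> x))"

definition two_equivalent :: "('o, 'f, 't) twocat \<Rightarrow> ('o2, 'f2, 't2) twocat \<Rightarrow> bool" where
  "two_equivalent K L \<longleftrightarrow>
     two_category K \<and> two_category L \<and>
     (\<exists>F G \<eta> \<epsilon>. two_functor K L F \<and> two_functor L K G \<and>
        two_nat_iso K K (two_id K) (two_comp K G F) \<eta> \<and>
        two_nat_iso L L (two_comp L F G) (two_id L) \<epsilon>)"


section \<open>Monoidal categories\<close>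

record ('o, 'm) moncat =
  base :: "('o, 'm) cat"
  tens :: "('o \<times> 'o, 'm \<times> 'm, 'o, 'm) fctr"
  unt  :: 'o
  asc  :: "'o \<Rightarrow> 'o \<Rightarrow> 'o \<Rightarrow> 'm"
  lun  :: "'o \<Rightarrow> 'm"
  run  :: "'o \<Rightarrow> 'm"

abbreviation tensO :: "'o \<Rightarrow> ('o, 'm) moncat \<Rightarrow> 'o \<Rightarrow> 'o"  ("(_ \<otimes>\<^bsub>_\<^esub>/ _)" [76, 0, 75] 75) where
  "a \<otimes>\<^bsub>M\<^esub> b \<equiv> FOb (tens M) (a, b)"

abbreviation tensA :: "'m \<Rightarrow> ('o, 'm) moncat \<Rightarrow> 'm \<Rightarrow> 'm"  ("(_ \<odot>\<^bsub>_\<^esub>/ _)" [76, 0, 75] 75) where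
  "g \<odot>\<^bsub>M\<^esub> f \<equiv> FAr (tens M) (g, f)"

abbreviation mcomp :: "'m \<Rightarrow> ('o, 'm) moncat \<Rightarrow> 'm \<Rightarrow> 'm"  ("(_ \<diamondop>\<^bsub>_\<^esub>/ _)" [70, 0, 71] 70) where
  "g \<diamondop>\<^bsub>M\<^esub> f \<equiv> g \<cdot>\<^bsub>base M\<^esub> f"

abbreviation mid :: "('o, 'm) moncat \<Rightarrow> 'o \<Rightarrow> 'm" where
  "mid M a \<equiv> Idt (base M) a"

definition monoidal_category :: "('o, 'm) moncat \<Rightarrow> bool" where
  "monoidal_category M \<longleftrightarrow>
     category (base M) \<and>
     is_functor (prod_cat (base M) (base M)) (base M) (tens M) \<and>
     unt M \<in> Ob (base M) \<and>
     (\<forall>a\<in>Ob (base M). \<forall>b\<in>Ob (base M). \<forall>c\<in>Ob (base M).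
        iso_between (base M) (asc M a b c) ((a \<otimes>\<^bsub>M\<^esub> b) \<otimes>\<^bsub>M\<^esub> c) (a \<otimes>\<^bsub>M\<^esub> (b \<otimes>\<^bsub>M\<^esub> c))) \<and>
     (\<forall>a\<in>Ob (base M).
        iso_between (base M) (lun M a) (unt M \<otimes>\<^bsub>M\<^esub> a) a \<and>
        iso_between (base M) (run M a) (a \<otimes>\<^bsub>M\<^esub> unt M) a) \<and>
     (\<forall>f\<in>Ar (base M). \<forall>g\<in>Ar (base M). \<forall>h\<in>Ar (base M).
        asc M (Cod (base M) f) (Cod (base M) g) (Cod (base M) h) \<diamondop>\<^bsub>M\<^esub> ((f \<odot>\<^bsub>M\<^esub> g) \<odot>\<^bsub>M\<^esub> h) =
        (f \<odot>\<^bsub>M\<^esub> (g \<odot>\<^bsub>M\<^esub> h)) \<diamondop>\<^bsub>M\<^esub> asc M (Dom (base M) f) (Dom (base M) g) (Dom (base M) h)) \<and>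
     (\<forall>f\<in>Ar (base M).
        lun M (Cod (base M) f) \<diamondop>\<^bsub>M\<^esub> (mid M (unt M) \<odot>\<^bsub>M\<^esub> f) = f \<diamondop>\<^bsub>M\<^esub> lun M (Dom (base M) f) \<and>
        run M (Cod (base M) f) \<diamondop>\<^bsub>M\<^esub> (f \<odot>\<^bsub>M\<^esub> mid M (unt M)) = f \<diamondop>\<^bsub>M\<^esub> run M (Dom (base M) f)) \<and>
     (\<forall>a\<in>Ob (base M). \<forall>b\<in>Ob (base M). \<forall>c\<in>Ob (base M). \<forall>d\<in>Ob (base M).
        asc M a b (c \<otimes>\<^bsub>M\<^esub> d) \<diamondop>\<^bsub>M\<^esub> asc M (a \<otimes>\<^bsub>M\<^esub> b) c d =
        (mid M a \<odot>\<^bsub>M\<^esub> asc M b c d) \<diamondop>\<^bsub>M\<^esub> asc M a (b \<otimes>\<^bsub>M\<^esub> c) d \<diamondop>\<^bsub>M\<^esub> (asc M a b c \<odot>\<^bsub>M\<^esub> mid M d)) \<and>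
     (\<forall>a\<in>Ob (base M). \<forall>b\<in>Ob (base M).
        (mid M a \<odot>\<^bsub>M\<^esub> lun M b) \<diamondop>\<^bsub>M\<^esub> asc M a (unt M) b = run M a \<odot>\<^bsub>M\<^esub> mid M b)"


section \<open>Enriched categories\<close>

record ('o, 'v, 'w) ecat =
  EObj  :: "'o set"
  EHom  :: "'o \<Rightarrow> 'o \<Rightarrow> 'v"
  EId   :: "'o \<Rightarrow> 'w"
  EComp :: "'o \<Rightarrow> 'o \<Rightarrow> 'o \<Rightarrow> 'w"

definition enriched_category :: "('v, 'w) moncat \<Rightarrow> ('o, 'v, 'w) ecat \<Rightarrow> bool" where
  "enriched_category M A \<longleftrightarrow>
     (\<forall>x\<in>EObj A. \<forall>y\<in>EObj A. EHom A x y \<in> Ob (base M)) \<and>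
     (\<forall>x\<in>EObj A. arr_between (base M) (EId A x) (unt M) (EHom A x x)) \<and>
     (\<forall>x\<in>EObj A. \<forall>y\<in>EObj A. \<forall>z\<in>EObj A.
        arr_between (base M) (EComp A x y z) (EHom A y z \<otimes>\<^bsub>M\<^esub> EHom A x y) (EHom A x z)) \<and>
     (\<forall>x\<in>EObj A. \<forall>y\<in>EObj A.
        EComp A x y y \<diamondop>\<^bsub>M\<^esub> (EId A y \<odot>\<^bsub>M\<^esub> mid M (EHom A x y)) = lun M (EHom A x y) \<and>
        EComp A x x y \<diamondop>\<^bsub>M\<^esub> (mid M (EHom A x y) \<odot>\<^bsub>M\<^esub> EId A x) = run M (EHom A x y)) \<and>
     (\<forall>x\<in>EObj A. \<forall>y\<in>EObj A. \<forall>z\<in>EObj A. \<forall>w\<in>EObj A.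
        EComp A x y w \<diamondop>\<^bsub>M\<^esub> (EComp A y z w \<odot>\<^bsub>M\<^esub> mid M (EHom A x y)) =
        EComp A x z w \<diamondop>\<^bsub>M\<^esub> (mid M (EHom A z w) \<odot>\<^bsub>M\<^esub> EComp A x y z)
          \<diamondop>\<^bsub>M\<^esub> asc M (EHom A z w) (EHom A y z) (EHom A x y)) \<and>
     (\<forall>x y. \<not> (x \<in> EObj A \<and> y \<in> EObj A) \<longrightarrow> EHom A x y = undefined) \<and>
     (\<forall>x. x \<notin> EObj A \<longrightarrow> EId A x = undefined) \<and>
     (\<forall>x y z. \<not> (x \<in> EObj A \<and> y \<in> EObj A \<and> z \<in> EObj A) \<longrightarrow> EComp A x y z = undefined)"

record ('o, 'w) efun =
  EFOb :: "'o \<Rightarrow> 'o"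
  EFAr :: "'o \<Rightarrow> 'o \<Rightarrow> 'w"

definition enriched_functor ::
  "('v, 'w) moncat \<Rightarrow> ('o, 'v, 'w) ecat \<Rightarrow> ('o, 'v, 'w) ecat \<Rightarrow> ('o, 'w) efun \<Rightarrow> bool" where
  "enriched_functor M A B F \<longleftrightarrow>
     EFOb F \<in> EObj A \<rightarrow>\<^sub>E EObj B \<and>
     (\<forall>x\<in>EObj A. \<forall>y\<in>EObj A.
        arr_between (base M) (EFAr F x y) (EHom A x y) (EHom B (EFOb F x) (EFOb F y))) \<and>
     (\<forall>x\<in>EObj A. EFAr F x x \<diamondop>\<^bsub>M\<^esub> EId A x = EId B (EFOb F x)) \<and>
     (\<forall>x\<in>EObj A. \<forall>y\<in>EObj A. \<forall>z\<in>EObj A.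
        EFAr F x z \<diamondop>\<^bsub>M\<^esub> EComp A x y z =
        EComp B (EFOb F x) (EFOb F y) (EFOb F z) \<diamondop>\<^bsub>M\<^esub> (EFAr F y z \<odot>\<^bsub>M\<^esub> EFAr F x y)) \<and>
     (\<forall>x y. \<not> (x \<in> EObj A \<and> y \<in> EObj A) \<longrightarrow> EFAr F x y = undefined)"

definition enriched_nat ::
  "('v, 'w) moncat \<Rightarrow> ('o, 'v, 'w) ecat \<Rightarrow> ('o, 'v, 'w) ecat \<Rightarrow> ('o, 'w) efun \<Rightarrow> ('o, 'w) efun
   \<Rightarrow> ('o \<Rightarrow> 'w) \<Rightarrow> bool" where
  "enriched_nat M A B F F' \<alpha> \<longleftrightarrow>
     \<alpha> \<in> extensional (EObj A) \<and>
     (\<forall>x\<in>EObj A. arr_between (base M) (\<alpha> x) (unt M) (EHom B (EFOb F x) (EFOb F' x))) \<and>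
     (\<forall>x\<in>EObj A. \<forall>y\<in>EObj A.
        EComp B (EFOb F x) (EFOb F y) (EFOb F' y) \<diamondop>\<^bsub>M\<^esub> (\<alpha> y \<odot>\<^bsub>M\<^esub> EFAr F x y)
          \<diamondop>\<^bsub>M\<^esub> inv_ar (base M) (lun M (EHom A x y)) =
        EComp B (EFOb F x) (EFOb F' x) (EFOb F' y) \<diamondop>\<^bsub>M\<^esub> (EFAr F' x y \<odot>\<^bsub>M\<^esub> \<alpha> x)
          \<diamondop>\<^bsub>M\<^esub> inv_ar (base M) (run M (EHom A x y)))"

definition eid_fun :: "('v, 'w) moncat \<Rightarrow> ('o, 'v, 'w) ecat \<Rightarrow> ('o, 'w) efun" where
  "eid_fun M A =
     \<lparr>EFOb = restrict (\<lambda>x. x) (EObj A),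
      EFAr = (\<lambda>x y. if x \<in> EObj A \<and> y \<in> EObj A then mid M (EHom A x y) else undefined)\<rparr>"

definition ecomp_fun ::
  "('v, 'w) moncat \<Rightarrow> ('o, 'v, 'w) ecat \<Rightarrow> ('o, 'w) efun \<Rightarrow> ('o, 'w) efun \<Rightarrow> ('o, 'w) efun" where
  "ecomp_fun M A G F =
     \<lparr>EFOb = compose (EObj A) (EFOb G) (EFOb F),
      EFAr = (\<lambda>x y. if x \<in> EObj A \<and> y \<in> EObj A
                    then EFAr G (EFOb F x) (EFOb F y) \<diamondop>\<^bsub>M\<^esub> EFAr F x y else undefined)\<rparr>"

text \<open>
  Composite of the global elements \<open>b : 1 \<rightarrow> C(y,z)\<close> and \<open>a : 1 \<rightarrow> C(x,y)\<close>.
\<close>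

definition ecomp_elt ::
  "('v, 'w) moncat \<Rightarrow> ('o, 'v, 'w) ecat \<Rightarrow> 'o \<Rightarrow> 'o \<Rightarrow> 'o \<Rightarrow> 'w \<Rightarrow> 'w \<Rightarrow> 'w" where
  "ecomp_elt M C x y z b a =
     EComp C x y z \<diamondop>\<^bsub>M\<^esub> (b \<odot>\<^bsub>M\<^esub> a) \<diamondop>\<^bsub>M\<^esub> inv_ar (base M) (lun M (unt M))"

type_synonym ('o, 'w) ecell = "(('o, 'w) efun, 'o \<Rightarrow> 'w) arrow"

definition ecat_hom ::
  "('v, 'w) moncat \<Rightarrow> ('o, 'v, 'w) ecat \<Rightarrow> ('o, 'v, 'w) ecat \<Rightarrow> (('o, 'w) efun, ('o, 'w) ecell) cat" where
  "ecat_hom M A B = mk_cat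
     {F. enriched_functor M A B F}
     {\<alpha>. enriched_functor M A B (src \<alpha>) \<and> enriched_functor M A B (trg \<alpha>) \<and>
         enriched_nat M A B (src \<alpha>) (trg \<alpha>) (mor \<alpha>)}
     src trg
     (\<lambda>F. \<lparr>src = F, mor = (\<lambda>x\<in>EObj A. EId B (EFOb F x)), trg = F\<rparr>)
     (\<lambda>\<beta> \<alpha>. \<lparr>src = src \<alpha>,
              mor = (\<lambda>x\<in>EObj A. ecomp_elt M B (EFOb (src \<alpha>) x) (EFOb (src \<beta>) x) (EFOb (trg \<beta>) x)
                                  (mor \<beta> x) (mor \<alpha> x)),
              trg = trg \<beta>\<rparr>)"

text \<open>
  The 2-category of all enriched categories with objects in \<^typ>\<open>'o\<close>. The horizontal composite of
  \<open>\<alpha> : F \<rightarrow> F'\<close> and \<open>\<beta> : G \<rightarrow> G'\<close> has components \<open>\<beta>\<^sub>F\<^sub>'\<^sub>x \<circ> G \<alpha>\<^sub>x\<close>.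
\<close>

definition ECat ::
  "('v, 'w) moncat \<Rightarrow> (('o, 'v, 'w) ecat, ('o, 'w) efun, ('o, 'w) ecell) twocat" where
  "ECat M =
     \<lparr>TObj = {A. enriched_category M A},
      THom = ecat_hom M,
      TId = eid_fun M,
      TComp = (\<lambda>A B C. mk_fun (prod_cat (ecat_hom M B C) (ecat_hom M A B))
        (\<lambda>(G, F). ecomp_fun M A G F)
        (\<lambda>(\<beta>, \<alpha>). let F = src \<alpha>; F' = trg \<alpha>; G = src \<beta>; G' = trg \<beta> in
           \<lparr>src = ecomp_fun M A G F,
            mor = (\<lambda>x\<in>EObj A.
                     ecomp_elt M C (EFOb G (EFOb F x)) (EFOb G (EFOb F' x)) (EFOb G' (EFOb F' x))
                       (mor \<beta> (EFOb F' x)) (EFAr G (EFOb F x) (EFOb F' x) \<diamondop>\<^bsub>M\<^esub> mor \<alpha> x)),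
            trg = ecomp_fun M A G' F'\<rparr>))\<rparr>"


section \<open>The monoidal category \<open>V\<close>\<close>

text \<open>
  The underlying category is \<open>Cat \<times> Cat\<close>, so an object is a pair \<open>(A\<^sup>+, A\<^sup>-)\<close> of categories with
  objects and arrows in the universe \<^typ>\<open>'u\<close>. HOL products and sums leave this type, so they are
  brought back along an injection \<open>e :: ('u \<times> 'u) + ('u \<times> 'u) \<Rightarrow> 'u\<close>; such an \<open>e\<close> exists for
  every infinite type \<^typ>\<open>'u\<close>. The element \<open>u\<close> is the object of the terminal category.
\<close>

type_synonym 'u enc = "('u \<times> 'u) + ('u \<times> 'u) \<Rightarrow> 'u"

definition V_tensO :: "'u enc \<Rightarrow> 'u scat \<times> 'u scat \<Rightarrow> 'u scat \<times> 'u scat \<Rightarrow> 'u scat \<times> 'u scat" where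
  "V_tensO e A B =
     (copy_cat e (sum_cat (prod_cat (fst A) (fst B)) (prod_cat (snd A) (op_cat (snd B)))),
      copy_cat e (sum_cat (prod_cat (fst A) (snd B)) (prod_cat (snd A) (op_cat (fst B)))))"

text \<open>A functor and its opposite have the same object and arrow maps.\<close>

definition V_tensF :: "'u enc \<Rightarrow> 'u scat \<Rightarrow> 'u scat \<Rightarrow> 'u sfun \<Rightarrow> 'u sfun \<Rightarrow> 'u sfun \<Rightarrow> 'u sfun \<Rightarrow> 'u sfun" where
  "V_tensF e C D F1 G1 F2 G2 =
     \<lparr>src = C,
      mor = mk_fun C
        (e \<circ> map_sum (map_prod (FOb (mor F1)) (FOb (mor G1))) (map_prod (FOb (mor F2)) (FOb (mor G2))) \<circ> inv e)
        (e \<circ> map_sum (map_prod (FAr (mor F1)) (FAr (mor G1))) (map_prod (FAr (mor F2)) (FAr (mor G2))) \<circ> inv e),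
      trg = D\<rparr>"

definition V_tensA :: "'u enc \<Rightarrow> 'u sfun \<times> 'u sfun \<Rightarrow> 'u sfun \<times> 'u sfun \<Rightarrow> 'u sfun \<times> 'u sfun" where
  "V_tensA e F G =
     (let C = V_tensO e (src (fst F), src (snd F)) (src (fst G), src (snd G));
          D = V_tensO e (trg (fst F), trg (snd F)) (trg (fst G), trg (snd G))
      in (V_tensF e (fst C) (fst D) (fst F) (fst G) (snd F) (snd G),
          V_tensF e (snd C) (snd D) (fst F) (snd G) (snd F) (fst G)))"

text \<open>
  The evident constraint isomorphisms. For each of them the same formula describes both
  components, on objects as well as on arrows. In \<open>(A \<otimes> B) \<otimes> C\<close> the summands are indexed by the
  variances of \<open>A \<otimes> B\<close> and \<open>A\<close> or \<open>B\<close>, so reassociating permutes the four summands: for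
  instance \<open>(A\<^sup>- \<times> (B\<^sup>-)\<^sup>o\<^sup>p) \<times> C\<^sup>+\<close> goes to \<open>A\<^sup>- \<times> (B\<^sup>- \<times> (C\<^sup>+)\<^sup>o\<^sup>p)\<^sup>o\<^sup>p\<close>.
\<close>

definition V_asc_map :: "'u enc \<Rightarrow> 'u \<Rightarrow> 'u" where
  "V_asc_map e t = (case inv e t of
      Inl (s, c) \<Rightarrow> (case inv e s of
          Inl (a, b) \<Rightarrow> e (Inl (a, e (Inl (b, c))))
        | Inr (a, b) \<Rightarrow> e (Inr (a, e (Inr (b, c)))))
    | Inr (s, c) \<Rightarrow> (case inv e s of
          Inl (a, b) \<Rightarrow> e (Inl (a, e (Inr (b, c))))
        | Inr (a, b) \<Rightarrow> e (Inr (a, e (Inl (b, c))))))"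

definition V_lun_map :: "'u enc \<Rightarrow> 'u \<Rightarrow> 'u" where
  "V_lun_map e t = (case inv e t of Inl (_, a) \<Rightarrow> a | Inr (_, a) \<Rightarrow> a)"

definition V_run_map :: "'u enc \<Rightarrow> 'u \<Rightarrow> 'u" where
  "V_run_map e t = (case inv e t of Inl (a, _) \<Rightarrow> a | Inr (a, _) \<Rightarrow> a)"

definition V_arrow :: "('u \<Rightarrow> 'u) \<Rightarrow> 'u scat \<times> 'u scat \<Rightarrow> 'u scat \<times> 'u scat \<Rightarrow> 'u sfun \<times> 'u sfun" where
  "V_arrow p A B =
     (\<lparr>src = fst A, mor = mk_fun (fst A) p p, trg = fst B\<rparr>,
      \<lparr>src = snd A, mor = mk_fun (snd A) p p, trg = snd B\<rparr>)"

definition V_unit :: "'u \<Rightarrow> 'u scat \<times> 'u scat" where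
  "V_unit u = (terminal_cat u, empty_cat)"

definition V :: "'u enc \<Rightarrow> 'u \<Rightarrow> ('u scat \<times> 'u scat, 'u sfun \<times> 'u sfun) moncat" where
  "V e u =
     \<lparr>base = prod_cat Cat Cat,
      tens = mk_fun (prod_cat (prod_cat Cat Cat) (prod_cat Cat Cat))
               (\<lambda>(A, B). V_tensO e A B) (\<lambda>(F, G). V_tensA e F G),
      unt = V_unit u,
      asc = (\<lambda>A B C. V_arrow (V_asc_map e) (V_tensO e (V_tensO e A B) C) (V_tensO e A (V_tensO e B C))),
      lun = (\<lambda>A. V_arrow (V_lun_map e) (V_tensO e (V_unit u) A) A),
      run = (\<lambda>A. V_arrow (V_run_map e) (V_tensO e A (V_unit u)) A)\<rparr>"


section \<open>2-categories with contravariance\<close>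

datatype variance = Covar | Contravar

fun vmul :: "variance \<Rightarrow> variance \<Rightarrow> variance" where
  "vmul Covar w = w"
| "vmul Contravar Covar = Contravar"
| "vmul Contravar Contravar = Covar"

fun vop :: "variance \<Rightarrow> ('o, 'm) cat \<Rightarrow> ('o, 'm) cat" where
  "vop Covar C = C"
| "vop Contravar C = op_cat C"

text \<open>
  The four composition functors are
  \<open>CComp A v w x y z : A\<^sup>v(y,z) \<times> A\<^sup>w(x,y) \<rightarrow> A\<^sup>v\<^sup>w(x,z)\<close>, where the second factor is
  replaced by its opposite if \<open>v\<close> is contravariant.
\<close>

record ('o, 'u) ccat =
  CObj  :: "'o set"
  CHom  :: "variance \<Rightarrow> 'o \<Rightarrow> 'o \<Rightarrow> 'u scat"
  CId   :: "'o \<Rightarrow> 'u"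
  CComp :: "variance \<Rightarrow> variance \<Rightarrow> 'o \<Rightarrow> 'o \<Rightarrow> 'o \<Rightarrow> ('u \<times> 'u, 'u \<times> 'u, 'u, 'u) fctr"

definition contra_category :: "('o, 'u) ccat \<Rightarrow> bool" where
  "contra_category A \<longleftrightarrow>
     (\<forall>v. \<forall>x\<in>CObj A. \<forall>y\<in>CObj A. category (CHom A v x y)) \<and>
     (\<forall>x\<in>CObj A. CId A x \<in> Ob (CHom A Covar x x)) \<and>
     (\<forall>v w. \<forall>x\<in>CObj A. \<forall>y\<in>CObj A. \<forall>z\<in>CObj A.
        is_functor (prod_cat (CHom A v y z) (vop v (CHom A w x y))) (CHom A (vmul v w) x z)
          (CComp A v w x y z)) \<and>
     (\<forall>v. \<forall>x\<in>CObj A. \<forall>y\<in>CObj A.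
        (\<forall>f\<in>Ob (CHom A v x y).
           FOb (CComp A Covar v x y y) (CId A y, f) = f \<and>
           FOb (CComp A v Covar x x y) (f, CId A x) = f) \<and>
        (\<forall>\<phi>\<in>Ar (CHom A v x y).
           FAr (CComp A Covar v x y y) (Idt (CHom A Covar y y) (CId A y), \<phi>) = \<phi> \<and>
           FAr (CComp A v Covar x x y) (\<phi>, Idt (CHom A Covar x x) (CId A x)) = \<phi>)) \<and>
     (\<forall>u v w. \<forall>x\<in>CObj A. \<forall>y\<in>CObj A. \<forall>z\<in>CObj A. \<forall>t\<in>CObj A.
        (\<forall>h\<in>Ob (CHom A u z t). \<forall>g\<in>Ob (CHom A v y z). \<forall>f\<in>Ob (CHom A w x y).
           FOb (CComp A u (vmul v w) x z t) (h, FOb (CComp A v w x y z) (g, f)) =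
           FOb (CComp A (vmul u v) w x y t) (FOb (CComp A u v y z t) (h, g), f)) \<and>
        (\<forall>\<theta>\<in>Ar (CHom A u z t). \<forall>\<psi>\<in>Ar (CHom A v y z). \<forall>\<phi>\<in>Ar (CHom A w x y).
           FAr (CComp A u (vmul v w) x z t) (\<theta>, FAr (CComp A v w x y z) (\<psi>, \<phi>)) =
           FAr (CComp A (vmul u v) w x y t) (FAr (CComp A u v y z t) (\<theta>, \<psi>), \<phi>))) \<and>
     (\<forall>v x y. \<not> (x \<in> CObj A \<and> y \<in> CObj A) \<longrightarrow> CHom A v x y = undefined) \<and>
     (\<forall>x. x \<notin> CObj A \<longrightarrow> CId A x = undefined) \<and>
     (\<forall>v w x y z. \<not> (x \<in> CObj A \<and> y \<in> CObj A \<and> z \<in> CObj A) \<longrightarrow> CComp A v w x y z = undefined)"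

record ('o, 'u) cfun =
  CFOb  :: "'o \<Rightarrow> 'o"
  CFHom :: "variance \<Rightarrow> 'o \<Rightarrow> 'o \<Rightarrow> ('u, 'u, 'u, 'u) fctr"

definition contra_functor :: "('o, 'u) ccat \<Rightarrow> ('o, 'u) ccat \<Rightarrow> ('o, 'u) cfun \<Rightarrow> bool" where
  "contra_functor A B F \<longleftrightarrow>
     CFOb F \<in> CObj A \<rightarrow>\<^sub>E CObj B \<and>
     (\<forall>v. \<forall>x\<in>CObj A. \<forall>y\<in>CObj A.
        is_functor (CHom A v x y) (CHom B v (CFOb F x) (CFOb F y)) (CFHom F v x y)) \<and>
     (\<forall>x\<in>CObj A. FOb (CFHom F Covar x x) (CId A x) = CId B (CFOb F x)) \<and>
     (\<forall>v w. \<forall>x\<in>CObj A. \<forall>y\<in>CObj A. \<forall>z\<in>CObj A.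
        (\<forall>g\<in>Ob (CHom A v y z). \<forall>f\<in>Ob (CHom A w x y).
           FOb (CFHom F (vmul v w) x z) (FOb (CComp A v w x y z) (g, f)) =
           FOb (CComp B v w (CFOb F x) (CFOb F y) (CFOb F z)) (FOb (CFHom F v y z) g, FOb (CFHom F w x y) f)) \<and>
        (\<forall>\<psi>\<in>Ar (CHom A v y z). \<forall>\<phi>\<in>Ar (CHom A w x y).
           FAr (CFHom F (vmul v w) x z) (FAr (CComp A v w x y z) (\<psi>, \<phi>)) =
           FAr (CComp B v w (CFOb F x) (CFOb F y) (CFOb F z)) (FAr (CFHom F v y z) \<psi>, FAr (CFHom F w x y) \<phi>))) \<and>
     (\<forall>v x y. \<not> (x \<in> CObj A \<and> y \<in> CObj A) \<longrightarrow> CFHom F v x y = undefined)"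

definition contra_nat ::
  "('o, 'u) ccat \<Rightarrow> ('o, 'u) ccat \<Rightarrow> ('o, 'u) cfun \<Rightarrow> ('o, 'u) cfun \<Rightarrow> ('o \<Rightarrow> 'u) \<Rightarrow> bool" where
  "contra_nat A B F F' \<alpha> \<longleftrightarrow>
     \<alpha> \<in> extensional (CObj A) \<and>
     (\<forall>x\<in>CObj A. \<alpha> x \<in> Ob (CHom B Covar (CFOb F x) (CFOb F' x))) \<and>
     (\<forall>v. \<forall>x\<in>CObj A. \<forall>y\<in>CObj A.
        (\<forall>f\<in>Ob (CHom A v x y).
           FOb (CComp B Covar v (CFOb F x) (CFOb F y) (CFOb F' y)) (\<alpha> y, FOb (CFHom F v x y) f) =
           FOb (CComp B v Covar (CFOb F x) (CFOb F' x) (CFOb F' y)) (FOb (CFHom F' v x y) f, \<alpha> x)) \<and>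
        (\<forall>\<phi>\<in>Ar (CHom A v x y).
           FAr (CComp B Covar v (CFOb F x) (CFOb F y) (CFOb F' y))
             (Idt (CHom B Covar (CFOb F y) (CFOb F' y)) (\<alpha> y), FAr (CFHom F v x y) \<phi>) =
           FAr (CComp B v Covar (CFOb F x) (CFOb F' x) (CFOb F' y))
             (FAr (CFHom F' v x y) \<phi>, Idt (CHom B Covar (CFOb F x) (CFOb F' x)) (\<alpha> x))))"

definition cid_fun :: "('o, 'u) ccat \<Rightarrow> ('o, 'u) cfun" where
  "cid_fun A =
     \<lparr>CFOb = restrict (\<lambda>x. x) (CObj A),
      CFHom = (\<lambda>v x y. if x \<in> CObj A \<and> y \<in> CObj A then id_fun (CHom A v x y) else undefined)\<rparr>"

definition ccomp_fun :: "('o, 'u) ccat \<Rightarrow> ('o, 'u) cfun \<Rightarrow> ('o, 'u) cfun \<Rightarrow> ('o, 'u) cfun" where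
  "ccomp_fun A G F =
     \<lparr>CFOb = compose (CObj A) (CFOb G) (CFOb F),
      CFHom = (\<lambda>v x y. if x \<in> CObj A \<and> y \<in> CObj A
                       then comp_fun (CHom A v x y) (CFHom G v (CFOb F x) (CFOb F y)) (CFHom F v x y)
                       else undefined)\<rparr>"

type_synonym ('o, 'u) ccell = "(('o, 'u) cfun, 'o \<Rightarrow> 'u) arrow"

definition ccat_hom :: "('o, 'u) ccat \<Rightarrow> ('o, 'u) ccat \<Rightarrow> (('o, 'u) cfun, ('o, 'u) ccell) cat" where
  "ccat_hom A B = mk_cat
     {F. contra_functor A B F}
     {\<alpha>. contra_functor A B (src \<alpha>) \<and> contra_functor A B (trg \<alpha>) \<and>
         contra_nat A B (src \<alpha>) (trg \<alpha>) (mor \<alpha>)}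
     src trg
     (\<lambda>F. \<lparr>src = F, mor = (\<lambda>x\<in>CObj A. CId B (CFOb F x)), trg = F\<rparr>)
     (\<lambda>\<beta> \<alpha>. \<lparr>src = src \<alpha>,
              mor = (\<lambda>x\<in>CObj A.
                       FOb (CComp B Covar Covar (CFOb (src \<alpha>) x) (CFOb (src \<beta>) x) (CFOb (trg \<beta>) x))
                         (mor \<beta> x, mor \<alpha> x)),
              trg = trg \<beta>\<rparr>)"

definition CCat :: "(('o, 'u) ccat, ('o, 'u) cfun, ('o, 'u) ccell) twocat" where
  "CCat =
     \<lparr>TObj = {A. contra_category A},
      THom = ccat_hom,
      TId = cid_fun,
      TComp = (\<lambda>A B C. mk_fun (prod_cat (ccat_hom B C) (ccat_hom A B))
        (\<lambda>(G, F). ccomp_fun A G F)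
        (\<lambda>(\<beta>, \<alpha>). let F = src \<alpha>; F' = trg \<alpha>; G = src \<beta>; G' = trg \<beta> in
           \<lparr>src = ccomp_fun A G F,
            mor = (\<lambda>x\<in>CObj A.
                     FOb (CComp C Covar Covar (CFOb G (CFOb F x)) (CFOb G (CFOb F' x)) (CFOb G' (CFOb F' x)))
                       (mor \<beta> (CFOb F' x), FOb (CFHom G Covar (CFOb F x) (CFOb F' x)) (mor \<alpha> x))),
            trg = ccomp_fun A G' F'\<rparr>))\<rparr>"

end

(*
An arrow A (x) B -> C of V is, summand by summand, the same as a family of functors
A^v x (B^w)^(op if v = -) -> C^(vw), and an arrow 1 -> A is the same as an object of A^+. Hence the
hom-objects, units and compositions of a V-category are exactly the data of a 2-category with
contravariance, and evaluating the enriched axioms on elements of the summands gives the unit laws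
and the eight associativity laws. The same holds for functors and transformations, so the passage is
bijective on objects, 1-cells and 2-cells and compatible with all operations. The 2-category laws
are verified for 2-categories with contravariance, where they are elementary, and are transported
along this isomorphism, which is in particular a 2-equivalence.
*)

theory Submission
  imports Defs
begin

section \<open>Categories\<close>

text \<open>The obstacle is the amount of case analysis: two variances for each factor, objects and
  arrows separately, and an opposite in half of the summands. Three devices remove it. Variances are
  treated as the group of order two, so that a summand of A \<otimes> B at total variance w is
  indexed by one variance v and has second factor of variance vw; the eight associativity laws
  become one. A kind variable treats objects and arrows together. Opposites change neither elements
  nor the maps of a functor, so they matter only in proofs of functoriality and are invisible in
  equations between arrows of V, which are compared through their action on elements. Strict
  bijectivity rests on the extensionality clauses: structure maps are \<open>undefined\<close> off
  their domains. Well-typed data (\<open>pre_contra\<close>, \<open>pre_enr\<close>) is kept apart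
  from the equational axioms; once the data correspond, each group of axioms is equivalent to its
  counterpart, which gives both directions at once.\<close>

lemma mk_cat_sel [simp]:
  "Ob (mk_cat X A d c i m) = X" "Ar (mk_cat X A d c i m) = A"
  "f \<in> A \<Longrightarrow> Dom (mk_cat X A d c i m) f = d f"
  "f \<in> A \<Longrightarrow> Cod (mk_cat X A d c i m) f = c f"
  "a \<in> X \<Longrightarrow> Idt (mk_cat X A d c i m) a = i a"
  "g \<in> A \<Longrightarrow> f \<in> A \<Longrightarrow> d g = c f \<Longrightarrow> g \<cdot>\<^bsub>mk_cat X A d c i m\<^esub> f = m g f"
  "composable (mk_cat X A d c i m) g f \<longleftrightarrow> g \<in> A \<and> f \<in> A \<and> d g = c f"
  by (auto simp: mk_cat_def composable_def)

lemma category_mk_catI: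
  assumes "\<And>f. f \<in> A \<Longrightarrow> d f \<in> X" "\<And>f. f \<in> A \<Longrightarrow> c f \<in> X" "\<And>a. a \<in> X \<Longrightarrow> i a \<in> A"
    "\<And>a. a \<in> X \<Longrightarrow> d (i a) = a" "\<And>a. a \<in> X \<Longrightarrow> c (i a) = a"
    "\<And>g f. g \<in> A \<Longrightarrow> f \<in> A \<Longrightarrow> d g = c f \<Longrightarrow> m g f \<in> A"
    "\<And>g f. g \<in> A \<Longrightarrow> f \<in> A \<Longrightarrow> d g = c f \<Longrightarrow> d (m g f) = d f"
    "\<And>g f. g \<in> A \<Longrightarrow> f \<in> A \<Longrightarrow> d g = c f \<Longrightarrow> c (m g f) = c g"
    "\<And>f. f \<in> A \<Longrightarrow> m f (i (d f)) = f" "\<And>f. f \<in> A \<Longrightarrow> m (i (c f)) f = f"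
    "\<And>h g f. h \<in> A \<Longrightarrow> g \<in> A \<Longrightarrow> f \<in> A \<Longrightarrow> d h = c g \<Longrightarrow> d g = c f \<Longrightarrow> m (m h g) f = m h (m g f)"
  shows "category (mk_cat X A d c i m)"
  unfolding category_def using assms by (auto simp: mk_cat_def composable_def)

context
  fixes C :: "('o, 'm) cat"
  assumes C: "category C"
begin

lemma cat_Dom [simp]: "f \<in> Ar C \<Longrightarrow> Dom C f \<in> Ob C"
  and cat_Cod [simp]: "f \<in> Ar C \<Longrightarrow> Cod C f \<in> Ob C"
  and cat_Idt [simp]: "a \<in> Ob C \<Longrightarrow> Idt C a \<in> Ar C"
  and cat_Dom_Idt [simp]: "a \<in> Ob C \<Longrightarrow> Dom C (Idt C a) = a"
  and cat_Cod_Idt [simp]: "a \<in> Ob C \<Longrightarrow> Cod C (Idt C a) = a"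
  using C unfolding category_def by (auto simp: PiE_def Pi_def)

lemma cat_Cmp [simp]:
  assumes "g \<in> Ar C" "f \<in> Ar C" "Dom C g = Cod C f"
  shows "g \<cdot>\<^bsub>C\<^esub> f \<in> Ar C" "Dom C (g \<cdot>\<^bsub>C\<^esub> f) = Dom C f" "Cod C (g \<cdot>\<^bsub>C\<^esub> f) = Cod C g"
  using C assms unfolding category_def composable_def by blast+

lemma cat_Cmp_Idt [simp]:
  "f \<in> Ar C \<Longrightarrow> Dom C f = a \<Longrightarrow> f \<cdot>\<^bsub>C\<^esub> Idt C a = f"
  "f \<in> Ar C \<Longrightarrow> Cod C f = a \<Longrightarrow> Idt C a \<cdot>\<^bsub>C\<^esub> f = f"
  using C unfolding category_def by auto

lemma cat_assoc:
  assumes "h \<in> Ar C" "g \<in> Ar C" "f \<in> Ar C" "Dom C h = Cod C g" "Dom C g = Cod C f"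
  shows "(h \<cdot>\<^bsub>C\<^esub> g) \<cdot>\<^bsub>C\<^esub> f = h \<cdot>\<^bsub>C\<^esub> (g \<cdot>\<^bsub>C\<^esub> f)"
  using C assms unfolding category_def composable_def by blast

lemma cat_eta: "mk_cat (Ob C) (Ar C) (Dom C) (Cod C) (Idt C) (Cmp C) = C"
  using C unfolding category_def mk_cat_def composable_def
  by (intro cat.equality) (auto simp: fun_eq_iff restrict_def PiE_def extensional_def)

end

lemma inverse_arrows_unique:
  assumes C: "category C" and g: "inverse_arrows C f g" and h: "inverse_arrows C f h"
  shows "g = h"
proof -
  have "g = (h \<cdot>\<^bsub>C\<^esub> f) \<cdot>\<^bsub>C\<^esub> g" using assms by (simp add: inverse_arrows_def arr_between_def)
  also have "\<dots> = h \<cdot>\<^bsub>C\<^esub> (f \<cdot>\<^bsub>C\<^esub> g)"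
    using assms by (intro cat_assoc) (auto simp: inverse_arrows_def arr_between_def)
  also have "\<dots> = h" using assms by (simp add: inverse_arrows_def arr_between_def)
  finally show ?thesis .
qed

lemma inv_ar_eqI: "category C \<Longrightarrow> inverse_arrows C f g \<Longrightarrow> inv_ar C f = g"
  unfolding inv_ar_def by (blast intro: inverse_arrows_unique)

section \<open>Opposites, products, sums and copies of categories\<close>

lemma category_op_cat [simp]: "category C \<Longrightarrow> category (op_cat C)"
  unfolding op_cat_def by (rule category_mk_catI) (auto simp: cat_assoc)

lemma category_prod_cat [simp]: "category C \<Longrightarrow> category D \<Longrightarrow> category (prod_cat C D)"
  unfolding prod_cat_def by (rule category_mk_catI) (auto simp: cat_assoc)

lemma category_sum_cat: "category C \<Longrightarrow> category D \<Longrightarrow> category (sum_cat C D)"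
  unfolding sum_cat_def by (rule category_mk_catI) (auto simp: cat_assoc)

lemma category_copy_cat: "inj e \<Longrightarrow> category C \<Longrightarrow> category (copy_cat e C)"
  unfolding copy_cat_def by (rule category_mk_catI) (auto simp: cat_assoc inj_eq)

lemma category_terminal_cat: "category (terminal_cat u)"
  unfolding terminal_cat_def by (rule category_mk_catI) auto

lemma category_empty_cat: "category empty_cat"
  unfolding empty_cat_def by (rule category_mk_catI) auto

lemma op_cat_sel [simp]:
  "Ob (op_cat C) = Ob C" "Ar (op_cat C) = Ar C"
  "f \<in> Ar C \<Longrightarrow> Dom (op_cat C) f = Cod C f" "f \<in> Ar C \<Longrightarrow> Cod (op_cat C) f = Dom C f"
  "a \<in> Ob C \<Longrightarrow> Idt (op_cat C) a = Idt C a"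
  "g \<in> Ar C \<Longrightarrow> f \<in> Ar C \<Longrightarrow> Dom C f = Cod C g \<Longrightarrow> g \<cdot>\<^bsub>op_cat C\<^esub> f = f \<cdot>\<^bsub>C\<^esub> g"
  by (auto simp: op_cat_def)

lemma op_cat_Cmp: "composable C f g \<Longrightarrow> g \<cdot>\<^bsub>op_cat C\<^esub> f = f \<cdot>\<^bsub>C\<^esub> g"
  by (simp add: composable_def)

lemma composable_op [simp]: "composable (op_cat C) g f \<longleftrightarrow> composable C f g"
  by (auto simp: composable_def)

lemma prod_cat_sel [simp]:
  "Ob (prod_cat C D) = Ob C \<times> Ob D" "Ar (prod_cat C D) = Ar C \<times> Ar D"
  "f \<in> Ar C \<Longrightarrow> f' \<in> Ar D \<Longrightarrow> Dom (prod_cat C D) (f, f') = (Dom C f, Dom D f')"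
  "f \<in> Ar C \<Longrightarrow> f' \<in> Ar D \<Longrightarrow> Cod (prod_cat C D) (f, f') = (Cod C f, Cod D f')"
  "a \<in> Ob C \<Longrightarrow> a' \<in> Ob D \<Longrightarrow> Idt (prod_cat C D) (a, a') = (Idt C a, Idt D a')"
  "composable C g f \<Longrightarrow> composable D g' f' \<Longrightarrow>
    (g, g') \<cdot>\<^bsub>prod_cat C D\<^esub> (f, f') = (g \<cdot>\<^bsub>C\<^esub> f, g' \<cdot>\<^bsub>D\<^esub> f')"
  "composable (prod_cat C D) (g, g') (f, f') \<longleftrightarrow> composable C g f \<and> composable D g' f'"
  by (auto simp: prod_cat_def composable_def)

section \<open>Functors and the category of categories\<close>

lemma mk_fun_sel [simp]:
  "a \<in> Ob C \<Longrightarrow> FOb (mk_fun C p q) a = p a" "f \<in> Ar C \<Longrightarrow> FAr (mk_fun C p q) f = q f"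
  by (auto simp: mk_fun_def)

lemma is_functor_mk_funI:
  assumes "category C"
    and "\<And>a. a \<in> Ob C \<Longrightarrow> p a \<in> Ob D" "\<And>f. f \<in> Ar C \<Longrightarrow> q f \<in> Ar D"
    "\<And>f. f \<in> Ar C \<Longrightarrow> Dom D (q f) = p (Dom C f)" "\<And>f. f \<in> Ar C \<Longrightarrow> Cod D (q f) = p (Cod C f)"
    "\<And>a. a \<in> Ob C \<Longrightarrow> q (Idt C a) = Idt D (p a)"
    "\<And>g f. composable C g f \<Longrightarrow> q (g \<cdot>\<^bsub>C\<^esub> f) = q g \<cdot>\<^bsub>D\<^esub> q f"
  shows "is_functor C D (mk_fun C p q)"
  using assms unfolding is_functor_def mk_fun_def composable_def by auto

lemma functorD:
  assumes "is_functor C D F"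
  shows "a \<in> Ob C \<Longrightarrow> FOb F a \<in> Ob D" "f \<in> Ar C \<Longrightarrow> FAr F f \<in> Ar D"
    "f \<in> Ar C \<Longrightarrow> Dom D (FAr F f) = FOb F (Dom C f)"
    "f \<in> Ar C \<Longrightarrow> Cod D (FAr F f) = FOb F (Cod C f)"
    "a \<in> Ob C \<Longrightarrow> FAr F (Idt C a) = Idt D (FOb F a)"
    "composable C g f \<Longrightarrow> FAr F (g \<cdot>\<^bsub>C\<^esub> f) = FAr F g \<cdot>\<^bsub>D\<^esub> FAr F f"
    "composable C g f \<Longrightarrow> composable D (FAr F g) (FAr F f)"
  using assms unfolding is_functor_def composable_def by auto

text \<open>Truncation to a domain is idempotent, so a functor built by \<open>mk_fun\<close> can be
  rebuilt from its own two maps. In this form the composition functors of the 2-category of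
  V-categories enter the transport along an isomorphism.\<close>

lemma mk_fun_idem: "mk_fun C (FOb (mk_fun C p q)) (FAr (mk_fun C p q)) = mk_fun C p q"
  by (auto simp: mk_fun_def)

lemma functor_extensional:
  assumes "is_functor C D F"
  shows "FOb F \<in> extensional (Ob C)" "FAr F \<in> extensional (Ar C)"
  using assms by (auto simp: is_functor_def PiE_def)

lemma mk_fun_eqI:
  assumes "FOb F \<in> extensional (Ob C)" "FAr F \<in> extensional (Ar C)"
    "\<And>a. a \<in> Ob C \<Longrightarrow> p a = FOb F a" "\<And>f. f \<in> Ar C \<Longrightarrow> q f = FAr F f"
  shows "mk_fun C p q = F"
  using assms by (intro fctr.equality) (auto simp: mk_fun_def extensional_def fun_eq_iff)

lemma functor_eta: "is_functor C D F \<Longrightarrow> mk_fun C (FOb F) (FAr F) = F"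
  by (rule mk_fun_eqI) (auto simp: is_functor_def PiE_def)

lemma functor_eqI:
  assumes "is_functor C D F" "is_functor C D' G"
    "\<And>a. a \<in> Ob C \<Longrightarrow> FOb F a = FOb G a" "\<And>f. f \<in> Ar C \<Longrightarrow> FAr F f = FAr G f"
  shows "F = G"
  using mk_fun_eqI [of G C "FOb F" "FAr F"] functor_eta [OF assms(1)] assms
  by (auto simp: is_functor_def PiE_def)

lemma mk_fun_cong:
  "(\<And>a. a \<in> Ob C \<Longrightarrow> p a = p' a) \<Longrightarrow> (\<And>f. f \<in> Ar C \<Longrightarrow> q f = q' f) \<Longrightarrow> mk_fun C p q = mk_fun C p' q'"
  by (auto simp: mk_fun_def fun_eq_iff)

lemma id_fun_sel [simp]:
  "a \<in> Ob C \<Longrightarrow> FOb (id_fun C) a = a" "f \<in> Ar C \<Longrightarrow> FAr (id_fun C) f = f"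
  by (auto simp: id_fun_def)

lemma comp_fun_sel [simp]:
  "a \<in> Ob C \<Longrightarrow> FOb (comp_fun C G F) a = FOb G (FOb F a)"
  "f \<in> Ar C \<Longrightarrow> FAr (comp_fun C G F) f = FAr G (FAr F f)"
  by (auto simp: comp_fun_def)

lemma is_functor_id_fun: "category C \<Longrightarrow> is_functor C C (id_fun C)"
  unfolding id_fun_def by (rule is_functor_mk_funI) auto

lemma is_functor_comp_fun:
  "category C \<Longrightarrow> is_functor C D F \<Longrightarrow> is_functor D E G \<Longrightarrow> is_functor C E (comp_fun C G F)"
  unfolding comp_fun_def by (rule is_functor_mk_funI) (simp_all add: functorD)

lemma comp_fun_id [simp]:
  "is_functor C D F \<Longrightarrow> category C \<Longrightarrow> comp_fun C F (id_fun C) = F"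
  "is_functor C D F \<Longrightarrow> category C \<Longrightarrow> comp_fun C (id_fun D) F = F"
  unfolding comp_fun_def
  by (rule mk_fun_eqI; simp add: functorD functor_extensional; fail)+

lemma comp_fun_assoc:
  "is_functor C D F \<Longrightarrow> comp_fun C (comp_fun D H G) F = comp_fun C H (comp_fun C G F)"
  unfolding comp_fun_def by (rule mk_fun_cong) (auto simp: functorD)

lemma category_Cat: "category Cat"
  unfolding Cat_def
  by (rule category_mk_catI) (auto simp: is_functor_id_fun is_functor_comp_fun comp_fun_assoc)

lemma copy_cat_sel [simp]:
  assumes "inj e"
  shows "f \<in> Ar C \<Longrightarrow> Dom (copy_cat e C) (e f) = e (Dom C f)"
    "f \<in> Ar C \<Longrightarrow> Cod (copy_cat e C) (e f) = e (Cod C f)"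
    "a \<in> Ob C \<Longrightarrow> Idt (copy_cat e C) (e a) = e (Idt C a)"
    "g \<in> Ar C \<Longrightarrow> f \<in> Ar C \<Longrightarrow> Dom C g = Cod C f \<Longrightarrow> e g \<cdot>\<^bsub>copy_cat e C\<^esub> e f = e (g \<cdot>\<^bsub>C\<^esub> f)"
  using assms by (auto simp: copy_cat_def)

lemma in_Plus [simp]: "Inl a \<in> A <+> B \<longleftrightarrow> a \<in> A" "Inr b \<in> A <+> B \<longleftrightarrow> b \<in> B"
  by auto

lemma sum_cat_sel [simp]:
  "Ob (sum_cat C D) = Ob C <+> Ob D" "Ar (sum_cat C D) = Ar C <+> Ar D"
  "f \<in> Ar C \<Longrightarrow> Dom (sum_cat C D) (Inl f) = Inl (Dom C f)"
  "g \<in> Ar D \<Longrightarrow> Dom (sum_cat C D) (Inr g) = Inr (Dom D g)"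
  "f \<in> Ar C \<Longrightarrow> Cod (sum_cat C D) (Inl f) = Inl (Cod C f)"
  "g \<in> Ar D \<Longrightarrow> Cod (sum_cat C D) (Inr g) = Inr (Cod D g)"
  "a \<in> Ob C \<Longrightarrow> Idt (sum_cat C D) (Inl a) = Inl (Idt C a)"
  "b \<in> Ob D \<Longrightarrow> Idt (sum_cat C D) (Inr b) = Inr (Idt D b)"
  "f \<in> Ar C \<Longrightarrow> f' \<in> Ar C \<Longrightarrow> Dom C f = Cod C f' \<Longrightarrow>
    Inl f \<cdot>\<^bsub>sum_cat C D\<^esub> Inl f' = Inl (f \<cdot>\<^bsub>C\<^esub> f')"
  "g \<in> Ar D \<Longrightarrow> g' \<in> Ar D \<Longrightarrow> Dom D g = Cod D g' \<Longrightarrow>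
    Inr g \<cdot>\<^bsub>sum_cat C D\<^esub> Inr g' = Inr (g \<cdot>\<^bsub>D\<^esub> g')"
  by (simp_all add: sum_cat_def Plus_def)

section \<open>The tensor product, elementwise\<close>

fun prj :: "variance \<Rightarrow> 'a \<times> 'a \<Rightarrow> 'a" where
  "prj Covar p = fst p"
| "prj Contravar p = snd p"

lemma prj_eqI: "(\<And>v. prj v p = prj v q) \<Longrightarrow> p = q"
  by (metis prj.simps prod_eqI)

lemma all_variance: "(\<forall>v. P v) \<longleftrightarrow> P Covar \<and> P Contravar"
  by (metis variance.exhaust)

text \<open>The variances form the group of order two with unit \<open>Covar\<close>. Since every
  variance is its own inverse, v and the product vw determine w; this is how the variance of a
  second factor is recovered from the summand and the total variance.\<close>

lemma vmul_simps [simp]: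
  "vmul v Covar = v" "vmul v v = Covar" "vmul v (vmul v w) = w" "vmul (vmul v w) w = v"
  "vmul (vmul u v) w = vmul u (vmul v w)"
  by (cases u; cases v; cases w; simp)+

lemma vmul_eq_Covar [simp]: "vmul v w = Covar \<longleftrightarrow> v = w"
  by (cases v; cases w; simp)

lemma vmul_left_comm: "vmul x (vmul v w) = vmul v (vmul x w)"
  by (cases x; cases v; cases w; simp)

text \<open>An opposite keeps objects, arrows and identities; source, target and composition are
  absent because they do change. Elements can therefore be moved freely in and out of
  \<open>vop\<close>.\<close>

lemma vop_sel [simp]:
  "Ob (vop v C) = Ob C" "Ar (vop v C) = Ar C" "a \<in> Ob C \<Longrightarrow> Idt (vop v C) a = Idt C a"
  by (cases v; simp)+

lemma category_vop [simp]: "category C \<Longrightarrow> category (vop v C)"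
  by (cases v) auto

lemma ex_variance: "(\<exists>v. P v) \<longleftrightarrow> P Covar \<or> P Contravar"
  by (metis variance.exhaust)

locale V_data =
  fixes e :: "'u enc" and u :: 'u
  assumes inj_e: "inj e"
begin

text \<open>
  Uniformly in the variances, \<open>(A \<otimes> B)\<^sup>w\<close> is the disjoint union over \<open>v\<close> of the products of
  \<open>A\<^sup>v\<close> with \<open>vop v (B\<^sup>v\<^sup>w)\<close>, and \<open>enc v a b\<close> is the pair \<open>(a, b)\<close> in the summand \<open>v\<close>.
\<close>

definition enc :: "variance \<Rightarrow> 'u \<Rightarrow> 'u \<Rightarrow> 'u" where
  "enc v a b = e (case v of Covar \<Rightarrow> Inl (a, b) | Contravar \<Rightarrow> Inr (a, b))"

definition dec :: "'u \<Rightarrow> variance \<times> 'u \<times> 'u" where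
  "dec t = (case inv e t of Inl p \<Rightarrow> (Covar, p) | Inr p \<Rightarrow> (Contravar, p))"

lemma inv_e [simp]: "inv e (e s) = s"
  using inj_e by simp

lemma dec_enc [simp]: "dec (enc v a b) = (v, a, b)"
  by (cases v) (auto simp: dec_def enc_def)

lemma enc_eq [simp]: "enc v a b = enc v' a' b' \<longleftrightarrow> v = v' \<and> a = a' \<and> b = b'"
  by (metis dec_enc prod.inject)

abbreviation T :: "'u scat \<times> 'u scat \<Rightarrow> 'u scat \<times> 'u scat \<Rightarrow> 'u scat \<times> 'u scat" where
  "T \<equiv> V_tensO e"

definition vcat :: "'u scat \<times> 'u scat \<Rightarrow> bool" where
  "vcat A \<longleftrightarrow> (\<forall>v. category (prj v A))"

lemma vcatD [simp]: "vcat A \<Longrightarrow> category (prj v A)"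
  by (simp add: vcat_def)

lemma vcat_Pair [simp]: "vcat (C, D) \<longleftrightarrow> category C \<and> category D"
  by (simp add: vcat_def all_variance)

text \<open>The two components of the tensor product differ only in which component of
  \<open>B\<close> meets which component of \<open>A\<close>, and \<open>vmul Contravar w\<close> is
  the variance other than \<open>w\<close>.\<close>

lemma prj_T:
  "prj w (T A B) = copy_cat e (sum_cat (prod_cat (prj Covar A) (prj w B))
     (prod_cat (prj Contravar A) (op_cat (prj (vmul Contravar w) B))))"
  by (cases w) (auto simp: V_tensO_def)

lemma vcat_T [simp]: "vcat A \<Longrightarrow> vcat B \<Longrightarrow> vcat (T A B)"
  unfolding vcat_def prj_T
  by (intro allI category_copy_cat category_sum_cat category_prod_cat category_op_cat)
    (simp_all add: inj_e del: prj.simps)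

lemma T_Ob: "Ob (prj w (T A B)) =
    {enc v a b |v a b. a \<in> Ob (prj v A) \<and> b \<in> Ob (prj (vmul v w) B)}" (is "?L = ?R")
  and T_Ar: "Ar (prj w (T A B)) =
    {enc v a b |v a b. a \<in> Ar (prj v A) \<and> b \<in> Ar (prj (vmul v w) B)}" (is "?L' = ?R'")
proof -
  \<comment> \<open>The two injections into the sum correspond to the two variances, so the image of
    a disjoint union is a union over \<open>v\<close>. The opposite on the second factor leaves the
    underlying sets alone.\<close>
  have eq: "e ` (X Covar \<times> Y Covar <+> X Contravar \<times> Y Contravar) =
      {enc v a b |v a b. a \<in> X v \<and> b \<in> Y v}" for X Y
    by (auto simp: enc_def Plus_def image_Un image_image all_variance ex_variance)
  show "?L = ?R"
    using eq [of "\<lambda>v. Ob (prj v A)" "\<lambda>v. Ob (prj (vmul v w) B)"]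
    by (simp add: prj_T copy_cat_def sum_cat_def del: prj.simps)
  show "?L' = ?R'"
    using eq [of "\<lambda>v. Ar (prj v A)" "\<lambda>v. Ar (prj (vmul v w) B)"]
    by (simp add: prj_T copy_cat_def sum_cat_def del: prj.simps)
qed

lemma enc_in_T [simp]:
  "enc v a b \<in> Ob (prj w (T A B)) \<longleftrightarrow> a \<in> Ob (prj v A) \<and> b \<in> Ob (prj (vmul v w) B)"
  "enc v a b \<in> Ar (prj w (T A B)) \<longleftrightarrow> a \<in> Ar (prj v A) \<and> b \<in> Ar (prj (vmul v w) B)"
  by (auto simp: T_Ob T_Ar)

lemma T_Dom:
  assumes "a \<in> Ar (prj v A)" "b \<in> Ar (prj (vmul v w) B)"
  shows "Dom (prj w (T A B)) (enc v a b) =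
    enc v (Dom (prj v A) a) (Dom (vop v (prj (vmul v w) B)) b)"
  using assms inj_e
  by (cases v) (simp_all add: prj_T enc_def del: prj.simps)

lemma T_Cod:
  assumes "a \<in> Ar (prj v A)" "b \<in> Ar (prj (vmul v w) B)"
  shows "Cod (prj w (T A B)) (enc v a b) =
    enc v (Cod (prj v A) a) (Cod (vop v (prj (vmul v w) B)) b)"
  using assms inj_e
  by (cases v) (simp_all add: prj_T enc_def del: prj.simps)

lemma T_Idt [simp]:
  assumes "a \<in> Ob (prj v A)" "b \<in> Ob (prj (vmul v w) B)"
  shows "Idt (prj w (T A B)) (enc v a b) = enc v (Idt (prj v A) a) (Idt (prj (vmul v w) B) b)"
  using assms inj_e
  by (cases v) (simp_all add: prj_T enc_def del: prj.simps)

lemma T_Cmp: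
  assumes "composable (prj v A) a a'" "composable (vop v (prj (vmul v w) B)) b b'"
  shows "enc v a b \<cdot>\<^bsub>prj w (T A B)\<^esub> enc v a' b' =
    enc v (a \<cdot>\<^bsub>prj v A\<^esub> a') (b \<cdot>\<^bsub>vop v (prj (vmul v w) B)\<^esub> b')"
  using assms inj_e
  by (cases v) (auto simp: prj_T enc_def composable_def simp del: prj.simps)

end

text \<open>
  The laws of all structures below hold on objects and on arrows alike; a kind variable states
  both at once. At kind \<open>ArK\<close>, an object acts as its identity arrow.
\<close>

datatype kind = ObK | ArK

fun cel :: "kind \<Rightarrow> ('a, 'a) cat \<Rightarrow> 'a set" where
  "cel ObK C = Ob C"
| "cel ArK C = Ar C"

fun fap :: "kind \<Rightarrow> ('a, 'a, 'b, 'b) fctr \<Rightarrow> 'a \<Rightarrow> 'b" where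
  "fap ObK F = FOb F"
| "fap ArK F = FAr F"

lemma all_kind: "(\<forall>k. P k) \<longleftrightarrow> P ObK \<and> P ArK"
  by (metis kind.exhaust)

lemma functor_fap: "is_functor C D F \<Longrightarrow> t \<in> cel k C \<Longrightarrow> fap k F t \<in> cel k D"
  by (cases k) (auto simp: functorD)

lemma fap_mk_fun [simp]: "t \<in> cel k C \<Longrightarrow> fap k (mk_fun C (p ObK) (p ArK)) t = p k t"
  by (cases k) auto

lemma cel_vop [simp]: "cel k (vop v C) = cel k C"
  by (cases k) auto

lemma cel_prod_cat [simp]: "cel k (prod_cat C D) = cel k C \<times> cel k D"
  by (cases k) auto

lemma functor_fap_eqI:
  assumes "is_functor C D F" "is_functor C D' G" "\<And>k t. t \<in> cel k C \<Longrightarrow> fap k F t = fap k G t"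
  shows "F = G"
  by (rule functor_eqI [OF assms(1,2)]) (use assms(3) [where k = ObK] assms(3) [where k = ArK] in auto)

definition inv_fun :: "('o, 'm) cat \<Rightarrow> ('o2, 'm2) cat \<Rightarrow> ('o, 'm, 'o2, 'm2) fctr \<Rightarrow>
    ('o2, 'm2, 'o, 'm) fctr" where
  "inv_fun C D F = mk_fun D (inv_into (Ob C) (FOb F)) (inv_into (Ar C) (FAr F))"

text \<open>A functor that is bijective on objects and arrows is an isomorphism: each law for the
  inverse maps holds after applying \<open>F\<close>, and \<open>F\<close> is injective. It serves
  both for the constraints of V and for the hom-functors of the inverse 2-functor.\<close>

lemma is_functor_inv_fun:
  assumes C: "category C" and D: "category D" and F: "is_functor C D F"
    and o: "bij_betw (FOb F) (Ob C) (Ob D)" and a: "bij_betw (FAr F) (Ar C) (Ar D)"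
  shows "is_functor D C (inv_fun C D F)"
proof -
  let ?p = "inv_into (Ob C) (FOb F)" and ?q = "inv_into (Ar C) (FAr F)"
  have p: "?p b \<in> Ob C" "FOb F (?p b) = b" if "b \<in> Ob D" for b
    using that o by (auto simp: bij_betw_def inv_into_into f_inv_into_f)
  have q: "?q b \<in> Ar C" "FAr F (?q b) = b" if "b \<in> Ar D" for b
    using that a by (auto simp: bij_betw_def inv_into_into f_inv_into_f)
  have po: "?p (FOb F x) = x" if "x \<in> Ob C" for x
    using that o by (simp add: bij_betw_def)
  have qa: "?q (FAr F x) = x" if "x \<in> Ar C" for x
    using that a by (simp add: bij_betw_def)
  have dom: "Dom C (?q f) = ?p (Dom D f)" and cod: "Cod C (?q f) = ?p (Cod D f)"
    if f: "f \<in> Ar D" for f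
    using functorD(3,4) [OF F q(1) [OF f]] q [OF f] po C by (metis cat_Dom cat_Cod)+
  show ?thesis unfolding inv_fun_def
  proof (rule is_functor_mk_funI [OF D])
    fix b assume b: "b \<in> Ob D"
    show "?q (Idt D b) = Idt C (?p b)"
      using functorD(5) [OF F p(1) [OF b]] p [OF b] qa C by (metis cat_Idt)
  next
    fix g f assume gf: "composable D g f"
    have c: "composable C (?q g) (?q f)"
      using gf q dom cod by (auto simp: composable_def)
    have "FAr F (?q g \<cdot>\<^bsub>C\<^esub> ?q f) = g \<cdot>\<^bsub>D\<^esub> f"
      using functorD(6) [OF F c] gf q by (auto simp: composable_def)
    then show "?q (g \<cdot>\<^bsub>D\<^esub> f) = ?q g \<cdot>\<^bsub>C\<^esub> ?q f"
      using qa c C by (metis cat_Cmp(1) composable_def)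
  qed (use p q dom cod in auto)
qed

context V_data
begin

section \<open>The monoidal category \<open>V\<close>\<close>

abbreviation M :: "('u scat \<times> 'u scat, 'u sfun \<times> 'u sfun) moncat" where
  "M \<equiv> V e u"

definition vsrc :: "'u sfun \<times> 'u sfun \<Rightarrow> 'u scat \<times> 'u scat" where
  "vsrc F = (src (fst F), src (snd F))"

definition vtrg :: "'u sfun \<times> 'u sfun \<Rightarrow> 'u scat \<times> 'u scat" where
  "vtrg F = (trg (fst F), trg (snd F))"

definition vAr :: "'u sfun \<times> 'u sfun \<Rightarrow> bool" where
  "vAr F \<longleftrightarrow> vcat (vsrc F) \<and> vcat (vtrg F) \<and>
     (\<forall>v. is_functor (prj v (vsrc F)) (prj v (vtrg F)) (mor (prj v F)))"

definition act :: "kind \<Rightarrow> variance \<Rightarrow> 'u sfun \<times> 'u sfun \<Rightarrow> 'u \<Rightarrow> 'u" where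
  "act k v F = fap k (mor (prj v F))"

lemma prj_vsrc: "prj v (vsrc F) = src (prj v F)" and prj_vtrg: "prj v (vtrg F) = trg (prj v F)"
  by (cases v; simp add: vsrc_def vtrg_def)+

lemma vAr_functor: "vAr F \<Longrightarrow> is_functor (prj v (vsrc F)) (prj v (vtrg F)) (mor (prj v F))"
  by (simp add: vAr_def)

lemma vAr_vcat [simp]: "vAr F \<Longrightarrow> vcat (vsrc F)" "vAr F \<Longrightarrow> vcat (vtrg F)"
  by (simp_all add: vAr_def)

lemma act_in: "vAr F \<Longrightarrow> t \<in> cel k (prj v (vsrc F)) \<Longrightarrow> act k v F t \<in> cel k (prj v (vtrg F))"
  unfolding act_def by (blast intro: functor_fap vAr_functor)

text \<open>Functors are extensional on their domains, so source, target and the action on objects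
  and arrows of both components determine an arrow of V. Commutativity of diagrams in V becomes a
  computation with elements.\<close>

lemma vAr_eqI:
  assumes "vAr F" "vAr G" "vsrc F = vsrc G" "vtrg F = vtrg G"
    "\<And>k v t. t \<in> cel k (prj v (vsrc G)) \<Longrightarrow> act k v F t = act k v G t"
  shows "F = G"
proof (rule prj_eqI)
  fix v
  have "mor (prj v F) = mor (prj v G)"
    by (rule functor_fap_eqI [of "prj v (vsrc G)" "prj v (vtrg G)" _ "prj v (vtrg G)"])
      (use assms vAr_functor [of F v] vAr_functor [of G v] in \<open>auto simp: act_def\<close>)
  then show "prj v F = prj v G"
    using assms(3,4) by (intro arrow.equality) (auto simp flip: prj_vsrc prj_vtrg)
qed

lemma M_Ob [simp]: "A \<in> Ob (base M) \<longleftrightarrow> vcat A"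
  by (cases A) (simp add: V_def Cat_def)

lemma M_Ar [simp]: "F \<in> Ar (base M) \<longleftrightarrow> vAr F"
  by (cases F) (auto simp: V_def Cat_def vAr_def all_variance vsrc_def vtrg_def)

lemma category_M [simp]: "category (base M)"
  by (simp add: V_def category_Cat)

lemma vAr_CatD: "vAr F \<Longrightarrow> fst F \<in> Ar Cat" "vAr F \<Longrightarrow> snd F \<in> Ar Cat"
  by (auto simp: Cat_def vAr_def all_variance vsrc_def vtrg_def)

lemma M_Dom [simp]: "vAr F \<Longrightarrow> Dom (base M) F = vsrc F"
  and M_Cod [simp]: "vAr F \<Longrightarrow> Cod (base M) F = vtrg F"
  using vAr_CatD [of F]
  by (cases F; simp add: V_def vsrc_def vtrg_def; simp add: Cat_def)+

lemma arr_between_M: "arr_between (base M) F A B \<longleftrightarrow> vAr F \<and> vsrc F = A \<and> vtrg F = B"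
  by (auto simp: arr_between_def)

lemma M_comp:
  assumes "vAr F" "vAr G" "vtrg F = vsrc G"
  shows "prj v (G \<diamondop>\<^bsub>M\<^esub> F) =
    \<lparr>src = src (prj v F), mor = comp_fun (src (prj v F)) (mor (prj v G)) (mor (prj v F)), trg =
        trg (prj v G)\<rparr>"
  using assms vAr_CatD [of F] vAr_CatD [of G]
  by (cases F; cases G; cases v) (auto simp: V_def vsrc_def vtrg_def composable_def Cat_def)

lemma
  assumes "vAr F" "vAr G" "vtrg F = vsrc G"
  shows comp_vAr [simp]: "vAr (G \<diamondop>\<^bsub>M\<^esub> F)"
    and comp_vsrc [simp]: "vsrc (G \<diamondop>\<^bsub>M\<^esub> F) = vsrc F"
    and comp_vtrg [simp]: "vtrg (G \<diamondop>\<^bsub>M\<^esub> F) = vtrg G"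
  using assms by (metis M_Ar M_Dom M_Cod cat_Cmp category_M)+

lemma comp_act [simp]:
  assumes "vAr F" "vAr G" "vtrg F = vsrc G" "t \<in> cel k (prj v (vsrc F))"
  shows "act k v (G \<diamondop>\<^bsub>M\<^esub> F) t = act k v G (act k v F t)"
  using assms by (cases k) (auto simp: act_def M_comp prj_vsrc)

lemma mid_prj: "vcat A \<Longrightarrow> prj v (mid M A) = \<lparr>src = prj v A, mor = id_fun (prj v A), trg = prj v A\<rparr>"
  by (cases A; cases v) (auto simp: V_def Cat_def)

lemma mid_vAr [simp]: "vcat A \<Longrightarrow> vAr (mid M A)"
  and mid_vsrc [simp]: "vcat A \<Longrightarrow> vsrc (mid M A) = A"
  and mid_vtrg [simp]: "vcat A \<Longrightarrow> vtrg (mid M A) = A"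
  by (metis M_Ar M_Ob M_Dom M_Cod cat_Idt cat_Dom_Idt cat_Cod_Idt category_M)+

lemma mid_act [simp]: "vcat A \<Longrightarrow> t \<in> cel k (prj v A) \<Longrightarrow> act k v (mid M A) t = t"
  by (cases k) (auto simp: act_def mid_prj)

text \<open>The common form of arrows of V given by a formula on elements, one for each kind and
  variance. Tensor products of arrows, the constraints, global elements, compositions and functor
  actions are all brought into it.\<close>

definition varr :: "'u scat \<times> 'u scat \<Rightarrow> 'u scat \<times> 'u scat \<Rightarrow> (kind \<Rightarrow> variance \<Rightarrow> 'u \<Rightarrow> 'u) \<Rightarrow> 'u sfun \<times> 'u sfun"
  where "varr A B p =
    (let F = (\<lambda>v. \<lparr>src = prj v A, mor = mk_fun (prj v A) (p ObK v) (p ArK v), trg = prj v B\<rparr>)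
     in (F Covar, F Contravar))"

lemma prj_varr: "prj v (varr A B p) =
    \<lparr>src = prj v A, mor = mk_fun (prj v A) (p ObK v) (p ArK v), trg = prj v B\<rparr>"
  by (cases v) (auto simp: varr_def Let_def)

lemma varr_vsrc [simp]: "vsrc (varr A B p) = A" and varr_vtrg [simp]: "vtrg (varr A B p) = B"
  by (auto intro!: prj_eqI simp: prj_vsrc prj_vtrg prj_varr)

lemma varr_act [simp]: "t \<in> cel k (prj v A) \<Longrightarrow> act k v (varr A B p) t = p k v t"
  using fap_mk_fun [of t k "prj v A" "\<lambda>k. p k v"] by (simp add: act_def prj_varr)

lemma varr_vArI:
  "vcat A \<Longrightarrow> vcat B \<Longrightarrow> (\<And>v. is_functor (prj v A) (prj v B) (mk_fun (prj v A) (p ObK v) (p ArK v)))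
   \<Longrightarrow> vAr (varr A B p)"
  by (simp add: vAr_def prj_varr)

lemma V_arrow_varr: "V_arrow p A B = varr A B (\<lambda>_ _. p)"
  by (simp add: V_arrow_def varr_def)

section \<open>Functors out of a tensor product\<close>

lemma T_cel [simp]: "enc v a b \<in> cel k (prj w (T A B)) \<longleftrightarrow> a \<in> cel k (prj v A) \<and> b \<in> cel k (prj (vmul v w) B)"
  by (cases k) auto

lemma T_cases:
  assumes "t \<in> cel k (prj w (T A B))"
  obtains v a b where "t = enc v a b" "a \<in> cel k (prj v A)" "b \<in> cel k (prj (vmul v w) B)"
  using assms by (cases k) (auto simp: T_Ob T_Ar)

text \<open>Reversing a tensor product reverses both factors of every summand. The second factor of
  summand \<open>v\<close> is then reversed according to \<open>vmul s v\<close>, two reversals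
  cancelling. This is needed when a tensor product is itself the second factor of another
  one.\<close>

lemma T_vop_Dom:
  assumes "vcat A" "vcat B" "a \<in> Ar (prj v A)" "b \<in> Ar (prj (vmul v w) B)"
  shows "Dom (vop s (prj w (T A B))) (enc v a b) =
    enc v (Dom (vop s (prj v A)) a) (Dom (vop (vmul s v) (prj (vmul v w) B)) b)"
  using assms by (cases s; cases v) (simp_all add: T_Dom T_Cod)

lemma T_vop_Cod:
  assumes "vcat A" "vcat B" "a \<in> Ar (prj v A)" "b \<in> Ar (prj (vmul v w) B)"
  shows "Cod (vop s (prj w (T A B))) (enc v a b) =
    enc v (Cod (vop s (prj v A)) a) (Cod (vop (vmul s v) (prj (vmul v w) B)) b)"
  using assms by (cases s; cases v) (simp_all add: T_Dom T_Cod)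

lemma T_vop_composable [simp]:
  assumes "vcat A" "vcat B"
  shows "composable (vop s (prj w (T A B))) (enc v a b) (enc v' a' b') \<longleftrightarrow>
    v = v' \<and> composable (vop s (prj v A)) a a' \<and> composable (vop (vmul s v) (prj (vmul v w) B)) b b'"
  using assms by (auto simp: composable_def T_vop_Dom T_vop_Cod)

lemma T_vop_Cmp:
  assumes "vcat A" "vcat B" "composable (vop s (prj v A)) a a'"
    "composable (vop (vmul s v) (prj (vmul v w) B)) b b'"
  shows "enc v a b \<cdot>\<^bsub>vop s (prj w (T A B))\<^esub> enc v a' b' =
    enc v (a \<cdot>\<^bsub>vop s (prj v A)\<^esub> a') (b \<cdot>\<^bsub>vop (vmul s v) (prj (vmul v w) B)\<^esub> b')"
proof (cases s)
  case Covar
  then show ?thesis using assms by (simp add: T_Cmp)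
next
  case Contravar
  then have "composable (prj w (T A B)) (enc v a' b') (enc v a b)"
    using T_vop_composable [of A B Contravar w v a b v a' b'] assms by simp
  then show ?thesis using assms Contravar by (cases v) (simp_all add: op_cat_Cmp T_Cmp)
qed

text \<open>Composable arrows of a disjoint union lie in the same summand, so functoriality on a
  tensor product can be checked on each summand, where the second factor carries
  \<open>vop v\<close>.\<close>

lemma T_functorI:
  assumes A: "vcat A" and B: "vcat B"
    and p: "\<And>v a b. a \<in> Ob (prj v A) \<Longrightarrow> b \<in> Ob (prj (vmul v w) B) \<Longrightarrow> p (enc v a b) \<in> Ob D"
    and q: "\<And>v f g. f \<in> Ar (prj v A) \<Longrightarrow> g \<in> Ar (prj (vmul v w) B) \<Longrightarrow> q (enc v f g) \<in> Ar D"
    and dom: "\<And>v f g. f \<in> Ar (prj v A) \<Longrightarrow> g \<in> Ar (prj (vmul v w) B) \<Longrightarrow>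
      Dom D (q (enc v f g)) = p (enc v (Dom (prj v A) f) (Dom (vop v (prj (vmul v w) B)) g))"
    and cod: "\<And>v f g. f \<in> Ar (prj v A) \<Longrightarrow> g \<in> Ar (prj (vmul v w) B) \<Longrightarrow>
      Cod D (q (enc v f g)) = p (enc v (Cod (prj v A) f) (Cod (vop v (prj (vmul v w) B)) g))"
    and idt: "\<And>v a b. a \<in> Ob (prj v A) \<Longrightarrow> b \<in> Ob (prj (vmul v w) B) \<Longrightarrow>
      q (enc v (Idt (prj v A) a) (Idt (prj (vmul v w) B) b)) = Idt D (p (enc v a b))"
    and cmp: "\<And>v f g f' g'. composable (prj v A) f f' \<Longrightarrow> composable (vop v (prj (vmul v w) B)) g g' \<Longrightarrow>
      q (enc v (f \<cdot>\<^bsub>prj v A\<^esub> f') (g \<cdot>\<^bsub>vop v (prj (vmul v w) B)\<^esub> g')) = q (enc v f g) \<cdot>\<^bsub>D\<^esub> q (enc v f' g')"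
  shows "is_functor (prj w (T A B)) D (mk_fun (prj w (T A B)) p q)"
proof (rule is_functor_mk_funI)
  fix g f assume gf: "composable (prj w (T A B)) g f"
  obtain v a b v' a' b' where e: "g = enc v a b" "f = enc v' a' b'"
    using gf by (auto simp: composable_def T_Ar)
  have c: "v = v'" "composable (prj v A) a a'" "composable (vop v (prj (vmul v w) B)) b b'"
    using gf A B T_vop_composable [of A B Covar w v a b v' a' b'] by (auto simp: e)
  show "q (g \<cdot>\<^bsub>prj w (T A B)\<^esub> f) = q g \<cdot>\<^bsub>D\<^esub> q f"
    using c by (simp add: e T_Cmp cmp)
qed (use assms in \<open>auto simp: T_Ob T_Ar T_Dom T_Cod\<close>)

end

text \<open>The functor itself is unchanged, so the functor laws of an arrow of V hold with the same
  maps for both orientations of its components.\<close>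

lemma functor_vop:
  assumes "category C" "category D" "is_functor C D F"
  shows "is_functor (vop v C) (vop v D) F"
proof (cases v)
  case Contravar
  have "FAr F f \<cdot>\<^bsub>op_cat D\<^esub> FAr F g = FAr F (f \<cdot>\<^bsub>op_cat C\<^esub> g)" if "composable C g f" for g f
    using functorD(6,7) [OF assms(3) that] that by (simp add: op_cat_Cmp)
  then show ?thesis
    using assms functorD [OF assms(3)] Contravar
    by (auto simp: is_functor_def)
qed (use assms in auto)

text \<open>Components stay symbolic from here on. Unfolding \<open>prj\<close> at a concrete
  variance would destroy the uniform shape in which the simplification rules are stated.\<close>

declare prj.simps [simp del]

context V_data
begin

lemma act_Ob [simp]: "vAr F \<Longrightarrow> a \<in> Ob (prj v (vsrc F)) \<Longrightarrow> act ObK v F a \<in> Ob (prj v (vtrg F))"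
  and act_Ar [simp]: "vAr F \<Longrightarrow> f \<in> Ar (prj v (vsrc F)) \<Longrightarrow> act ArK v F f \<in> Ar (prj v (vtrg F))"
  using act_in [of F a ObK v] act_in [of F f ArK v] by auto

lemma
  assumes F: "vAr F"
  shows act_Dom: "f \<in> Ar (prj v (vsrc F)) \<Longrightarrow>
      Dom (vop s (prj v (vtrg F))) (act ArK v F f) = act ObK v F (Dom (vop s (prj v (vsrc F))) f)"
    and act_Cod: "f \<in> Ar (prj v (vsrc F)) \<Longrightarrow>
      Cod (vop s (prj v (vtrg F))) (act ArK v F f) = act ObK v F (Cod (vop s (prj v (vsrc F))) f)"
    and act_Idt: "a \<in> Ob (prj v (vsrc F)) \<Longrightarrow>
      act ArK v F (Idt (prj v (vsrc F)) a) = Idt (prj v (vtrg F)) (act ObK v F a)"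
    and act_Cmp: "composable (vop s (prj v (vsrc F))) g f \<Longrightarrow>
      act ArK v F (g \<cdot>\<^bsub>vop s (prj v (vsrc F))\<^esub> f) =
      act ArK v F g \<cdot>\<^bsub>vop s (prj v (vtrg F))\<^esub> act ArK v F f"
    and act_composable: "composable (vop s (prj v (vsrc F))) g f \<Longrightarrow>
      composable (vop s (prj v (vtrg F))) (act ArK v F g) (act ArK v F f)"
  using functorD [OF functor_vop [OF _ _ vAr_functor [OF F, of v], of s]] vAr_functor [OF F, of v] F
  by (auto simp: act_def functorD)

lemmas act_functor = act_Dom act_Cod act_Idt act_Cmp act_composable

text \<open>The rules at \<open>s = Covar\<close> with \<open>vop\<close> simplified away, because a
  plain component does not match the pattern \<open>vop s\<close>.\<close>

lemmas act_functor0 = act_Dom [where s = Covar, simplified] act_Cod [where s = Covar, simplified]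
  act_Cmp [where s = Covar, simplified] act_composable [where s = Covar, simplified]

section \<open>Tensor products of arrows\<close>

lemma tens_Ob [simp]: "vcat A \<Longrightarrow> vcat B \<Longrightarrow> A \<otimes>\<^bsub>M\<^esub> B = T A B"
  using M_Ob by (simp add: V_def)

definition tens_map :: "'u sfun \<times> 'u sfun \<Rightarrow> 'u sfun \<times> 'u sfun \<Rightarrow> kind \<Rightarrow> variance \<Rightarrow> 'u \<Rightarrow> 'u" where
  "tens_map F G k w t = (case dec t of (v, a, b) \<Rightarrow> enc v (act k v F a) (act k (vmul v w) G b))"

lemma tens_Ar:
  assumes "vAr F" "vAr G"
  shows "F \<odot>\<^bsub>M\<^esub> G = varr (T (vsrc F) (vsrc G)) (T (vtrg F) (vtrg G)) (tens_map F G)"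
proof -
  have 1: "F \<odot>\<^bsub>M\<^esub> G = V_tensA e F G"
    using assms M_Ar by (simp add: V_def)
  show ?thesis
    unfolding 1
  proof (rule prj_eqI)
    fix w
    \<comment> \<open>Both components of \<open>V_tensA\<close> are instances of one formula, in
      which the contravariant summand takes the second map at the other variance. Through
      \<open>dec\<close> the case distinction on the injection becomes one on
      \<open>v\<close>.\<close>
    have m: "mk_fun (prj w (T A B)) (\<lambda>t. e (map_sum (map_prod (p Covar) (q w))
        (map_prod (p Contravar) (q (vmul Contravar w))) (inv e t)))
       (\<lambda>t. e (map_sum (map_prod (p' Covar) (q' w)) (map_prod (p' Contravar) (q' (vmul Contravar w)))
           (inv e t))) =
       mk_fun (prj w (T A B)) (\<lambda>t. case dec t of (v, a, b) \<Rightarrow> enc v (p v a) (q (vmul v w) b))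
       (\<lambda>t. case dec t of (v, a, b) \<Rightarrow> enc v (p' v a) (q' (vmul v w) b))" for A B p q p' q'
      by (rule mk_fun_cong) (auto simp: dec_def enc_def split: sum.split)
    show "prj w (V_tensA e F G) = prj w (varr (T (vsrc F) (vsrc G)) (T (vtrg F) (vtrg G)) (tens_map F G))"
      using m [of "vsrc F" "vsrc G" "\<lambda>v. act ObK v F" "\<lambda>v. act ObK v G" "\<lambda>v. act ArK v F" "\<lambda>v. act ArK v G"]
      by (cases w) (auto simp: prj.simps prj_varr V_tensA_def V_tensF_def tens_map_def [abs_def]
          vsrc_def vtrg_def act_def Let_def comp_def)
  qed
qed

lemma tens_vAr [simp]: "vAr F \<Longrightarrow> vAr G \<Longrightarrow> vAr (F \<odot>\<^bsub>M\<^esub> G)"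
  unfolding tens_Ar
  by (intro varr_vArI T_functorI)
    (auto simp: tens_map_def T_Dom T_Cod T_Cmp act_functor act_functor0)

lemma tens_vsrc [simp]: "vAr F \<Longrightarrow> vAr G \<Longrightarrow> vsrc (F \<odot>\<^bsub>M\<^esub> G) = T (vsrc F) (vsrc G)"
  and tens_vtrg [simp]: "vAr F \<Longrightarrow> vAr G \<Longrightarrow> vtrg (F \<odot>\<^bsub>M\<^esub> G) = T (vtrg F) (vtrg G)"
  by (auto simp: tens_Ar)

lemma tens_act [simp]:
  assumes "vAr F" "vAr G" "a \<in> cel k (prj v (vsrc F))" "b \<in> cel k (prj (vmul v w) (vsrc G))"
  shows "act k w (F \<odot>\<^bsub>M\<^esub> G) (enc v a b) = enc v (act k v F a) (act k (vmul v w) G b)"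
  using assms by (simp add: tens_Ar tens_map_def)

section \<open>Unit object and constraint isomorphisms\<close>

lemma unt_M [simp]: "unt M = V_unit u"
  by (simp add: V_def)

lemma unit_cel [simp]: "cel k (prj v (V_unit u)) = (if v = Covar then {u} else {})"
  by (cases k; cases v) (auto simp: prj.simps V_unit_def terminal_cat_def empty_cat_def)

lemma unit_sel [simp]: "Ob (prj v (V_unit u)) = (if v = Covar then {u} else {})"
  "Ar (prj v (V_unit u)) = (if v = Covar then {u} else {})"
  by (cases v; simp add: prj.simps V_unit_def terminal_cat_def empty_cat_def)+

lemma unit_Dom [simp]: "Dom (prj Covar (V_unit u)) u = u" "Cod (prj Covar (V_unit u)) u =
    u" "Idt (prj Covar (V_unit u)) u = u"
  "u \<cdot>\<^bsub>prj Covar (V_unit u)\<^esub> u = u"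
  by (auto simp: prj.simps V_unit_def terminal_cat_def)

lemma vcat_unit [simp]: "vcat (V_unit u)"
  by (simp add: V_unit_def category_terminal_cat category_empty_cat)

text \<open>In (A \<otimes> B) \<otimes> C the element \<open>a\<close> has variance v' and the pair
  of \<open>a\<close> and \<open>b\<close> has variance v, so \<open>b\<close> has variance v'v,
  which indexes the inner summand after reassociation. The four cases of \<open>V_asc_map\<close>
  are this single rule.\<close>

lemma asc_map [simp]: "V_asc_map e (enc v (enc v' a b) c) = enc v' a (enc (vmul v' v) b c)"
  by (cases v; cases v') (simp_all add: V_asc_map_def enc_def)

lemma lun_map [simp]: "V_lun_map e (enc v a b) = b"
  by (cases v) (simp_all add: V_lun_map_def enc_def)

lemma run_map [simp]: "V_run_map e (enc v a b) = a"
  by (cases v) (simp_all add: V_run_map_def enc_def)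

lemma asc_eq: "asc M A B C = varr (T (T A B) C) (T A (T B C)) (\<lambda>_ _. V_asc_map e)"
  and lun_eq: "lun M A = varr (T (V_unit u) A) A (\<lambda>_ _. V_lun_map e)"
  and run_eq: "run M A = varr (T A (V_unit u)) A (\<lambda>_ _. V_run_map e)"
  by (auto simp: V_def V_arrow_varr)

lemma asc_st [simp]: "vsrc (asc M A B C) = T (T A B) C" "vtrg (asc M A B C) = T A (T B C)"
  and lun_st [simp]: "vsrc (lun M A) = T (V_unit u) A" "vtrg (lun M A) = A"
  and run_st [simp]: "vsrc (run M A) = T A (V_unit u)" "vtrg (run M A) = A"
  by (auto simp: asc_eq lun_eq run_eq)

lemma asc_act [simp]:
  assumes "a \<in> cel k (prj v' A)" "b \<in> cel k (prj (vmul v' v) B)" "c \<in> cel k (prj (vmul v w) C)"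
  shows "act k w (asc M A B C) (enc v (enc v' a b) c) = enc v' a (enc (vmul v' v) b c)"
  using assms by (simp add: asc_eq)

lemma lun_act [simp]: "a \<in> cel k (prj w A) \<Longrightarrow> act k w (lun M A) (enc Covar u a) = a"
  and run_act [simp]: "a \<in> cel k (prj w A) \<Longrightarrow> act k w (run M A) (enc w a u) = a"
  by (simp_all add: lun_eq run_eq)

lemma lun_vAr [simp]: "vcat A \<Longrightarrow> vAr (lun M A)"
  unfolding lun_eq by (intro varr_vArI T_functorI) (auto simp: composable_def split: if_splits)

lemma run_vAr [simp]: "vcat A \<Longrightarrow> vAr (run M A)"
  unfolding run_eq by (intro varr_vArI T_functorI) (auto simp: composable_def split: if_splits)

lemma asc_vAr [simp]:
  assumes [simp]: "vcat A" "vcat B" "vcat C"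
  shows "vAr (asc M A B C)"
proof -
  have *: "is_functor (prj w (T (T A B) C)) (prj w (T A (T B C)))
     (mk_fun (prj w (T (T A B) C)) (V_asc_map e) (V_asc_map e))" for w
  proof (rule T_functorI, goal_cases)
    \<comment> \<open>For composition the inner summands must be opened: composable arrows agree in
      the outer and in the inner variance. On the target side B \<otimes> C is the second factor of
      summand \<open>x\<close>, so its composition is taken in \<open>vop x\<close>, which
      \<open>T_vop_Cmp\<close> computes.\<close>
    case (8 v f g f' g')
    obtain x a b where f: "f = enc x a b" "a \<in> Ar (prj x A)" "b \<in> Ar (prj (vmul x v) B)"
      using 8(1) by (auto simp: composable_def T_Ar)
    obtain x' a' b' where f': "f' = enc x' a' b'" "a' \<in> Ar (prj x' A)" "b' \<in> Ar (prj (vmul x' v) B)"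
      using 8(1) by (auto simp: composable_def T_Ar)
    have c: "x = x'" "composable (prj x A) a a'" "composable (vop x (prj (vmul x v) B)) b b'"
      using 8(1) T_vop_composable [of A B Covar v x a b x' a' b'] by (auto simp: f f')
    show ?case
      using c 8(2) T_vop_Cmp [of B C x "vmul x v" b b' "vmul x w" g g'] 
      by (simp add: f f' T_Cmp vmul_left_comm [of x'] vmul_left_comm [of x])
  qed (auto simp: T_Ob T_Ar T_Dom T_Cod T_vop_Dom T_vop_Cod vmul_left_comm)
  then show ?thesis unfolding asc_eq by (intro varr_vArI) auto
qed

text \<open>The pointwise inverses of bijective actions are again functors in each component, and
  the two inverse laws hold on elements. Invertibility of a constraint is thereby reduced to a
  bijection of sets.\<close>

lemma inverse_arrows_M:
  assumes F: "vAr F" and b: "\<And>k v. bij_betw (act k v F) (cel k (prj v (vsrc F))) (cel k (prj v (vtrg F)))"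
  shows "\<exists>G. inverse_arrows (base M) F G"
proof -
  define p where "p k v = inv_into (cel k (prj v (vsrc F))) (act k v F)" for k v
  let ?G = "varr (vtrg F) (vsrc F) p"
  have p: "p k v t \<in> cel k (prj v (vsrc F))" "act k v F (p k v t) =
      t" if "t \<in> cel k (prj v (vtrg F))" for k v t
    using that b [of k v] by (auto simp: bij_betw_def p_def inv_into_into f_inv_into_f)
  have p': "p k v (act k v F t) = t" if "t \<in> cel k (prj v (vsrc F))" for k v t
    using that b [of k v] by (auto simp: bij_betw_def p_def)
  have G: "vAr ?G"
  proof (rule varr_vArI)
    fix v
    have "is_functor (prj v (vtrg F)) (prj v (vsrc F))
        (inv_fun (prj v (vsrc F)) (prj v (vtrg F)) (mor (prj v F)))"
      using F b [of ObK v] b [of ArK v] vAr_functor by (intro is_functor_inv_fun) (auto simp: act_def)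
    then show "is_functor (prj v (vtrg F)) (prj v (vsrc F)) (mk_fun (prj v (vtrg F)) (p ObK v) (p ArK v))"
      by (simp add: p_def inv_fun_def act_def)
  qed (use F in auto)
  have "?G \<diamondop>\<^bsub>M\<^esub> F = mid M (vsrc F)" "F \<diamondop>\<^bsub>M\<^esub> ?G = mid M (vtrg F)"
    using F G by (auto intro!: vAr_eqI simp: act_in p p')
  then have "inverse_arrows (base M) F ?G"
    using F G by (simp add: inverse_arrows_def arr_between_M)
  then show ?thesis ..
qed

text \<open>\<open>inv_ar\<close> is a definite description, so it is identified with an exhibited
  inverse. The last clause evaluates it on elements of the form \<open>act k v F t\<close>; this
  makes the inverse unitors in enriched naturality and in composites of global elements
  computable.\<close>

lemma inv_act:
  assumes F: "vAr F" and b: "\<And>k v. bij_betw (act k v F) (cel k (prj v (vsrc F))) (cel k (prj v (vtrg F)))"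
  shows "vAr (inv_ar (base M) F)" "vsrc (inv_ar (base M) F) = vtrg F" "vtrg (inv_ar (base M) F) = vsrc F"
    "t \<in> cel k (prj v (vsrc F)) \<Longrightarrow> act k v (inv_ar (base M) F) (act k v F t) = t"
proof -
  obtain G where G: "inverse_arrows (base M) F G" using inverse_arrows_M [OF assms] ..
  then have g: "inv_ar (base M) F = G" by (intro inv_ar_eqI) auto
  have "vAr G" "vsrc G = Cod (base M) F" "vsrc F = Cod (base M) G"
    using G unfolding inverse_arrows_def arr_between_M by blast+
  then have G': "vAr G" "vsrc G = vtrg F" "vtrg G = vsrc F"
    using F by simp_all
  then show "vAr (inv_ar (base M) F)" "vsrc (inv_ar (base M) F) = vtrg F" "vtrg (inv_ar (base M) F) =
      vsrc F"
    by (simp_all add: g)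
  have "G \<diamondop>\<^bsub>M\<^esub> F = mid M (vsrc F)" using G F by (simp add: inverse_arrows_def)
  then show "act k v (inv_ar (base M) F) (act k v F t) = t" if "t \<in> cel k (prj v (vsrc F))"
    using comp_act [OF F G'(1) G'(2) [symmetric] that] that F by (simp add: g)
qed

lemma asc_bij:
  "bij_betw (act k w (asc M A B C)) (cel k (prj w (T (T A B) C))) (cel k (prj w (T A (T B C))))"
proof (rule bij_betw_byWitness)
  \<comment> \<open>With \<open>a\<close> in variance v' and \<open>b\<close> in variance v, the
    pair has the variance whose product with v' is v, that is v'v.\<close>
  let ?g = "\<lambda>t. case dec t of (v', a, s) \<Rightarrow> case dec s of (v, b, c) \<Rightarrow> enc (vmul v' v) (enc v' a b) c"
  show "\<forall>t\<in>cel k (prj w (T (T A B) C)). ?g (act k w (asc M A B C) t) = t"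
    by (auto elim!: T_cases)
  show "\<forall>t\<in>cel k (prj w (T A (T B C))). act k w (asc M A B C) (?g t) = t"
    by (auto elim!: T_cases simp: vmul_left_comm)
  show "act k w (asc M A B C) ` cel k (prj w (T (T A B) C)) \<subseteq> cel k (prj w (T A (T B C)))"
    by (auto elim!: T_cases simp: vmul_left_comm)
  show "?g ` cel k (prj w (T A (T B C))) \<subseteq> cel k (prj w (T (T A B) C))"
    by (auto elim!: T_cases simp: vmul_left_comm)
qed

lemma lun_bij: "bij_betw (act k w (lun M A)) (cel k (prj w (T (V_unit u) A))) (cel k (prj w A))"
  by (rule bij_betw_byWitness [where f' = "enc Covar u"]) (auto elim!: T_cases split: if_splits)

lemma run_bij: "bij_betw (act k w (run M A)) (cel k (prj w (T A (V_unit u)))) (cel k (prj w A))"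
  by (rule bij_betw_byWitness [where f' = "\<lambda>a. enc w a u"]) (auto elim!: T_cases split: if_splits)

lemma inv_lun [simp]:
  assumes "vcat A"
  shows "vAr (inv_ar (base M) (lun M A))" "vsrc (inv_ar (base M) (lun M A)) = A"
    "vtrg (inv_ar (base M) (lun M A)) = T (V_unit u) A"
    "a \<in> cel k (prj w A) \<Longrightarrow> act k w (inv_ar (base M) (lun M A)) a = enc Covar u a"
  using inv_act [of "lun M A"] inv_act(4) [of "lun M A" "enc Covar u a" k w] assms lun_bij by auto

lemma inv_run [simp]:
  assumes "vcat A"
  shows "vAr (inv_ar (base M) (run M A))" "vsrc (inv_ar (base M) (run M A)) = A"
    "vtrg (inv_ar (base M) (run M A)) = T A (V_unit u)"
    "a \<in> cel k (prj w A) \<Longrightarrow> act k w (inv_ar (base M) (run M A)) a = enc w a u"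
  using inv_act [of "run M A"] inv_act(4) [of "run M A" "enc w a u" k w] assms run_bij by auto

lemma tens_functor: "is_functor (prod_cat (base M) (base M)) (base M) (tens M)"
proof -
  \<comment> \<open>\<open>tens M\<close> equals its own truncation. Keeping its two maps opaque
    lets the computation rules for \<otimes> on objects and arrows apply.\<close>
  have "tens M = mk_fun (prod_cat (base M) (base M)) (FOb (tens M)) (FAr (tens M))"
    by (simp add: V_def mk_fun_def)
  also have "is_functor (prod_cat (base M) (base M)) (base M) \<dots>"
    by (rule is_functor_mk_funI)
      (auto intro!: vAr_eqI elim!: T_cases simp: composable_def act_in)
  finally show ?thesis .
qed

text \<open>On elements, both sides of each naturality, pentagon and triangle condition yield the
  same rearrangement of nested \<open>enc\<close> terms; the variances agree because
  \<open>vmul\<close> is commutative and every variance is its own inverse.\<close>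

theorem monoidal_category_V: "monoidal_category M"
  unfolding monoidal_category_def iso_between_def arr_between_M
  using inverse_arrows_M asc_bij lun_bij run_bij
  by (auto intro!: vAr_eqI tens_functor elim!: T_cases simp: act_in vmul_left_comm split: if_splits)

end

section \<open>The 2-category of 2-categories with contravariance\<close>

definition hm :: "('o, 'u) ccat \<Rightarrow> kind \<Rightarrow> variance \<Rightarrow> 'o \<Rightarrow> 'o \<Rightarrow> 'u set" where
  "hm A k v x y = cel k (CHom A v x y)"

definition cmp :: "('o, 'u) ccat \<Rightarrow> kind \<Rightarrow> variance \<Rightarrow> variance \<Rightarrow> 'o \<Rightarrow> 'o \<Rightarrow> 'o \<Rightarrow> 'u \<Rightarrow> 'u \<Rightarrow> 'u" where
  "cmp A k v w x y z g f = fap k (CComp A v w x y z) (g, f)"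

definition el :: "('o, 'u) ccat \<Rightarrow> kind \<Rightarrow> 'o \<Rightarrow> 'o \<Rightarrow> 'u \<Rightarrow> 'u" where
  "el A k x y a = (case k of ObK \<Rightarrow> a | ArK \<Rightarrow> Idt (CHom A Covar x y) a)"

definition fh :: "('o, 'u) cfun \<Rightarrow> kind \<Rightarrow> variance \<Rightarrow> 'o \<Rightarrow> 'o \<Rightarrow> 'u \<Rightarrow> 'u" where
  "fh F k v x y = fap k (CFHom F v x y)"

lemma el_ObK [simp]: "el A ObK x y a = a"
  by (simp add: el_def)

text \<open>The typing and extensionality conditions without unit and associativity laws. The
  passage to enriched data and back already works at this level.\<close>

definition pre_contra :: "('o, 'u) ccat \<Rightarrow> bool" where
  "pre_contra A \<longleftrightarrow>
     (\<forall>v. \<forall>x\<in>CObj A. \<forall>y\<in>CObj A. category (CHom A v x y)) \<and>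
     (\<forall>x\<in>CObj A. CId A x \<in> Ob (CHom A Covar x x)) \<and>
     (\<forall>v w. \<forall>x\<in>CObj A. \<forall>y\<in>CObj A. \<forall>z\<in>CObj A.
        is_functor (prod_cat (CHom A v y z) (vop v (CHom A w x y))) (CHom A (vmul v w) x z)
          (CComp A v w x y z)) \<and>
     (\<forall>v x y. \<not> (x \<in> CObj A \<and> y \<in> CObj A) \<longrightarrow> CHom A v x y = undefined) \<and>
     (\<forall>x. x \<notin> CObj A \<longrightarrow> CId A x = undefined) \<and>
     (\<forall>v w x y z. \<not> (x \<in> CObj A \<and> y \<in> CObj A \<and> z \<in> CObj A) \<longrightarrow> CComp A v w x y z = undefined)"

lemma contra_category_iff:
  "contra_category A \<longleftrightarrow> pre_contra A \<and>
     (\<forall>k v. \<forall>x\<in>CObj A. \<forall>y\<in>CObj A. \<forall>f\<in>hm A k v x y.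
        cmp A k Covar v x y y (el A k y y (CId A y)) f = f \<and>
        cmp A k v Covar x x y f (el A k x x (CId A x)) = f) \<and>
     (\<forall>k u v w. \<forall>x\<in>CObj A. \<forall>y\<in>CObj A. \<forall>z\<in>CObj A. \<forall>t\<in>CObj A.
        \<forall>h\<in>hm A k u z t. \<forall>g\<in>hm A k v y z. \<forall>f\<in>hm A k w x y.
           cmp A k u (vmul v w) x z t h (cmp A k v w x y z g f) =
           cmp A k (vmul u v) w x y t (cmp A k u v y z t h g) f)"
  unfolding contra_category_def pre_contra_def all_kind hm_def cmp_def el_def
  by (simp only: cel.simps fap.simps kind.case ball_conj_distrib all_conj_distrib,
      intro iffI conjI; elim conjE; assumption)

context
  fixes A :: "('o, 'u) ccat"
  assumes A: "pre_contra A"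
begin

lemma pre_category: "x \<in> CObj A \<Longrightarrow> y \<in> CObj A \<Longrightarrow> category (CHom A v x y)"
  and pre_CId: "x \<in> CObj A \<Longrightarrow> CId A x \<in> hm A ObK Covar x x"
  and pre_CComp: "x \<in> CObj A \<Longrightarrow> y \<in> CObj A \<Longrightarrow> z \<in> CObj A \<Longrightarrow>
    is_functor (prod_cat (CHom A v y z) (vop v (CHom A w x y))) (CHom A (vmul v w) x z) (CComp A v w x y z)"
  using A by (auto simp: pre_contra_def hm_def)

lemma cmp_in:
  "x \<in> CObj A \<Longrightarrow> y \<in> CObj A \<Longrightarrow> z \<in> CObj A \<Longrightarrow> g \<in> hm A k v y z \<Longrightarrow> f \<in> hm A k w x y \<Longrightarrow>
   cmp A k v w x y z g f \<in> hm A k (vmul v w) x z"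
  unfolding hm_def cmp_def by (rule functor_fap [OF pre_CComp]) auto

lemma el_in: "x \<in> CObj A \<Longrightarrow> y \<in> CObj A \<Longrightarrow> a \<in> hm A ObK Covar x y \<Longrightarrow> el A k x y a \<in> hm A k Covar x y"
  using pre_category by (cases k) (auto simp: el_def hm_def)

text \<open>At kind \<open>ArK\<close> this is preservation of identities by the composition
  functor.\<close>

lemma el_cmp:
  assumes "x \<in> CObj A" "y \<in> CObj A" "z \<in> CObj A" "b \<in> hm A ObK Covar y z" "a \<in> hm A ObK Covar x y"
  shows "el A k x z (cmp A ObK Covar Covar x y z b a) =
      cmp A k Covar Covar x y z (el A k y z b) (el A k x y a)"
  using assms functorD(5) [OF pre_CComp [of x y z Covar Covar], of "(b, a)"]
  by (cases k) (auto simp: el_def hm_def cmp_def)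

end

lemma contra_pre: "contra_category A \<Longrightarrow> pre_contra A"
  by (simp add: contra_category_iff)

lemmas ccat_in = cmp_in [OF contra_pre] el_in [OF contra_pre] pre_CId [OF contra_pre]

context
  fixes A :: "('o, 'u) ccat"
  assumes A: "contra_category A"
begin

lemma cmp_unit:
  "x \<in> CObj A \<Longrightarrow> y \<in> CObj A \<Longrightarrow> f \<in> hm A k v x y \<Longrightarrow> cmp A k Covar v x y y (el A k y y (CId A y)) f = f"
  "x \<in> CObj A \<Longrightarrow> y \<in> CObj A \<Longrightarrow> f \<in> hm A k v x y \<Longrightarrow> cmp A k v Covar x x y f (el A k x x (CId A x)) = f"
  using A by (simp_all add: contra_category_iff)

lemmas cmp_unit0 = cmp_unit [where k = ObK, simplified]

text \<open>The composite variances are variables with defining equations, because after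
  simplification a product of variances need no longer have the form
  \<open>vmul u v\<close>.\<close>

lemma cmp_assoc:
  "x \<in> CObj A \<Longrightarrow> y \<in> CObj A \<Longrightarrow> z \<in> CObj A \<Longrightarrow> t \<in> CObj A \<Longrightarrow>
   h \<in> hm A k u z t \<Longrightarrow> g \<in> hm A k v y z \<Longrightarrow> f \<in> hm A k w x y \<Longrightarrow> uv = vmul u v \<Longrightarrow> vw = vmul v w \<Longrightarrow>
   cmp A k uv w x y t (cmp A k u v y z t h g) f = cmp A k u vw x z t h (cmp A k v w x y z g f)"
  using A by (simp add: contra_category_iff)

end

section \<open>2-functors preserving contravariance\<close>

definition pre_cfun :: "('o, 'u) ccat \<Rightarrow> ('o, 'u) ccat \<Rightarrow> ('o, 'u) cfun \<Rightarrow> bool" where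
  "pre_cfun A B F \<longleftrightarrow>
     CFOb F \<in> CObj A \<rightarrow>\<^sub>E CObj B \<and>
     (\<forall>v. \<forall>x\<in>CObj A. \<forall>y\<in>CObj A.
        is_functor (CHom A v x y) (CHom B v (CFOb F x) (CFOb F y)) (CFHom F v x y)) \<and>
     (\<forall>v x y. \<not> (x \<in> CObj A \<and> y \<in> CObj A) \<longrightarrow> CFHom F v x y = undefined)"

lemma contra_functor_iff:
  "contra_functor A B F \<longleftrightarrow> pre_cfun A B F \<and>
     (\<forall>x\<in>CObj A. fh F ObK Covar x x (CId A x) = CId B (CFOb F x)) \<and>
     (\<forall>k v w. \<forall>x\<in>CObj A. \<forall>y\<in>CObj A. \<forall>z\<in>CObj A. \<forall>g\<in>hm A k v y z. \<forall>f\<in>hm A k w x y.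
        fh F k (vmul v w) x z (cmp A k v w x y z g f) =
        cmp B k v w (CFOb F x) (CFOb F y) (CFOb F z) (fh F k v y z g) (fh F k w x y f))"
  unfolding contra_functor_def pre_cfun_def all_kind hm_def cmp_def fh_def
  by (simp only: cel.simps fap.simps ball_conj_distrib all_conj_distrib,
      intro iffI conjI; elim conjE; assumption)

lemma contra_pre_cfun: "contra_functor A B F \<Longrightarrow> pre_cfun A B F"
  by (simp add: contra_functor_iff)

context
  fixes A B :: "('o, 'u) ccat" and F :: "('o, 'u) cfun"
  assumes F: "pre_cfun A B F"
begin

lemma pre_CFOb: "x \<in> CObj A \<Longrightarrow> CFOb F x \<in> CObj B"
  and pre_CFOb_ext: "CFOb F \<in> extensional (CObj A)"
  and pre_CFHom: "x \<in> CObj A \<Longrightarrow> y \<in> CObj A \<Longrightarrow>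
    is_functor (CHom A v x y) (CHom B v (CFOb F x) (CFOb F y)) (CFHom F v x y)"
  and pre_CFHom_ext: "x \<notin> CObj A \<or> y \<notin> CObj A \<Longrightarrow> CFHom F v x y = undefined"
  using F by (auto simp: pre_cfun_def PiE_def)

lemma fh_in: "x \<in> CObj A \<Longrightarrow> y \<in> CObj A \<Longrightarrow> f \<in> hm A k v x y \<Longrightarrow> fh F k v x y f \<in> hm B k v (CFOb F x) (CFOb F y)"
  unfolding hm_def fh_def by (rule functor_fap [OF pre_CFHom])

lemma fh_el: "x \<in> CObj A \<Longrightarrow> y \<in> CObj A \<Longrightarrow> a \<in> hm A ObK Covar x y \<Longrightarrow>
   el B k (CFOb F x) (CFOb F y) (fh F ObK Covar x y a) = fh F k Covar x y (el A k x y a)"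
  using functorD(5) [OF pre_CFHom, of x y a Covar] by (cases k) (auto simp: el_def fh_def hm_def)

end

lemma pre_cfun_eqI:
  assumes F: "pre_cfun A B F" and G: "pre_cfun A B G"
    and o: "\<And>x. x \<in> CObj A \<Longrightarrow> CFOb F x = CFOb G x"
    and h: "\<And>k v x y f. x \<in> CObj A \<Longrightarrow> y \<in> CObj A \<Longrightarrow> f \<in> hm A k v x y \<Longrightarrow> fh F k v x y f = fh G k v x y f"
  shows "F = G"
proof -
  have "CFOb F = CFOb G"
    using o pre_CFOb_ext [OF F] pre_CFOb_ext [OF G] by (auto intro: extensionalityI)
  moreover have "CFHom F v x y = CFHom G v x y" for v x y
  proof (cases "x \<in> CObj A \<and> y \<in> CObj A")
    case True
    then show ?thesis
      by (intro functor_fap_eqI [OF pre_CFHom [OF F] pre_CFHom [OF G]])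
        (auto simp: h [unfolded hm_def fh_def])
  next
    case False
    then show ?thesis using pre_CFHom_ext [OF F] pre_CFHom_ext [OF G] by metis
  qed
  ultimately show ?thesis by (intro cfun.equality) (auto simp: fun_eq_iff)
qed

context
  fixes A B :: "('o, 'u) ccat" and F :: "('o, 'u) cfun"
  assumes F: "contra_functor A B F"
begin

lemma fh_CId: "x \<in> CObj A \<Longrightarrow> fh F ObK Covar x x (CId A x) = CId B (CFOb F x)"
  using F by (simp add: contra_functor_iff)

lemma fh_cmp:
  "x \<in> CObj A \<Longrightarrow> y \<in> CObj A \<Longrightarrow> z \<in> CObj A \<Longrightarrow> g \<in> hm A k v y z \<Longrightarrow> f \<in> hm A k w x y \<Longrightarrow> vw = vmul v w \<Longrightarrow>
   fh F k vw x z (cmp A k v w x y z g f) =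
   cmp B k v w (CFOb F x) (CFOb F y) (CFOb F z) (fh F k v y z g) (fh F k w x y f)"
  using F by (simp add: contra_functor_iff)

end

lemmas cfun_in = pre_CFOb [OF contra_pre_cfun] fh_in [OF contra_pre_cfun]

lemma cid_fun_sel [simp]: "x \<in> CObj A \<Longrightarrow> CFOb (cid_fun A) x = x"
  "x \<in> CObj A \<Longrightarrow> y \<in> CObj A \<Longrightarrow> f \<in> hm A k v x y \<Longrightarrow> fh (cid_fun A) k v x y f = f"
  by (cases k; auto simp: cid_fun_def fh_def hm_def)+

lemma ccomp_fun_sel [simp]: "x \<in> CObj A \<Longrightarrow> CFOb (ccomp_fun A G F) x = CFOb G (CFOb F x)"
  "x \<in> CObj A \<Longrightarrow> y \<in> CObj A \<Longrightarrow> f \<in> hm A k v x y \<Longrightarrow>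
    fh (ccomp_fun A G F) k v x y f = fh G k v (CFOb F x) (CFOb F y) (fh F k v x y f)"
  by (cases k; auto simp: ccomp_fun_def fh_def hm_def compose_def)+

lemma cid_fun: "contra_category A \<Longrightarrow> contra_functor A A (cid_fun A)"
  unfolding contra_functor_iff pre_cfun_def
  by (auto simp: ccat_in) (auto simp: cid_fun_def is_functor_id_fun pre_category contra_pre)

lemma ccomp_fun:
  assumes A: "contra_category A" and F: "contra_functor A B F" and G: "contra_functor B C G"
  shows "contra_functor A C (ccomp_fun A G F)"
proof -
  have "pre_cfun A C (ccomp_fun A G F)"
    unfolding pre_cfun_def
    using pre_CFHom [OF contra_pre_cfun [OF F]] pre_CFHom [OF contra_pre_cfun [OF G]] 
      pre_CFOb [OF contra_pre_cfun [OF F]] pre_CFOb [OF contra_pre_cfun [OF G]]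
          pre_category [OF contra_pre [OF A]]
    by (auto simp: ccomp_fun_def compose_def intro!: is_functor_comp_fun)
  then show ?thesis
    using A F G unfolding contra_functor_iff [of A C]
    by (simp add: ccat_in cfun_in fh_CId fh_cmp)
qed

section \<open>2-natural transformations and their vertical composition\<close>

definition cnat :: "('o, 'u) ccat \<Rightarrow> ('o, 'u) ccat \<Rightarrow> ('o, 'u) ccell \<Rightarrow> bool" where
  "cnat A B \<alpha> \<longleftrightarrow> contra_functor A B (src \<alpha>) \<and> contra_functor A B (trg \<alpha>) \<and>
     contra_nat A B (src \<alpha>) (trg \<alpha>) (mor \<alpha>)"

lemma contra_nat_iff:
  "contra_nat A B F F' \<alpha> \<longleftrightarrow> \<alpha> \<in> extensional (CObj A) \<and>
     (\<forall>x\<in>CObj A. \<alpha> x \<in> hm B ObK Covar (CFOb F x) (CFOb F' x)) \<and>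
     (\<forall>k v. \<forall>x\<in>CObj A. \<forall>y\<in>CObj A. \<forall>f\<in>hm A k v x y.
        cmp B k Covar v (CFOb F x) (CFOb F y) (CFOb F' y) (el B k (CFOb F y) (CFOb F' y) (\<alpha> y))
            (fh F k v x y f) =
        cmp B k v Covar (CFOb F x) (CFOb F' x) (CFOb F' y) (fh F' k v x y f)
            (el B k (CFOb F x) (CFOb F' x) (\<alpha> x)))"
  unfolding contra_nat_def all_kind hm_def cmp_def fh_def el_def
  by (simp only: cel.simps fap.simps kind.case ball_conj_distrib all_conj_distrib)

context
  fixes A B :: "('o, 'u) ccat" and \<alpha> :: "('o, 'u) ccell"
  assumes \<alpha>: "cnat A B \<alpha>"
begin

lemma cnat_fun: "contra_functor A B (src \<alpha>)" "contra_functor A B (trg \<alpha>)"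
  using \<alpha> by (auto simp: cnat_def)

lemma cnat_in: "x \<in> CObj A \<Longrightarrow> mor \<alpha> x \<in> hm B ObK Covar (CFOb (src \<alpha>) x) (CFOb (trg \<alpha>) x)"
  using \<alpha> by (auto simp: cnat_def contra_nat_iff)

lemma cnat_ext: "mor \<alpha> \<in> extensional (CObj A)"
  using \<alpha> by (auto simp: cnat_def contra_nat_iff)

lemma cnat_nat:
  "x \<in> CObj A \<Longrightarrow> y \<in> CObj A \<Longrightarrow> f \<in> hm A k v x y \<Longrightarrow>
   cmp B k Covar v (CFOb (src \<alpha>) x) (CFOb (src \<alpha>) y) (CFOb (trg \<alpha>) y)
     (el B k (CFOb (src \<alpha>) y) (CFOb (trg \<alpha>) y) (mor \<alpha> y)) (fh (src \<alpha>) k v x y f) =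
   cmp B k v Covar (CFOb (src \<alpha>) x) (CFOb (trg \<alpha>) x) (CFOb (trg \<alpha>) y)
     (fh (trg \<alpha>) k v x y f) (el B k (CFOb (src \<alpha>) x) (CFOb (trg \<alpha>) x) (mor \<alpha> x))"
  using \<alpha> by (auto simp: cnat_def contra_nat_iff)

end

lemma cnat_eqI:
  assumes "cnat A B \<alpha>" "cnat A B \<beta>" "src \<alpha> = src \<beta>" "trg \<alpha> = trg \<beta>"
    "\<And>x. x \<in> CObj A \<Longrightarrow> mor \<alpha> x = mor \<beta> x"
  shows "\<alpha> = \<beta>"
  using assms cnat_ext [OF assms(1)] cnat_ext [OF assms(2)]
  by (intro arrow.equality) (auto intro: extensionalityI)

definition cvid :: "('o, 'u) ccat \<Rightarrow> ('o, 'u) ccat \<Rightarrow> ('o, 'u) cfun \<Rightarrow> ('o, 'u) ccell" where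
  "cvid A B F = \<lparr>src = F, mor = (\<lambda>x\<in>CObj A. CId B (CFOb F x)), trg = F\<rparr>"

definition cvcomp :: "('o, 'u) ccat \<Rightarrow> ('o, 'u) ccat \<Rightarrow> ('o, 'u) ccell \<Rightarrow> ('o, 'u) ccell \<Rightarrow>
    ('o, 'u) ccell" where
  "cvcomp A B \<beta> \<alpha> = \<lparr>src = src \<alpha>,
     mor = (\<lambda>x\<in>CObj A. cmp B ObK Covar Covar (CFOb (src \<alpha>) x) (CFOb (src \<beta>) x) (CFOb (trg \<beta>) x)
         (mor \<beta> x) (mor \<alpha> x)),
     trg = trg \<beta>\<rparr>"

definition chcomp :: "('o, 'u) ccat \<Rightarrow> ('o, 'u) ccat \<Rightarrow> ('o, 'u) ccell \<Rightarrow> ('o, 'u) ccell \<Rightarrow>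
    ('o, 'u) ccell" where
  "chcomp A C \<beta> \<alpha> = \<lparr>src = ccomp_fun A (src \<beta>) (src \<alpha>),
     mor = (\<lambda>x\<in>CObj A.
        cmp C ObK Covar Covar (CFOb (src \<beta>) (CFOb (src \<alpha>) x)) (CFOb (src \<beta>) (CFOb (trg \<alpha>) x))
            (CFOb (trg \<beta>) (CFOb (trg \<alpha>) x))
          (mor \<beta> (CFOb (trg \<alpha>) x)) (fh (src \<beta>) ObK Covar (CFOb (src \<alpha>) x) (CFOb (trg \<alpha>) x) (mor \<alpha> x))),
     trg = ccomp_fun A (trg \<beta>) (trg \<alpha>)\<rparr>"

lemma ccat_hom_eq: "ccat_hom A B = mk_cat {F. contra_functor A B F} {\<alpha>. cnat A B \<alpha>} src trg (cvid A B)
    (cvcomp A B)"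
  by (simp add: ccat_hom_def cnat_def cvid_def [abs_def] cvcomp_def [abs_def] cmp_def)

lemma CCat_eq: "CCat = \<lparr>TObj = {A. contra_category A}, THom = ccat_hom, TId = cid_fun,
    TComp = (\<lambda>A B C. mk_fun (prod_cat (ccat_hom B C) (ccat_hom A B))
      (\<lambda>(G, F). ccomp_fun A G F) (\<lambda>(\<beta>, \<alpha>). chcomp A C \<beta> \<alpha>))\<rparr>"
  by (simp add: CCat_def chcomp_def cmp_def fh_def Let_def)

lemma cvid:
  assumes A: "contra_category A" and B: "contra_category B" and F: "contra_functor A B F"
  shows "cnat A B (cvid A B F)"
  using A B F
  by (auto simp: cnat_def cvid_def contra_nat_iff ccat_in cfun_in cmp_unit)

text \<open>Two naturality squares are pasted: the element of the hom moves past \<alpha>, then past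
  \<beta>, with associativity regrouping in between. The argument is the same for both variances
  since the components of \<alpha> and \<beta> are covariant.\<close>

lemma cvcomp:
  assumes B: "contra_category B" and \<beta>: "cnat A B \<beta>" and \<alpha>: "cnat A B \<alpha>"
    and st: "src \<beta> = trg \<alpha>"
  shows "cnat A B (cvcomp A B \<beta> \<alpha>)"
proof -
  define F F' F'' where d: "F = src \<alpha>" "F' = trg \<alpha>" "F'' = trg \<beta>"
  note n\<alpha> = cnat_nat [OF \<alpha>, folded d] and n\<beta> = cnat_nat [OF \<beta>, unfolded st, folded d]
  note i\<alpha> = cnat_in [OF \<alpha>, folded d] and i\<beta> = cnat_in [OF \<beta>, unfolded st, folded d]
  have F: "contra_functor A B F" "contra_functor A B F'" "contra_functor A B F''"
    using cnat_fun [OF \<alpha>] cnat_fun [OF \<beta>] by (simp_all add: d)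
  note [simp] = ccat_in [OF B] cfun_in [OF F(1)] cfun_in [OF F(2)] cfun_in [OF F(3)] i\<alpha> i\<beta>
  \<comment> \<open>Here the product of variances in \<open>cmp_in\<close> has been reduced to
    \<open>Covar\<close>, so that the fact can be used as a rewrite rule.\<close>
  have [simp]: "cmp B ObK Covar Covar (CFOb F x) (CFOb F' x) (CFOb F'' x) (mor \<beta> x) (mor \<alpha> x)
      \<in> hm B ObK Covar (CFOb F x) (CFOb F'' x)" if "x \<in> CObj A" for x
    using that cmp_in [OF contra_pre [OF B], of "CFOb F x" "CFOb F' x" "CFOb F'' x" "mor \<beta> x"
        ObK Covar "mor \<alpha> x" Covar]
    by simp
  have "cmp B k Covar v (CFOb F x) (CFOb F y) (CFOb F'' y)
      (el B k (CFOb F y) (CFOb F'' y) (cmp B ObK Covar Covar (CFOb F y) (CFOb F' y) (CFOb F'' y)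
          (mor \<beta> y) (mor \<alpha> y)))
      (fh F k v x y f) =
    cmp B k v Covar (CFOb F x) (CFOb F'' x) (CFOb F'' y) (fh F'' k v x y f)
      (el B k (CFOb F x) (CFOb F'' x) (cmp B ObK Covar Covar (CFOb F x) (CFOb F' x) (CFOb F'' x)
          (mor \<beta> x) (mor \<alpha> x)))"
    (is "?l = ?r") if [simp]: "x \<in> CObj A" "y \<in> CObj A" "f \<in> hm A k v x y" for k v x y f
  proof -
    let ?e = "\<lambda>F G x \<alpha>. el B k (CFOb F x) (CFOb G x) (mor \<alpha> x)"
    have "?l = cmp B k Covar v (CFOb F x) (CFOb F y) (CFOb F'' y)
        (cmp B k Covar Covar (CFOb F y) (CFOb F' y) (CFOb F'' y) (?e F' F'' y \<beta>) (?e F F' y \<alpha>))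
            (fh F k v x y f)"
      by (simp add: el_cmp [OF contra_pre [OF B]])
    also have "\<dots> = cmp B k Covar v (CFOb F x) (CFOb F' y) (CFOb F'' y) (?e F' F'' y \<beta>)
        (cmp B k Covar v (CFOb F x) (CFOb F y) (CFOb F' y) (?e F F' y \<alpha>) (fh F k v x y f))"
      by (rule cmp_assoc [OF B]) auto
    also have "\<dots> = cmp B k Covar v (CFOb F x) (CFOb F' y) (CFOb F'' y) (?e F' F'' y \<beta>)
        (cmp B k v Covar (CFOb F x) (CFOb F' x) (CFOb F' y) (fh F' k v x y f) (?e F F' x \<alpha>))"
      by (simp add: n\<alpha>)
    also have "\<dots> = cmp B k v Covar (CFOb F x) (CFOb F' x) (CFOb F'' y)
        (cmp B k Covar v (CFOb F' x) (CFOb F' y) (CFOb F'' y) (?e F' F'' y \<beta>) (fh F' k v x y f))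
            (?e F F' x \<alpha>)"
      by (rule cmp_assoc [OF B, symmetric]) auto
    also have "\<dots> = cmp B k v Covar (CFOb F x) (CFOb F' x) (CFOb F'' y)
        (cmp B k v Covar (CFOb F' x) (CFOb F'' x) (CFOb F'' y) (fh F'' k v x y f) (?e F' F'' x \<beta>))
            (?e F F' x \<alpha>)"
      by (simp add: n\<beta>)
    also have "\<dots> = cmp B k v Covar (CFOb F x) (CFOb F'' x) (CFOb F'' y) (fh F'' k v x y f)
        (cmp B k Covar Covar (CFOb F x) (CFOb F' x) (CFOb F'' x) (?e F' F'' x \<beta>) (?e F F' x \<alpha>))"
      by (rule cmp_assoc [OF B]) auto
    also have "\<dots> = ?r"
      by (simp add: el_cmp [OF contra_pre [OF B]])
    finally show ?thesis .
  qed
  then show ?thesis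
    using F by (simp add: cnat_def contra_nat_iff cvcomp_def st flip: d)
qed

text \<open>Transformations are equal when their components are, and on components the category laws
  are the unit and associativity laws of \<open>B\<close> for covariant 1-cells.\<close>

lemma category_ccat_hom:
  assumes A: "contra_category A" and B: "contra_category B"
  shows "category (ccat_hom A B)"
  unfolding ccat_hom_eq
proof (rule category_mk_catI; (unfold mem_Collect_eq)?)
  show c: "cnat A B (cvcomp A B g f)" if "cnat A B g" "cnat A B f" "src g = trg f" for g f
    using that by (rule cvcomp [OF B])
  show i: "cnat A B (cvid A B F)" if "contra_functor A B F" for F
    using that by (rule cvid [OF A B])
  have [simp]: "src (cvcomp A B g f) = src f" "trg (cvcomp A B g f) = trg g"
    "src (cvid A B F) = F" "trg (cvid A B F) = F" for g f F
    by (simp_all add: cvcomp_def cvid_def)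
  show "cvcomp A B f (cvid A B (src f)) = f" if f: "cnat A B f" for f
    using cnat_fun [OF f] cnat_in [OF f] B
    by (intro cnat_eqI [OF c f] i f) (auto simp: cmp_unit0 cfun_in cvid_def cvcomp_def)
  show "cvcomp A B (cvid A B (trg f)) f = f" if f: "cnat A B f" for f
    using cnat_fun [OF f] cnat_in [OF f] B
    by (intro cnat_eqI [OF c f] i f) (auto simp: cmp_unit0 cfun_in cvid_def cvcomp_def)
  show "cvcomp A B (cvcomp A B h g) f = cvcomp A B h (cvcomp A B g f)"
    if h: "cnat A B h" and g: "cnat A B g" and f: "cnat A B f" and hg: "src h =
        trg g" and gf: "src g = trg f" for h g f
    using cnat_fun [OF f] cnat_in [OF f] cnat_fun [OF g] cnat_in [OF g] cnat_fun [OF h] cnat_in [OF h]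
        B hg gf
    by (intro cnat_eqI [OF c c] c f g h) (auto simp: cfun_in cvcomp_def intro!: cmp_assoc)
qed (auto simp: cnat_fun cvid_def cvcomp_def)

lemma ccomp_cid:
  assumes A: "contra_category A" and B: "contra_category B" and F: "contra_functor A B F"
  shows "ccomp_fun A (cid_fun B) F = F" "ccomp_fun A F (cid_fun A) = F"
  using ccomp_fun [OF A F cid_fun [OF B]] ccomp_fun [OF A cid_fun [OF A] F] F
  by (auto intro!: pre_cfun_eqI [OF contra_pre_cfun contra_pre_cfun] simp: cfun_in [OF F])

lemma ccomp_assoc:
  assumes A: "contra_category A" and B: "contra_category B" and F: "contra_functor A B F"
    and G: "contra_functor B C G" and H: "contra_functor C D H"
  shows "ccomp_fun A (ccomp_fun B H G) F = ccomp_fun A H (ccomp_fun A G F)"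
  using ccomp_fun [OF A F ccomp_fun [OF B G H]] ccomp_fun [OF A ccomp_fun [OF A F G] H]
  by (auto intro!: pre_cfun_eqI [OF contra_pre_cfun contra_pre_cfun] simp: cfun_in [OF F])

section \<open>Whiskering, horizontal composition and interchange\<close>

definition whisker_left :: "('o, 'u) ccat \<Rightarrow> ('o, 'u) cfun \<Rightarrow> ('o, 'u) ccell \<Rightarrow> ('o, 'u) ccell" where
  "whisker_left A G \<alpha> = \<lparr>src = ccomp_fun A G (src \<alpha>),
     mor = (\<lambda>x\<in>CObj A. fh G ObK Covar (CFOb (src \<alpha>) x) (CFOb (trg \<alpha>) x) (mor \<alpha> x)),
     trg = ccomp_fun A G (trg \<alpha>)\<rparr>"

definition whisker_right :: "('o, 'u) ccat \<Rightarrow> ('o, 'u) ccell \<Rightarrow> ('o, 'u) cfun \<Rightarrow> ('o, 'u) ccell" where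
  "whisker_right A \<beta> F = \<lparr>src = ccomp_fun A (src \<beta>) F, mor = (\<lambda>x\<in>CObj A. mor \<beta> (CFOb F x)),
     trg = ccomp_fun A (trg \<beta>) F\<rparr>"

text \<open>The horizontal composite is \<beta> whiskered by the target of \<alpha>, after \<alpha>
  whiskered by the source of \<beta>. Its naturality then follows from whiskering and vertical
  composition.\<close>

lemma chcomp_eq: "chcomp A C \<beta> \<alpha> = cvcomp A C (whisker_right A \<beta> (trg \<alpha>)) (whisker_left A (src \<beta>) \<alpha>)"
  by (auto simp: chcomp_def cvcomp_def whisker_left_def whisker_right_def)

text \<open>The required square is the image under \<open>G\<close> of the naturality square of
  \<alpha>, since \<open>G\<close> preserves composition and identities.\<close>

lemma whisker_left:
  assumes A: "contra_category A" and B: "contra_category B" and G: "contra_functor B C G"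
      and \<alpha>: "cnat A B \<alpha>"
  shows "cnat A C (whisker_left A G \<alpha>)"
proof -
  note F = cnat_fun(1) [OF \<alpha>] and F' = cnat_fun(2) [OF \<alpha>]
  note [simp] = ccat_in [OF B] cfun_in [OF F] cfun_in [OF F'] cfun_in [OF G] cnat_in [OF \<alpha>]
  let ?F = "src \<alpha>" and ?F' = "trg \<alpha>"
  have "cmp C k Covar v (CFOb G (CFOb ?F x)) (CFOb G (CFOb ?F y)) (CFOb G (CFOb ?F' y))
      (el C k (CFOb G (CFOb ?F y)) (CFOb G (CFOb ?F' y))
          (fh G ObK Covar (CFOb ?F y) (CFOb ?F' y) (mor \<alpha> y)))
      (fh G k v (CFOb ?F x) (CFOb ?F y) (fh ?F k v x y f)) =
    cmp C k v Covar (CFOb G (CFOb ?F x)) (CFOb G (CFOb ?F' x)) (CFOb G (CFOb ?F' y))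
      (fh G k v (CFOb ?F' x) (CFOb ?F' y) (fh ?F' k v x y f))
      (el C k (CFOb G (CFOb ?F x)) (CFOb G (CFOb ?F' x))
          (fh G ObK Covar (CFOb ?F x) (CFOb ?F' x) (mor \<alpha> x)))"
    if [simp]: "x \<in> CObj A" "y \<in> CObj A" "f \<in> hm A k v x y" for x y k v f
    using cnat_nat [OF \<alpha> that]
    by (simp add: fh_el [OF contra_pre_cfun [OF G]] flip: fh_cmp [OF G])
  then show ?thesis
    using ccomp_fun [OF A F G] ccomp_fun [OF A F' G]
    by (simp add: cnat_def contra_nat_iff whisker_left_def)
qed

text \<open>The required square is that of \<beta> at the image under \<open>F\<close> of the given
  element.\<close>

lemma whisker_right:
  assumes A: "contra_category A" and F: "contra_functor A B F" and \<beta>: "cnat B C \<beta>"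
  shows "cnat A C (whisker_right A \<beta> F)"
  using ccomp_fun [OF A F cnat_fun(1) [OF \<beta>]] ccomp_fun [OF A F cnat_fun(2) [OF \<beta>]]
  by (simp add: cnat_def contra_nat_iff whisker_right_def cfun_in [OF F] cnat_in [OF \<beta>] cnat_nat [OF \<beta>])

lemma chcomp:
  assumes A: "contra_category A" and B: "contra_category B" and C: "contra_category C"
    and \<beta>: "cnat B C \<beta>" and \<alpha>: "cnat A B \<alpha>"
  shows "cnat A C (chcomp A C \<beta> \<alpha>)"
  unfolding chcomp_eq
  by (rule cvcomp [OF C whisker_right [OF A cnat_fun(2) [OF \<alpha>] \<beta>]
      whisker_left [OF A B cnat_fun(1) [OF \<beta>] \<alpha>]])
    (simp add: whisker_left_def whisker_right_def)

lemma chcomp_sel [simp]: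
  "src (chcomp A C \<beta> \<alpha>) = ccomp_fun A (src \<beta>) (src \<alpha>)" "trg (chcomp A C \<beta> \<alpha>) = ccomp_fun A (trg \<beta>) (trg \<alpha>)"
  "x \<in> CObj A \<Longrightarrow> mor (chcomp A C \<beta> \<alpha>) x =
     cmp C ObK Covar Covar (CFOb (src \<beta>) (CFOb (src \<alpha>) x)) (CFOb (src \<beta>) (CFOb (trg \<alpha>) x))
         (CFOb (trg \<beta>) (CFOb (trg \<alpha>) x))
          (mor \<beta> (CFOb (trg \<alpha>) x)) (fh (src \<beta>) ObK Covar (CFOb (src \<alpha>) x) (CFOb (trg \<alpha>) x) (mor \<alpha> x))"
  by (simp_all add: chcomp_def)

lemma cvcomp_sel [simp]:
  "src (cvcomp A B \<beta> \<alpha>) = src \<alpha>" "trg (cvcomp A B \<beta> \<alpha>) = trg \<beta>"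
  "x \<in> CObj A \<Longrightarrow> mor (cvcomp A B \<beta> \<alpha>) x =
     cmp B ObK Covar Covar (CFOb (src \<alpha>) x) (CFOb (src \<beta>) x) (CFOb (trg \<beta>) x) (mor \<beta> x) (mor \<alpha> x)"
  by (simp_all add: cvcomp_def)

lemma cvid_sel [simp]: "src (cvid A B F) = F" "trg (cvid A B F) = F"
  "x \<in> CObj A \<Longrightarrow> mor (cvid A B F) x = CId B (CFOb F x)"
  by (simp_all add: cvid_def)

lemma chcomp_cvid:
  assumes A: "contra_category A" and B: "contra_category B" and C: "contra_category C"
    and G: "contra_functor B C G" and F: "contra_functor A B F"
  shows "chcomp A C (cvid B C G) (cvid A B F) = cvid A C (ccomp_fun A G F)"
  by (rule cnat_eqI [OF chcomp [OF A B C cvid [OF B C G] cvid [OF A B F]]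
      cvid [OF A C ccomp_fun [OF A F G]]])
    (simp_all add: cfun_in [OF F] cfun_in [OF G] ccat_in [OF C] fh_CId [OF G] cmp_unit0 [OF C])

text \<open>Both components at \<open>x\<close> compose parts of \<beta>', \<beta>, \<alpha>' and
  \<alpha>. They differ only in whether \<beta> is applied after or before the image of \<alpha>',
  which is naturality of \<beta> at the component of \<alpha>'.\<close>

lemma chcomp_interchange:
  assumes A: "contra_category A" and B: "contra_category B" and C: "contra_category C"
    and \<alpha>: "cnat A B \<alpha>" and \<alpha>': "cnat A B \<alpha>'" and \<alpha>\<alpha>': "src \<alpha>' = trg \<alpha>"
    and \<beta>: "cnat B C \<beta>" and \<beta>': "cnat B C \<beta>'" and \<beta>\<beta>': "src \<beta>' = trg \<beta>"
  shows "chcomp A C (cvcomp B C \<beta>' \<beta>) (cvcomp A B \<alpha>' \<alpha>) = cvcomp A C (chcomp A C \<beta>' \<alpha>') (chcomp A C \<beta> \<alpha>)"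
proof (rule cnat_eqI)
  note v\<alpha> = cvcomp [OF B \<alpha>' \<alpha> \<alpha>\<alpha>'] and v\<beta> = cvcomp [OF C \<beta>' \<beta> \<beta>\<beta>']
  show "cnat A C (chcomp A C (cvcomp B C \<beta>' \<beta>) (cvcomp A B \<alpha>' \<alpha>))"
    by (rule chcomp [OF A B C v\<beta> v\<alpha>])
  show "cnat A C (cvcomp A C (chcomp A C \<beta>' \<alpha>') (chcomp A C \<beta> \<alpha>))"
    by (rule cvcomp [OF C chcomp [OF A B C \<beta>' \<alpha>'] chcomp [OF A B C \<beta> \<alpha>]]) (simp add: \<alpha>\<alpha>' \<beta>\<beta>')
  fix x assume x [simp]: "x \<in> CObj A"
  define F F' F'' G G' G'' where d: "F = src \<alpha>" "F' = trg \<alpha>" "F'' = trg \<alpha>'" "G = src \<beta>" "G' =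
      trg \<beta>" "G'' = trg \<beta>'"
  have fF: "contra_functor A B F" "contra_functor A B F'" "contra_functor A B F''"
    and fG: "contra_functor B C G" "contra_functor B C G'" "contra_functor B C G''"
    using cnat_fun [OF \<alpha>] cnat_fun [OF \<alpha>'] cnat_fun [OF \<beta>] cnat_fun [OF \<beta>'] by (simp_all add: d)
  note [simp] = cfun_in [OF fF(1)] cfun_in [OF fF(2)] cfun_in [OF fF(3)]
    cfun_in [OF fG(1)] cfun_in [OF fG(2)] cfun_in [OF fG(3)]
    cnat_in [OF \<alpha>, folded d] cnat_in [OF \<alpha>', unfolded \<alpha>\<alpha>', folded d]
    cnat_in [OF \<beta>, folded d] cnat_in [OF \<beta>', unfolded \<beta>\<beta>', folded d]
  have cin [simp]: "cmp C ObK Covar Covar x y z g f \<in> hm C ObK Covar x z"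
    if "x \<in> CObj C" "y \<in> CObj C" "z \<in> CObj C" "g \<in> hm C ObK Covar y z" "f \<in> hm C ObK Covar x y"
        for x y z g f
    using that cmp_in [OF contra_pre [OF C], of x y z g ObK Covar f Covar] by simp
  define X X' X'' where X: "X = CFOb F x" "X' = CFOb F' x" "X'' = CFOb F'' x"
  have [simp]: "X \<in> CObj B" "X' \<in> CObj B" "X'' \<in> CObj B" by (simp_all add: X)
  define a a' where a: "a = mor \<alpha> x" "a' = mor \<alpha>' x"
  have [simp]: "a \<in> hm B ObK Covar X X'" "a' \<in> hm B ObK Covar X' X''" by (simp_all add: X a)
  let ?m = "cmp C ObK Covar Covar" and ?G = "fh G ObK Covar" and ?G' = "fh G' ObK Covar"
  have n: "?m (CFOb G X') (CFOb G X'') (CFOb G' X'') (mor \<beta> X'') (?G X' X'' a') =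
    ?m (CFOb G X') (CFOb G' X') (CFOb G' X'') (?G' X' X'' a') (mor \<beta> X')"
    using cnat_nat [OF \<beta>, of X' X'' a' ObK Covar] by (simp flip: d)
  have "?m (CFOb G X) (CFOb G X'') (CFOb G'' X'')
      (?m (CFOb G X'') (CFOb G' X'') (CFOb G'' X'') (mor \<beta>' X'') (mor \<beta> X''))
      (?G X X'' (cmp B ObK Covar Covar X X' X'' a' a)) =
    ?m (CFOb G X) (CFOb G' X'') (CFOb G'' X'') (mor \<beta>' X'')
        (?m (CFOb G X) (CFOb G X'') (CFOb G' X'') (mor \<beta> X'')
      (?m (CFOb G X) (CFOb G X') (CFOb G X'') (?G X' X'' a') (?G X X' a)))"
    by (simp add: fh_cmp [OF fG(1)] cmp_assoc [OF C])
  also have "?m (CFOb G X) (CFOb G X'') (CFOb G' X'') (mor \<beta> X'')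
      (?m (CFOb G X) (CFOb G X') (CFOb G X'') (?G X' X'' a') (?G X X' a)) =
    ?m (CFOb G X) (CFOb G X') (CFOb G' X'')
      (?m (CFOb G X') (CFOb G' X') (CFOb G' X'') (?G' X' X'' a') (mor \<beta> X')) (?G X X' a)"
    by (subst n [symmetric], rule cmp_assoc [OF C, symmetric]) auto
  also have "?m (CFOb G X) (CFOb G' X'') (CFOb G'' X'') (mor \<beta>' X'') \<dots> =
    ?m (CFOb G X) (CFOb G' X') (CFOb G'' X'') (?m (CFOb G' X') (CFOb G' X'') (CFOb G'' X'')
        (mor \<beta>' X'') (?G' X' X'' a'))
      (?m (CFOb G X) (CFOb G X') (CFOb G' X') (mor \<beta> X') (?G X X' a))"
    by (simp add: cmp_assoc [OF C])
  finally show "mor (chcomp A C (cvcomp B C \<beta>' \<beta>) (cvcomp A B \<alpha>' \<alpha>)) x =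
      mor (cvcomp A C (chcomp A C \<beta>' \<alpha>') (chcomp A C \<beta> \<alpha>)) x"
    by (simp add: \<alpha>\<alpha>' \<beta>\<beta>' X a flip: d)
qed (simp_all add: \<alpha>\<alpha>' \<beta>\<beta>')

lemma chcomp_unit:
  assumes A: "contra_category A" and B: "contra_category B" and \<alpha>: "cnat A B \<alpha>"
  shows "chcomp A B (cvid B B (cid_fun B)) \<alpha> = \<alpha>" "chcomp A B \<alpha> (cvid A A (cid_fun A)) = \<alpha>"
  using ccomp_cid [OF A B cnat_fun(1) [OF \<alpha>]] ccomp_cid [OF A B cnat_fun(2) [OF \<alpha>]]
    cfun_in [OF cnat_fun(1) [OF \<alpha>]] cfun_in [OF cnat_fun(2) [OF \<alpha>]] cnat_in [OF \<alpha>]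
        fh_CId [OF cnat_fun(1) [OF \<alpha>]]
  by (auto intro!: cnat_eqI [OF chcomp [OF A B B cvid [OF B B cid_fun [OF B]] \<alpha>] \<alpha>]
      cnat_eqI [OF chcomp [OF A A B \<alpha> cvid [OF A A cid_fun [OF A]]] \<alpha>]
      simp: cmp_unit0 [OF B] ccat_in [OF A])

text \<open>On components, the source 2-functor of \<gamma> preserves composition, and the rest is
  associativity in \<open>D\<close>.\<close>

lemma chcomp_assoc:
  assumes A: "contra_category A" and B: "contra_category B" and C: "contra_category C"
      and D: "contra_category D"
    and \<alpha>: "cnat A B \<alpha>" and \<beta>: "cnat B C \<beta>" and \<gamma>: "cnat C D \<gamma>"
  shows "chcomp A D \<gamma> (chcomp A C \<beta> \<alpha>) = chcomp A D (chcomp B D \<gamma> \<beta>) \<alpha>"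
proof (rule cnat_eqI)
  note F = cnat_fun [OF \<alpha>] and G = cnat_fun [OF \<beta>] and H = cnat_fun [OF \<gamma>]
  note [simp] = cfun_in [OF F(1)] cfun_in [OF F(2)] cfun_in [OF G(1)] cfun_in [OF G(2)]
    cfun_in [OF H(1)] cfun_in [OF H(2)] cnat_in [OF \<alpha>] cnat_in [OF \<beta>] cnat_in [OF \<gamma>]
  show "cnat A D (chcomp A D \<gamma> (chcomp A C \<beta> \<alpha>))" "cnat A D (chcomp A D (chcomp B D \<gamma> \<beta>) \<alpha>)"
    by (rule chcomp [OF A C D \<gamma> chcomp [OF A B C \<beta> \<alpha>]], rule chcomp [OF A B D chcomp [OF B C D \<gamma> \<beta>] \<alpha>])
  show "src (chcomp A D \<gamma> (chcomp A C \<beta> \<alpha>)) = src (chcomp A D (chcomp B D \<gamma> \<beta>) \<alpha>)"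
    "trg (chcomp A D \<gamma> (chcomp A C \<beta> \<alpha>)) = trg (chcomp A D (chcomp B D \<gamma> \<beta>) \<alpha>)"
    using F G H by (simp_all add: ccomp_assoc [OF A B])
  fix x assume [simp]: "x \<in> CObj A"
  show "mor (chcomp A D \<gamma> (chcomp A C \<beta> \<alpha>)) x = mor (chcomp A D (chcomp B D \<gamma> \<beta>) \<alpha>) x"
    by (simp add: fh_cmp [OF H(1)] cmp_assoc [OF D])
qed

theorem two_category_CCat: "two_category (CCat :: (('o, 'u) ccat, ('o, 'u) cfun, ('o, 'u) ccell) twocat)"
proof -
  \<comment> \<open>Functoriality of horizontal composition consists of its effect on identities,
    \<open>chcomp_cvid\<close>, and of the interchange law.\<close>
  have f: "is_functor (prod_cat (ccat_hom B C) (ccat_hom A B)) (ccat_hom A C)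
      (mk_fun (prod_cat (ccat_hom B C) (ccat_hom A B)) (\<lambda>(G, F). ccomp_fun A G F)
          (\<lambda>(\<beta>, \<alpha>). chcomp A C \<beta> \<alpha>))"
    if [simp]: "contra_category A" "contra_category B" "contra_category C" for A B C :: "('o, 'u) ccat"
  proof (rule is_functor_mk_funI)
    show "category (prod_cat (ccat_hom B C) (ccat_hom A B))"
      by (simp add: category_ccat_hom)
  qed (auto simp: ccat_hom_eq ccomp_fun chcomp [OF that] chcomp_cvid [OF that] chcomp_interchange [OF that]
        cvcomp cvid cnat_fun)
  show ?thesis
    unfolding two_category_def CCat_eq
    by (simp add: category_ccat_hom f) 
      (auto simp: ccat_hom_eq cid_fun ccomp_fun ccomp_cid ccomp_assoc [rotated 2] chcomp [rotated 3]
          chcomp_unit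
        chcomp_assoc [rotated 4] cvid)
qed

section \<open>Transport of 2-category structure along an isomorphism\<close>

text \<open>Off their domains, the structure maps have the junk values that \<^const>\<open>mk_cat\<close> gives them.\<close>

definition norm_cat :: "('o, 'm) cat \<Rightarrow> bool" where
  "norm_cat D \<longleftrightarrow> mk_cat (Ob D) (Ar D) (Dom D) (Cod D) (Idt D) (Cmp D) = D"

lemma norm_mk_cat: "norm_cat (mk_cat X A d c i m)"
  unfolding norm_cat_def by (auto simp: mk_cat_def fun_eq_iff)

text \<open>The structure of \<open>D\<close> is the image of that of \<open>C\<close>. As
  \<open>D\<close> is not yet known to be a category, \<open>norm_cat\<close> supplies the default
  values off the domains.\<close>

lemma category_transport:
  assumes C: "category C" and D: "norm_cat D"
    and p: "bij_betw p (Ob C) (Ob D)" and q: "bij_betw q (Ar C) (Ar D)"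
    and dom: "\<And>f. f \<in> Ar C \<Longrightarrow> Dom D (q f) = p (Dom C f)"
    and cod: "\<And>f. f \<in> Ar C \<Longrightarrow> Cod D (q f) = p (Cod C f)"
    and idt: "\<And>a. a \<in> Ob C \<Longrightarrow> Idt D (p a) = q (Idt C a)"
    and cmp: "\<And>g f. composable C g f \<Longrightarrow> q g \<cdot>\<^bsub>D\<^esub> q f = q (g \<cdot>\<^bsub>C\<^esub> f)"
  shows "category D"
proof -
  have e: "Ob D = p ` Ob C" "Ar D = q ` Ar C"
    using p q by (auto simp: bij_betw_def)
  have i: "inj_on p (Ob C)" using p by (simp add: bij_betw_def)
  \<comment> \<open>Injectivity on objects ensures that arrows composable in \<open>D\<close> come
    from arrows composable in \<open>C\<close>.\<close>
  have pe: "p (Dom C g) = p (Cod C f) \<longleftrightarrow> Dom C g = Cod C f" if "g \<in> Ar C" "f \<in> Ar C" for g f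
    using that C by (intro inj_on_eq_iff [OF i]) auto
  have "category (mk_cat (p ` Ob C) (q ` Ar C) (Dom D) (Cod D) (Idt D) (Cmp D))"
    using C by (intro category_mk_catI) (auto simp: dom cod idt cmp pe composable_def cat_assoc)
  then show ?thesis using D e by (simp add: norm_cat_def)
qed

text \<open>2-functors are not truncated, so a composite of mutually inverse ones agrees with
  \<open>two_id\<close> only on cells of \<open>K\<close>. That suffices: identity 1-cells form the
  invertible transformation, and naturality is the unit law.\<close>

lemma two_nat_iso_id:
  assumes K: "two_category K"
    and F: "\<And>x. x \<in> TObj K \<Longrightarrow> TFOb F x = x"
      "\<And>x y f. x \<in> TObj K \<Longrightarrow> y \<in> TObj K \<Longrightarrow> f \<in> Ob (THom K x y) \<Longrightarrow> FOb (TFHom F x y) f = f"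
      "\<And>x y f. x \<in> TObj K \<Longrightarrow> y \<in> TObj K \<Longrightarrow> f \<in> Ar (THom K x y) \<Longrightarrow> FAr (TFHom F x y) f = f"
    and F': "\<And>x. x \<in> TObj K \<Longrightarrow> TFOb F' x = x"
      "\<And>x y f. x \<in> TObj K \<Longrightarrow> y \<in> TObj K \<Longrightarrow> f \<in> Ob (THom K x y) \<Longrightarrow> FOb (TFHom F' x y) f = f"
      "\<And>x y f. x \<in> TObj K \<Longrightarrow> y \<in> TObj K \<Longrightarrow> f \<in> Ar (THom K x y) \<Longrightarrow> FAr (TFHom F' x y) f = f"
  shows "two_nat_iso K K F F' (TId K)"
proof -
  have i: "TId K x \<in> Ob (THom K x x)" if "x \<in> TObj K" for x
    using K that by (simp add: two_category_def)
  have u: "FOb (TComp K x y y) (TId K y, f) = f" "FOb (TComp K x x y) (f, TId K x) = f"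
    if "x \<in> TObj K" "y \<in> TObj K" "f \<in> Ob (THom K x y)" for x y f
    using K that by (simp_all add: two_category_def)
  have v: "FAr (TComp K x y y) (Idt (THom K y y) (TId K y), \<phi>) = \<phi>"
    "FAr (TComp K x x y) (\<phi>, Idt (THom K x x) (TId K x)) = \<phi>"
    if "x \<in> TObj K" "y \<in> TObj K" "\<phi> \<in> Ar (THom K x y)" for x y \<phi>
    using K that by (simp_all add: two_category_def)
  show ?thesis
    unfolding two_nat_iso_def two_nat_def one_cell_iso_def
    using F F' i u v by auto
qed

text \<open>No law of \<open>L\<close> is assumed. The maps are bijections carrying operations to
  operations, while \<open>norm\<close> and \<open>tnorm\<close> fix the values of the structure
  maps of \<open>L\<close> off their domains; together these force the laws of \<open>K\<close> upon
  \<open>L\<close>.\<close>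

locale two_iso =
  fixes K :: "('o, 'f, 't) twocat" and L :: "('o2, 'f2, 't2) twocat"
    and ob :: "'o \<Rightarrow> 'o2" and p :: "'o \<Rightarrow> 'o \<Rightarrow> 'f \<Rightarrow> 'f2" and q :: "'o \<Rightarrow> 'o \<Rightarrow> 't \<Rightarrow> 't2"
  assumes K: "two_category K"
    and ob: "bij_betw ob (TObj K) (TObj L)"
    and p: "x \<in> TObj K \<Longrightarrow> y \<in> TObj K \<Longrightarrow> bij_betw (p x y) (Ob (THom K x y)) (Ob (THom L (ob x) (ob y)))"
    and q: "x \<in> TObj K \<Longrightarrow> y \<in> TObj K \<Longrightarrow> bij_betw (q x y) (Ar (THom K x y)) (Ar (THom L (ob x) (ob y)))"
    and dom: "x \<in> TObj K \<Longrightarrow> y \<in> TObj K \<Longrightarrow> \<phi> \<in> Ar (THom K x y) \<Longrightarrow>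
      Dom (THom L (ob x) (ob y)) (q x y \<phi>) = p x y (Dom (THom K x y) \<phi>)"
    and cod: "x \<in> TObj K \<Longrightarrow> y \<in> TObj K \<Longrightarrow> \<phi> \<in> Ar (THom K x y) \<Longrightarrow>
      Cod (THom L (ob x) (ob y)) (q x y \<phi>) = p x y (Cod (THom K x y) \<phi>)"
    and idt: "x \<in> TObj K \<Longrightarrow> y \<in> TObj K \<Longrightarrow> f \<in> Ob (THom K x y) \<Longrightarrow>
      Idt (THom L (ob x) (ob y)) (p x y f) = q x y (Idt (THom K x y) f)"
    and cmp: "x \<in> TObj K \<Longrightarrow> y \<in> TObj K \<Longrightarrow> composable (THom K x y) \<psi> \<phi> \<Longrightarrow>
      q x y \<psi> \<cdot>\<^bsub>THom L (ob x) (ob y)\<^esub> q x y \<phi> = q x y (\<psi> \<cdot>\<^bsub>THom K x y\<^esub> \<phi>)"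
    and norm: "norm_cat (THom L (ob x) (ob y))"
    and tid: "x \<in> TObj K \<Longrightarrow> TId L (ob x) = p x x (TId K x)"
    and tob: "x \<in> TObj K \<Longrightarrow> y \<in> TObj K \<Longrightarrow> z \<in> TObj K \<Longrightarrow>
      g \<in> Ob (THom K y z) \<Longrightarrow> f \<in> Ob (THom K x y) \<Longrightarrow>
      FOb (TComp L (ob x) (ob y) (ob z)) (p y z g, p x y f) = p x z (FOb (TComp K x y z) (g, f))"
    and tar: "x \<in> TObj K \<Longrightarrow> y \<in> TObj K \<Longrightarrow> z \<in> TObj K \<Longrightarrow>
      \<psi> \<in> Ar (THom K y z) \<Longrightarrow> \<phi> \<in> Ar (THom K x y) \<Longrightarrow>
      FAr (TComp L (ob x) (ob y) (ob z)) (q y z \<psi>, q x y \<phi>) = q x z (FAr (TComp K x y z) (\<psi>, \<phi>))"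
    and tnorm: "mk_fun (prod_cat (THom L (ob y) (ob z)) (THom L (ob x) (ob y)))
      (FOb (TComp L (ob x) (ob y) (ob z))) (FAr (TComp L (ob x) (ob y) (ob z))) =
          TComp L (ob x) (ob y) (ob z)"
begin

lemma TObj_L: "TObj L = ob ` TObj K"
  using ob by (simp add: bij_betw_def)

lemma THom_L:
  assumes "x \<in> TObj K" "y \<in> TObj K"
  shows "Ob (THom L (ob x) (ob y)) = p x y ` Ob (THom K x y)"
    "Ar (THom L (ob x) (ob y)) = q x y ` Ar (THom K x y)"
  using p [OF assms] q [OF assms] by (simp_all add: bij_betw_def)

lemma Kcat: "x \<in> TObj K \<Longrightarrow> y \<in> TObj K \<Longrightarrow> category (THom K x y)"
  and Kid: "x \<in> TObj K \<Longrightarrow> TId K x \<in> Ob (THom K x x)"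
  and Kcomp: "x \<in> TObj K \<Longrightarrow> y \<in> TObj K \<Longrightarrow> z \<in> TObj K \<Longrightarrow>
        is_functor (prod_cat (THom K y z) (THom K x y)) (THom K x z) (TComp K x y z)"
  using K by (simp_all add: two_category_def)

lemma Kcomp_sel:
  assumes "x \<in> TObj K" "y \<in> TObj K" "z \<in> TObj K"
  shows "g \<in> Ob (THom K y z) \<Longrightarrow> f \<in> Ob (THom K x y) \<Longrightarrow> FOb (TComp K x y z) (g, f) \<in> Ob (THom K x z)"
    "\<psi> \<in> Ar (THom K y z) \<Longrightarrow> \<phi> \<in> Ar (THom K x y) \<Longrightarrow> FAr (TComp K x y z) (\<psi>, \<phi>) \<in> Ar (THom K x z)"
    "\<psi> \<in> Ar (THom K y z) \<Longrightarrow> \<phi> \<in> Ar (THom K x y) \<Longrightarrow> Dom (THom K x z) (FAr (TComp K x y z) (\<psi>, \<phi>)) =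
      FOb (TComp K x y z) (Dom (THom K y z) \<psi>, Dom (THom K x y) \<phi>)"
    "\<psi> \<in> Ar (THom K y z) \<Longrightarrow> \<phi> \<in> Ar (THom K x y) \<Longrightarrow> Cod (THom K x z) (FAr (TComp K x y z) (\<psi>, \<phi>)) =
      FOb (TComp K x y z) (Cod (THom K y z) \<psi>, Cod (THom K x y) \<phi>)"
    "g \<in> Ob (THom K y z) \<Longrightarrow> f \<in> Ob (THom K x y) \<Longrightarrow>
      FAr (TComp K x y z) (Idt (THom K y z) g, Idt (THom K x y) f) =
          Idt (THom K x z) (FOb (TComp K x y z) (g, f))"
    "composable (THom K y z) \<psi>' \<psi> \<Longrightarrow> composable (THom K x y) \<phi>' \<phi> \<Longrightarrow>
      FAr (TComp K x y z) (\<psi>' \<cdot>\<^bsub>THom K y z\<^esub> \<psi>, \<phi>' \<cdot>\<^bsub>THom K x y\<^esub> \<phi>) =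
      FAr (TComp K x y z) (\<psi>', \<phi>') \<cdot>\<^bsub>THom K x z\<^esub> FAr (TComp K x y z) (\<psi>, \<phi>)"
    "composable (THom K y z) \<psi>' \<psi> \<Longrightarrow> composable (THom K x y) \<phi>' \<phi> \<Longrightarrow>
      composable (THom K x z) (FAr (TComp K x y z) (\<psi>', \<phi>')) (FAr (TComp K x y z) (\<psi>, \<phi>))"
  using functorD(1-5) [OF Kcomp [OF assms]] functorD(6,7) [OF Kcomp [OF assms], of "(\<psi>', \<phi>')" "(\<psi>, \<phi>)"]
  by auto

lemma Lcat: "x \<in> TObj K \<Longrightarrow> y \<in> TObj K \<Longrightarrow> category (THom L (ob x) (ob y))"
  by (rule category_transport [OF Kcat norm p q dom cod idt cmp])

lemma Lcomposable:
  assumes "x \<in> TObj K" "y \<in> TObj K" "\<psi> \<in> Ar (THom K x y)" "\<phi> \<in> Ar (THom K x y)"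
  shows "composable (THom L (ob x) (ob y)) (q x y \<psi>) (q x y \<phi>) \<longleftrightarrow> composable (THom K x y) \<psi> \<phi>"
  using assms dom cod THom_L inj_on_eq_iff [OF bij_betw_imp_inj_on [OF p [OF assms(1,2)]]] Kcat
  by (auto simp: composable_def)

lemma LcompI:
  assumes x: "x \<in> TObj K" and y: "y \<in> TObj K" and z: "z \<in> TObj K"
  shows "is_functor (prod_cat (THom L (ob y) (ob z)) (THom L (ob x) (ob y))) (THom L (ob x) (ob z))
    (TComp L (ob x) (ob y) (ob z))"
proof -
  note [simp] = Lcat Kcat THom_L tob tar dom cod idt cmp Kcomp_sel x y z
  \<comment> \<open>The composition of \<open>L\<close> is rewritten as a truncation of itself, so
    functoriality can be checked on images of cells of \<open>K\<close>; \<open>tnorm\<close>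
    removes the truncation at the end.\<close>
  have "is_functor (prod_cat (THom L (ob y) (ob z)) (THom L (ob x) (ob y))) (THom L (ob x) (ob z))
    (mk_fun (prod_cat (THom L (ob y) (ob z)) (THom L (ob x) (ob y)))
      (FOb (TComp L (ob x) (ob y) (ob z))) (FAr (TComp L (ob x) (ob y) (ob z))))"
  proof (rule is_functor_mk_funI)
    fix g f assume c: "composable (prod_cat (THom L (ob y) (ob z)) (THom L (ob x) (ob y))) g f"
    then obtain \<psi>' \<phi>' \<psi> \<phi> where e: "g = (q y z \<psi>', q x y \<phi>')" "f = (q y z \<psi>, q x y \<phi>)"
      and a: "\<psi>' \<in> Ar (THom K y z)" "\<phi>' \<in> Ar (THom K x y)" "\<psi> \<in> Ar (THom K y z)" "\<phi> \<in> Ar (THom K x y)"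
      by (auto simp: composable_def)
    have k: "composable (THom K y z) \<psi>' \<psi>" "composable (THom K x y) \<phi>' \<phi>"
      using c a by (simp_all add: e Lcomposable del: THom_L)
    have l: "composable (THom L (ob y) (ob z)) (q y z \<psi>') (q y z \<psi>)"
        "composable (THom L (ob x) (ob y)) (q x y \<phi>') (q x y \<phi>)"
      using k a by (simp_all add: Lcomposable)
    have m: "\<psi>' \<cdot>\<^bsub>THom K y z\<^esub> \<psi> \<in> Ar (THom K y z)" "\<phi>' \<cdot>\<^bsub>THom K x y\<^esub> \<phi> \<in> Ar (THom K x y)"
      using k by (auto simp: composable_def)
    show "FAr (TComp L (ob x) (ob y) (ob z)) (g \<cdot>\<^bsub>prod_cat (THom L (ob y) (ob z))
        (THom L (ob x) (ob y))\<^esub> f) =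
        FAr (TComp L (ob x) (ob y) (ob z)) g \<cdot>\<^bsub>THom L (ob x) (ob z)\<^esub> FAr (TComp L (ob x) (ob y) (ob z)) f"
      using a k l m by (simp add: e)
  qed auto
  then show ?thesis by (simp only: tnorm)
qed

text \<open>Every cell of \<open>L\<close> is the image of a cell of \<open>K\<close>, so each law
  of \<open>L\<close> is the image of the same law of \<open>K\<close>.\<close>

lemma two_category_L: "two_category L"
  unfolding two_category_def TObj_L
proof (simp add: Lcat LcompI THom_L tid Kid, intro conjI ballI, goal_cases)
qed (use K in \<open>auto simp: two_category_def tob tar idt tid Kcomp_sel Kid Kcat THom_L\<close>)

definition FK :: "('o, 'f, 't, 'o2, 'f2, 't2) twofun" where
  "FK = \<lparr>TFOb = ob, TFHom = (\<lambda>x y. mk_fun (THom K x y) (p x y) (q x y))\<rparr>"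

definition GL :: "('o2, 'f2, 't2, 'o, 'f, 't) twofun" where
  "GL = (let o' = inv_into (TObj K) ob in
    \<lparr>TFOb = o', TFHom = (\<lambda>X Y. inv_fun (THom K (o' X) (o' Y)) (THom L X Y) (TFHom FK (o' X) (o' Y)))\<rparr>)"

lemma FK_sel [simp]: "TFOb FK x = ob x" "f \<in> Ob (THom K x y) \<Longrightarrow> FOb (TFHom FK x y) f = p x y f"
  "\<phi> \<in> Ar (THom K x y) \<Longrightarrow> FAr (TFHom FK x y) \<phi> = q x y \<phi>"
  by (simp_all add: FK_def)

lemma FK_functor: "x \<in> TObj K \<Longrightarrow> y \<in> TObj K \<Longrightarrow> is_functor (THom K x y) (THom L (ob x) (ob y)) (TFHom FK x y)"
  unfolding FK_def by (auto intro!: is_functor_mk_funI simp: Kcat THom_L dom cod idt cmp)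

lemma GL_ob [simp]: "x \<in> TObj K \<Longrightarrow> TFOb GL (ob x) = x"
  using ob by (simp add: GL_def Let_def bij_betw_def)

lemma GL_functor:
  assumes "x \<in> TObj K" "y \<in> TObj K"
  shows "is_functor (THom L (ob x) (ob y)) (THom K x y) (TFHom GL (ob x) (ob y))"
proof -
  have b: "bij_betw (FOb (TFHom FK x y)) (Ob (THom K x y)) (Ob (THom L (ob x) (ob y)))"
    "bij_betw (FAr (TFHom FK x y)) (Ar (THom K x y)) (Ar (THom L (ob x) (ob y)))"
    using p [OF assms] q [OF assms] by (auto intro: bij_betw_cong [THEN iffD1, rotated])
  show ?thesis
    using is_functor_inv_fun [OF Kcat [OF assms] Lcat [OF assms] FK_functor [OF assms] b] assms ob
    by (simp add: GL_def Let_def bij_betw_def)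
qed

lemma GL_sel [simp]:
  assumes "x \<in> TObj K" "y \<in> TObj K"
  shows "f \<in> Ob (THom K x y) \<Longrightarrow> FOb (TFHom GL (ob x) (ob y)) (p x y f) = f"
    "\<phi> \<in> Ar (THom K x y) \<Longrightarrow> FAr (TFHom GL (ob x) (ob y)) (q x y \<phi>) = \<phi>"
proof -
  have i: "inj_on (FOb (TFHom FK x y)) (Ob (THom K x y))" "inj_on (FAr (TFHom FK x y)) (Ar (THom K x y))"
    using p [OF assms] q [OF assms] by (auto simp: bij_betw_def inj_on_def)
  have ob': "inv_into (TObj K) ob (ob x) = x" "inv_into (TObj K) ob (ob y) = y"
    using ob assms by (auto simp: bij_betw_def)
  show "FOb (TFHom GL (ob x) (ob y)) (p x y f) = f" if "f \<in> Ob (THom K x y)"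
    using that assms inv_into_f_f [OF i(1) that] by (simp add: GL_def Let_def ob' inv_fun_def THom_L)
  show "FAr (TFHom GL (ob x) (ob y)) (q x y \<phi>) = \<phi>" if "\<phi> \<in> Ar (THom K x y)"
    using that assms inv_into_f_f [OF i(2) that] by (simp add: GL_def Let_def ob' inv_fun_def THom_L)
qed

lemma two_equivalent: "two_equivalent K L"
proof -
  have "two_functor K L FK"
    by (auto simp: two_functor_def TObj_L FK_functor tid Kid tob tar Kcomp_sel)
  moreover have "two_functor L K GL"
    by (auto simp: two_functor_def TObj_L GL_functor tid Kid tob tar Kcomp_sel THom_L)
  moreover have "two_nat_iso K K (two_id K) (two_comp K GL FK) (TId K)"
    by (rule two_nat_iso_id [OF K]) (auto simp: two_id_def two_comp_def)
  moreover have "two_nat_iso L L (two_comp L FK GL) (two_id L) (TId L)"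
    by (rule two_nat_iso_id [OF two_category_L]) (auto simp: two_id_def two_comp_def TObj_L THom_L)
  ultimately show ?thesis
    using K two_category_L unfolding two_equivalent_def by blast
qed

end

section \<open>Enriched categories from 2-categories with contravariance\<close>

context V_data
begin

text \<open>Evaluating an equation of V for fixed objects puts the quantifiers over kinds and
  variances inside those over objects, whereas the axioms on the other side have them
  outside.\<close>

lemma ball_all_swap: "(\<forall>x\<in>S. \<forall>k. P x k) \<longleftrightarrow> (\<forall>k. \<forall>x\<in>S. P x k)"
  by blast

lemma T_ball: "(\<forall>t\<in>cel k (prj w (T A B)). P t) \<longleftrightarrow>
    (\<forall>v. \<forall>a\<in>cel k (prj v A). \<forall>b\<in>cel k (prj (vmul v w) B). P (enc v a b))"
  by (auto elim!: T_cases)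

text \<open>The equivalence, rather than one implication, lets an enriched axiom be exchanged for
  its elementwise form in both directions.\<close>

lemma vAr_eq_iff:
  assumes "vAr F" "vAr G" "vsrc F = vsrc G" "vtrg F = vtrg G"
  shows "F = G \<longleftrightarrow> (\<forall>k v. \<forall>t\<in>cel k (prj v (vsrc G)). act k v F t = act k v G t)"
  using vAr_eqI [OF assms] by auto

section \<open>Objects: V-categories and 2-categories with contravariance\<close>

definition chom :: "('o, 'u) ccat \<Rightarrow> 'o \<Rightarrow> 'o \<Rightarrow> 'u scat \<times> 'u scat" where
  "chom A x y = (CHom A Covar x y, CHom A Contravar x y)"

lemma prj_chom [simp]: "prj v (chom A x y) = CHom A v x y"
  by (cases v) (simp_all add: chom_def prj.simps)

lemma cel_CHom: "cel k (CHom A v x y) = hm A k v x y"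
  by (simp add: hm_def)

text \<open>The global element of \<open>X\<close> named by \<open>a\<close>: the only arrow of the
  terminal category goes to the identity of \<open>a\<close>. The formula ignores the variance
  because the contravariant component of the unit is empty.\<close>

definition gel :: "'u scat \<times> 'u scat \<Rightarrow> 'u \<Rightarrow> 'u sfun \<times> 'u sfun" where
  "gel X a = varr (V_unit u) X (\<lambda>k v t. case k of ObK \<Rightarrow> a | ArK \<Rightarrow> Idt (prj Covar X) a)"

text \<open>On summand \<open>v\<close> of the component of variance \<open>w\<close>, the second
  factor has variance vw, so the composition for the variances v and vw lands in variance
  \<open>w\<close>.\<close>

definition ccmp :: "('o, 'u) ccat \<Rightarrow> 'o \<Rightarrow> 'o \<Rightarrow> 'o \<Rightarrow> 'u sfun \<times> 'u sfun" where
  "ccmp A x y z = varr (T (chom A y z) (chom A x y)) (chom A x z)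
     (\<lambda>k w t. case dec t of (v, a, b) \<Rightarrow> cmp A k v (vmul v w) x y z a b)"

definition EC :: "('o, 'u) ccat \<Rightarrow> ('o, 'u scat \<times> 'u scat, 'u sfun \<times> 'u sfun) ecat" where
  "EC A = \<lparr>EObj = CObj A,
     EHom = (\<lambda>x y. if x \<in> CObj A \<and> y \<in> CObj A then chom A x y else undefined),
     EId = (\<lambda>x. if x \<in> CObj A then gel (chom A x x) (CId A x) else undefined),
     EComp = (\<lambda>x y z. if x \<in> CObj A \<and> y \<in> CObj A \<and> z \<in> CObj A then ccmp A x y z else undefined)\<rparr>"

text \<open>The composition for the variances \<open>v\<close> and \<open>w\<close> is read off from
  the component of variance vw, restricted to summand \<open>v\<close>, whose second factor has
  variance v(vw) = w.\<close>

definition CE :: "('o, 'u scat \<times> 'u scat, 'u sfun \<times> 'u sfun) ecat \<Rightarrow> ('o, 'u) ccat" where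
  "CE E = \<lparr>CObj = EObj E,
     CHom = (\<lambda>v x y. if x \<in> EObj E \<and> y \<in> EObj E then prj v (EHom E x y) else undefined),
     CId = (\<lambda>x. if x \<in> EObj E then act ObK Covar (EId E x) u else undefined),
     CComp = (\<lambda>v w x y z. if x \<in> EObj E \<and> y \<in> EObj E \<and> z \<in> EObj E then
        mk_fun (prod_cat (prj v (EHom E y z)) (vop v (prj w (EHom E x y))))
          (\<lambda>(a, b). act ObK (vmul v w) (EComp E x y z) (enc v a b))
          (\<lambda>(a, b). act ArK (vmul v w) (EComp E x y z) (enc v a b)) else undefined)\<rparr>"

lemma EC_sel [simp]: "EObj (EC A) = CObj A"
  "x \<in> CObj A \<Longrightarrow> y \<in> CObj A \<Longrightarrow> EHom (EC A) x y = chom A x y"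
  "x \<in> CObj A \<Longrightarrow> EId (EC A) x = gel (chom A x x) (CId A x)"
  "x \<in> CObj A \<Longrightarrow> y \<in> CObj A \<Longrightarrow> z \<in> CObj A \<Longrightarrow> EComp (EC A) x y z = ccmp A x y z"
  by (simp_all add: EC_def)

definition pre_enr :: "('o, 'u scat \<times> 'u scat, 'u sfun \<times> 'u sfun) ecat \<Rightarrow> bool" where
  "pre_enr E \<longleftrightarrow>
     (\<forall>x\<in>EObj E. \<forall>y\<in>EObj E. vcat (EHom E x y)) \<and>
     (\<forall>x\<in>EObj E. vAr (EId E x) \<and> vsrc (EId E x) = V_unit u \<and> vtrg (EId E x) = EHom E x x) \<and>
     (\<forall>x\<in>EObj E. \<forall>y\<in>EObj E. \<forall>z\<in>EObj E. vAr (EComp E x y z) \<and>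
        vsrc (EComp E x y z) = T (EHom E y z) (EHom E x y) \<and> vtrg (EComp E x y z) = EHom E x z) \<and>
     (\<forall>x y. \<not> (x \<in> EObj E \<and> y \<in> EObj E) \<longrightarrow> EHom E x y = undefined) \<and>
     (\<forall>x. x \<notin> EObj E \<longrightarrow> EId E x = undefined) \<and>
     (\<forall>x y z. \<not> (x \<in> EObj E \<and> y \<in> EObj E \<and> z \<in> EObj E) \<longrightarrow> EComp E x y z = undefined)"

lemma enriched_category_iff:
  "enriched_category M E \<longleftrightarrow> pre_enr E \<and>
     (\<forall>x\<in>EObj E. \<forall>y\<in>EObj E.
        EComp E x y y \<diamondop>\<^bsub>M\<^esub> (EId E y \<odot>\<^bsub>M\<^esub> mid M (EHom E x y)) = lun M (EHom E x y) \<and>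
        EComp E x x y \<diamondop>\<^bsub>M\<^esub> (mid M (EHom E x y) \<odot>\<^bsub>M\<^esub> EId E x) = run M (EHom E x y)) \<and>
     (\<forall>x\<in>EObj E. \<forall>y\<in>EObj E. \<forall>z\<in>EObj E. \<forall>w\<in>EObj E.
        EComp E x y w \<diamondop>\<^bsub>M\<^esub> (EComp E y z w \<odot>\<^bsub>M\<^esub> mid M (EHom E x y)) =
        EComp E x z w \<diamondop>\<^bsub>M\<^esub> (mid M (EHom E z w) \<odot>\<^bsub>M\<^esub> EComp E x y z)
          \<diamondop>\<^bsub>M\<^esub> asc M (EHom E z w) (EHom E y z) (EHom E x y))"
proof -
  have t: "(\<forall>x\<in>EObj E. \<forall>y\<in>EObj E. vcat (EHom E x y)) \<Longrightarrow>
    (\<forall>x\<in>EObj E. \<forall>y\<in>EObj E. \<forall>z\<in>EObj E.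
        arr_between (base M) (EComp E x y z) (EHom E y z \<otimes>\<^bsub>M\<^esub> EHom E x y) (EHom E x z)) \<longleftrightarrow>
    (\<forall>x\<in>EObj E. \<forall>y\<in>EObj E. \<forall>z\<in>EObj E. vAr (EComp E x y z) \<and>
        vsrc (EComp E x y z) = T (EHom E y z) (EHom E x y) \<and> vtrg (EComp E x y z) = EHom E x z)"
    by (simp add: arr_between_M)
  show ?thesis
  \<comment> \<open>\<open>tens M\<close> is truncated, so \<otimes> unfolds to \<open>T\<close>
    only for objects of V. If some hom is not such an object, both sides of the equivalence are
    false.\<close>
  proof (cases "\<forall>x\<in>EObj E. \<forall>y\<in>EObj E. vcat (EHom E x y)")
    case True
    show ?thesis
      unfolding enriched_category_def pre_enr_def M_Ob unt_M t [OF True]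
      unfolding arr_between_M by (rule iffI; elim conjE; intro conjI; assumption)
  next
    case False
    then show ?thesis
      by (auto simp: enriched_category_def pre_enr_def)
  qed
qed

lemma gel_st [simp]: "vsrc (gel X a) = V_unit u" "vtrg (gel X a) = X"
  by (simp_all add: gel_def)

lemma gel_vAr [simp]: "vcat X \<Longrightarrow> a \<in> Ob (prj Covar X) \<Longrightarrow> vAr (gel X a)"
  unfolding gel_def
  by (intro varr_vArI is_functor_mk_funI) (auto simp: composable_def split: if_splits)

lemma gel_act: "act k Covar (gel X a) u = (case k of ObK \<Rightarrow> a | ArK \<Rightarrow> Idt (prj Covar X) a)"
  by (simp add: gel_def)

lemma gel_act_el [simp]: "act k Covar (gel (chom A x y) a) u = el A k x y a"
  by (cases k) (simp_all add: gel_act el_def)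

text \<open>The unit has a single object and its identity as the only arrow, and functors preserve
  identities; hence the image of the object determines the whole arrow.\<close>

lemma gel_surj:
  assumes F: "vAr F" "vsrc F = V_unit u" "vtrg F = X"
  shows "act ObK Covar F u \<in> Ob (prj Covar X)" "gel X (act ObK Covar F u) = F"
proof -
  show i: "act ObK Covar F u \<in> Ob (prj Covar X)"
    using act_Ob [OF F(1), of u Covar] F by simp
  have "act ArK Covar F u = Idt (prj Covar X) (act ObK Covar F u)"
    using act_Idt [OF F(1), of u Covar] F by simp
  then have "act k Covar (gel X (act ObK Covar F u)) u = act k Covar F u" for k
    by (cases k) (simp_all add: gel_act)
  moreover have "vcat X" using F by auto
  ultimately show "gel X (act ObK Covar F u) = F"
    using F i by (intro vAr_eqI) (auto split: if_splits)
qed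

context
  fixes A :: "('o, 'u) ccat"
  assumes A: "pre_contra A"
begin

lemma chom_vcat: "x \<in> CObj A \<Longrightarrow> y \<in> CObj A \<Longrightarrow> vcat (chom A x y)"
  using pre_category [OF A] by (simp add: vcat_def)

text \<open>Checked summand by summand, each functor law is the one of the composition for the
  variances \<open>v\<close> and \<open>vmul v w\<close>.\<close>

lemma ccmp_vAr:
  assumes [simp]: "x \<in> CObj A" "y \<in> CObj A" "z \<in> CObj A"
  shows "vAr (ccmp A x y z)"
  unfolding ccmp_def
proof (rule varr_vArI)
  fix w
  note C = pre_CComp [OF A assms]
  show "is_functor (prj w (T (chom A y z) (chom A x y))) (prj w (chom A x z))
      (mk_fun (prj w (T (chom A y z) (chom A x y)))
        (\<lambda>t. case dec t of (v, a, b) \<Rightarrow> cmp A ObK v (vmul v w) x y z a b)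
        (\<lambda>t. case dec t of (v, a, b) \<Rightarrow> cmp A ArK v (vmul v w) x y z a b))"
  proof (rule T_functorI, goal_cases)
    case (8 v f g f' g')
    then show ?case
      using functorD(6) [OF C [of v "vmul v w"], of "(f, g)" "(f', g')"] by (simp add: cmp_def)
  next
    case (7 v a b)
    then show ?case
      using functorD(5) [OF C [of v "vmul v w"], of "(a, b)"] by (simp add: cmp_def)
  next
    case (6 v f g)
    then show ?case
      using functorD(4) [OF C [of v "vmul v w"], of "(f, g)"] by (simp add: cmp_def)
  next
    case (5 v f g)
    then show ?case
      using functorD(3) [OF C [of v "vmul v w"], of "(f, g)"] by (simp add: cmp_def)
  next
    case (4 v f g)
    then show ?case
      using functorD(2) [OF C [of v "vmul v w"], of "(f, g)"] by (simp add: cmp_def)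
  next
    case (3 v a b)
    then show ?case
      using functorD(1) [OF C [of v "vmul v w"], of "(a, b)"] by (simp add: cmp_def)
  qed (simp_all add: chom_vcat)
qed (simp_all add: chom_vcat)

end

lemma ccmp_st [simp]: "vsrc (ccmp A x y z) = T (chom A y z) (chom A x y)" "vtrg (ccmp A x y z) = chom A x z"
  by (simp_all add: ccmp_def)

lemma ccmp_act [simp]:
  "g \<in> hm A k v y z \<Longrightarrow> f \<in> hm A k (vmul v w) x y \<Longrightarrow>
   act k w (ccmp A x y z) (enc v g f) = cmp A k v (vmul v w) x y z g f"
  by (simp add: ccmp_def hm_def)

lemma EC_pre:
  assumes A: "pre_contra A"
  shows "pre_enr (EC A)"
  using pre_CId [OF A] unfolding pre_enr_def
  by (auto simp: chom_vcat [OF A] ccmp_vAr [OF A] hm_def) (auto simp: EC_def)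

text \<open>Including summand \<open>v\<close> into the component of variance vw, by
  \<open>enc v\<close>, respects sources, targets, identities and composition. The extracted map is
  this inclusion followed by a functor.\<close>

lemma CE_pre:
  assumes E: "pre_enr E"
  shows "pre_contra (CE E)"
proof -
  have C: "is_functor (prod_cat (prj v (EHom E y z)) (vop v (prj w (EHom E x y))))
      (prj (vmul v w) (EHom E x z))
     (mk_fun (prod_cat (prj v (EHom E y z)) (vop v (prj w (EHom E x y))))
          (\<lambda>(a, b). act ObK (vmul v w) (EComp E x y z) (enc v a b))
          (\<lambda>(a, b). act ArK (vmul v w) (EComp E x y z) (enc v a b)))"
    if x: "x \<in> EObj E" "y \<in> EObj E" "z \<in> EObj E" for v w x y z
  proof (rule is_functor_mk_funI)
    have F: "vAr (EComp E x y z)" and s: "vsrc (EComp E x y z) = T (EHom E y z) (EHom E x y)"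
      and t: "vtrg (EComp E x y z) = EHom E x z" and vc [simp]: "vcat (EHom E y z)" "vcat (EHom E x y)"
      using E x by (auto simp: pre_enr_def)
    note D = act_Ob [OF F] act_Ar [OF F] act_functor0 [OF F] act_Idt [OF F]
    note D' = D [unfolded s t]
    show "category (prod_cat (prj v (EHom E y z)) (vop v (prj w (EHom E x y))))" by simp
    show "(case ab of (a, b) \<Rightarrow> act ObK (vmul v w) (EComp E x y z) (enc v a b)) \<in> Ob
        (prj (vmul v w) (EHom E x z))"
      if "ab \<in> Ob (prod_cat (prj v (EHom E y z)) (vop v (prj w (EHom E x y))))" for ab
      using that by (auto intro!: D')
    show "(case ab of (a, b) \<Rightarrow> act ArK (vmul v w) (EComp E x y z) (enc v a b)) \<in> Ar
        (prj (vmul v w) (EHom E x z))"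
      if "ab \<in> Ar (prod_cat (prj v (EHom E y z)) (vop v (prj w (EHom E x y))))" for ab
      using that by (auto intro!: D')
    fix g f assume gf: "composable (prod_cat (prj v (EHom E y z)) (vop v (prj w (EHom E x y)))) g f"
    obtain a b a' b' where e: "g = (a, b)" "f = (a', b')" by (metis surj_pair)
    have c: "composable (prj v (EHom E y z)) a a'" "composable (vop v (prj w (EHom E x y))) b b'"
      using gf by (simp_all add: e)
    have k: "composable (prj (vmul v w) (T (EHom E y z) (EHom E x y))) (enc v a b) (enc v a' b')"
      using c T_vop_composable [OF vc, of Covar "vmul v w" v a b v a' b'] by simp
    show "(case g \<cdot>\<^bsub>prod_cat (prj v (EHom E y z)) (vop v (prj w (EHom E x y)))\<^esub> f of
        (a, b) \<Rightarrow> act ArK (vmul v w) (EComp E x y z) (enc v a b)) =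
      (case g of (a, b) \<Rightarrow> act ArK (vmul v w) (EComp E x y z) (enc v a b)) \<cdot>\<^bsub>prj (vmul v w) (EHom E x z)\<^esub>
      (case f of (a, b) \<Rightarrow> act ArK (vmul v w) (EComp E x y z) (enc v a b))"
      using c D'(5) [OF k] T_Cmp [of v "EHom E y z" a a' "vmul v w" "EHom E x y" b b'] by (simp add: e)
  next
    have F: "vAr (EComp E x y z)" and s: "vsrc (EComp E x y z) = T (EHom E y z) (EHom E x y)"
      and t: "vtrg (EComp E x y z) = EHom E x z" and vc [simp]: "vcat (EHom E y z)" "vcat (EHom E x y)"
      using E x by (auto simp: pre_enr_def)
    note D' = act_functor0 [OF F, unfolded s t] act_Idt [OF F, unfolded s t]
    show "Dom (prj (vmul v w) (EHom E x z)) (case f of (a, b) \<Rightarrow> act ArK (vmul v w) (EComp E x y z)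
        (enc v a b)) =
       (case Dom (prod_cat (prj v (EHom E y z)) (vop v (prj w (EHom E x y)))) f of
        (a, b) \<Rightarrow> act ObK (vmul v w) (EComp E x y z) (enc v a b))"
      "Cod (prj (vmul v w) (EHom E x z)) (case f of (a, b) \<Rightarrow> act ArK (vmul v w) (EComp E x y z)
          (enc v a b)) =
       (case Cod (prod_cat (prj v (EHom E y z)) (vop v (prj w (EHom E x y)))) f of
        (a, b) \<Rightarrow> act ObK (vmul v w) (EComp E x y z) (enc v a b))"
      if "f \<in> Ar (prod_cat (prj v (EHom E y z)) (vop v (prj w (EHom E x y))))" for f
      using that by (auto simp: D' T_Dom T_Cod)
    show "(case Idt (prod_cat (prj v (EHom E y z)) (vop v (prj w (EHom E x y)))) a of
        (a, b) \<Rightarrow> act ArK (vmul v w) (EComp E x y z) (enc v a b)) =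
       Idt (prj (vmul v w) (EHom E x z)) (case a of (a, b) \<Rightarrow> act ObK (vmul v w) (EComp E x y z)
           (enc v a b))"
      if "a \<in> Ob (prod_cat (prj v (EHom E y z)) (vop v (prj w (EHom E x y))))" for a
      using that by (auto simp flip: D'(5))
  qed
  have i: "act ObK Covar (EId E x) u \<in> Ob (prj Covar (EHom E x x))" if "x \<in> EObj E" for x
    using gel_surj(1) [of "EId E x" "EHom E x x"] E that by (simp add: pre_enr_def)
  have h: "category (prj v (EHom E x y))" if "x \<in> EObj E" "y \<in> EObj E" for v x y
    using E that by (auto simp: pre_enr_def)
  show ?thesis
    unfolding pre_contra_def by (simp add: CE_def C i h)
qed

lemma CE_EC:
  assumes A: "pre_contra A"
  shows "CE (EC A) = A"
proof (rule ccat.equality)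
  show "CHom (CE (EC A)) = CHom A"
    using A by (auto simp: CE_def fun_eq_iff pre_contra_def)
  have "act ObK Covar (EId (EC A) x) u = CId A x" if "x \<in> CObj A" for x
    using that by simp
  then show "CId (CE (EC A)) = CId A"
    using A by (auto simp: CE_def fun_eq_iff pre_contra_def)
  have "mk_fun (prod_cat (CHom A v y z) (vop v (CHom A w x y)))
          (\<lambda>(a, b). act ObK (vmul v w) (ccmp A x y z) (enc v a b))
          (\<lambda>(a, b). act ArK (vmul v w) (ccmp A x y z) (enc v a b)) = CComp A v w x y z"
    if "x \<in> CObj A" "y \<in> CObj A" "z \<in> CObj A" for v w x y z
    by (rule mk_fun_eqI; (intro functor_extensional [OF pre_CComp [OF A that]])?)
      (auto simp: hm_def cmp_def)
  then show "CComp (CE (EC A)) = CComp A"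
    using A by (auto simp: CE_def fun_eq_iff pre_contra_def)
qed (simp_all add: CE_def)

text \<open>An arrow out of a tensor product is determined by its restrictions to the summands, and
  a global element by its object. Off the set of objects both sides are
  \<open>undefined\<close>.\<close>

lemma EC_CE:
  assumes E: "pre_enr E"
  shows "EC (CE E) = E"
proof (rule ecat.equality)
  have h: "chom (CE E) x y = EHom E x y" if "x \<in> EObj E" "y \<in> EObj E" for x y
    using that by (intro prj_eqI) (simp add: CE_def)
  show "EHom (EC (CE E)) = EHom E"
    using E h by (auto simp: EC_def fun_eq_iff pre_enr_def) (auto simp: CE_def)
  have "gel (chom (CE E) x x) (CId (CE E) x) = EId E x" if "x \<in> EObj E" for x
    using gel_surj(2) [of "EId E x" "EHom E x x"] E that h by (simp add: pre_enr_def) (simp add: CE_def)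
  then show "EId (EC (CE E)) = EId E"
    using E by (auto simp: EC_def fun_eq_iff pre_enr_def) (auto simp: CE_def)
  have "ccmp (CE E) x y z = EComp E x y z" if x: "x \<in> EObj E" "y \<in> EObj E" "z \<in> EObj E" for x y z
  proof (rule vAr_eqI)
    have F: "vAr (EComp E x y z)" and s: "vsrc (EComp E x y z) = T (EHom E y z) (EHom E x y)"
      and t: "vtrg (EComp E x y z) = EHom E x z"
      using E x by (auto simp: pre_enr_def)
    show "vAr (EComp E x y z)" by (rule F)
    show "vAr (ccmp (CE E) x y z)" using x by (intro ccmp_vAr CE_pre E) (simp_all add: CE_def)
    show "vsrc (ccmp (CE E) x y z) = vsrc (EComp E x y z)" "vtrg (ccmp (CE E) x y z) = vtrg (EComp E x y z)"
      using x by (simp_all add: s t h)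
    fix k w t assume "t \<in> cel k (prj w (vsrc (EComp E x y z)))"
    then obtain v g f where "t = enc v g f" and g: "g \<in> cel k (prj v (EHom E y z))"
        "f \<in> cel k (prj (vmul v w) (EHom E x y))"
      unfolding s by (auto elim!: T_cases)
    moreover have "g \<in> hm (CE E) k v y z" "f \<in> hm (CE E) k (vmul v w) x y"
      using g x by (auto simp: hm_def CE_def)
    ultimately show "act k w (ccmp (CE E) x y z) t = act k w (EComp E x y z) t"
      using x by (cases k) (simp_all add: cmp_def CE_def)
  qed
  then show "EComp (EC (CE E)) = EComp E"
    using E by (auto simp: EC_def fun_eq_iff pre_enr_def) (auto simp: CE_def)
qed (simp_all add: EC_def CE_def)

lemma EC_unit_iff:
  assumes A: "pre_contra A" and [simp]: "x \<in> CObj A" "y \<in> CObj A"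
  shows "ccmp A x y y \<diamondop>\<^bsub>M\<^esub> (gel (chom A y y) (CId A y) \<odot>\<^bsub>M\<^esub> mid M (chom A x y)) = lun M (chom A x y) \<longleftrightarrow>
      (\<forall>k v. \<forall>f\<in>hm A k v x y. cmp A k Covar v x y y (el A k y y (CId A y)) f = f)"
    "ccmp A x x y \<diamondop>\<^bsub>M\<^esub> (mid M (chom A x y) \<odot>\<^bsub>M\<^esub> gel (chom A x x) (CId A x)) = run M (chom A x y) \<longleftrightarrow>
      (\<forall>k v. \<forall>f\<in>hm A k v x y. cmp A k v Covar x x y f (el A k x x (CId A x)) = f)"
proof -
  have [simp]: "CId A z \<in> Ob (CHom A Covar z z)" "el A k z z (CId A z) \<in> hm A k Covar z z"
      if "z \<in> CObj A" for z k
    using pre_CId [OF A that] el_in [OF A that that] by (auto simp: hm_def)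
  note [simp] = chom_vcat [OF A] ccmp_vAr [OF A] cel_CHom
  \<comment> \<open>Only the covariant component of the unit is inhabited, so the quantifier over
    the summands of 1 \<otimes> A collapses to one instance.\<close>
  have sp: "(\<forall>v. \<forall>a\<in>if v = Covar then {u} else {}. P v a) \<longleftrightarrow> P Covar u" for P
    by auto
  \<comment> \<open>For A \<otimes> 1 at variance \<open>w\<close>, the unit is taken at variance
    vw, which is covariant only if \<open>v = w\<close>.\<close>
  have sp': "(\<forall>v. \<forall>f\<in>S v. \<forall>a\<in>if v = w then {u} else {}. P v f a) \<longleftrightarrow> (\<forall>f\<in>S w. P w f u)" for P S w
    by auto
  show "ccmp A x y y \<diamondop>\<^bsub>M\<^esub> (gel (chom A y y) (CId A y) \<odot>\<^bsub>M\<^esub> mid M (chom A x y)) = lun M (chom A x y) \<longleftrightarrow>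
      (\<forall>k v. \<forall>f\<in>hm A k v x y. cmp A k Covar v x y y (el A k y y (CId A y)) f = f)"
    by (subst vAr_eq_iff) (simp_all add: T_ball sp)
  show "ccmp A x x y \<diamondop>\<^bsub>M\<^esub> (mid M (chom A x y) \<odot>\<^bsub>M\<^esub> gel (chom A x x) (CId A x)) = run M (chom A x y) \<longleftrightarrow>
      (\<forall>k v. \<forall>f\<in>hm A k v x y. cmp A k v Covar x x y f (el A k x x (CId A x)) = f)"
    by (subst vAr_eq_iff) (simp_all add: T_ball sp')
qed

lemma EC_assoc_iff:
  assumes A: "pre_contra A" and [simp]: "x \<in> CObj A" "y \<in> CObj A" "z \<in> CObj A" "t \<in> CObj A"
  shows "ccmp A x y t \<diamondop>\<^bsub>M\<^esub> (ccmp A y z t \<odot>\<^bsub>M\<^esub> mid M (chom A x y)) =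
        ccmp A x z t \<diamondop>\<^bsub>M\<^esub> (mid M (chom A z t) \<odot>\<^bsub>M\<^esub> ccmp A x y z)
          \<diamondop>\<^bsub>M\<^esub> asc M (chom A z t) (chom A y z) (chom A x y) \<longleftrightarrow>
     (\<forall>k u v w. \<forall>h\<in>hm A k u z t. \<forall>g\<in>hm A k v y z. \<forall>f\<in>hm A k w x y.
           cmp A k u (vmul v w) x z t h (cmp A k v w x y z g f) =
           cmp A k (vmul u v) w x y t (cmp A k u v y z t h g) f)" (is "?L \<longleftrightarrow> (\<forall>k. ?R k)")
proof -
  note [simp] = chom_vcat [OF A] ccmp_vAr [OF A] cel_CHom
  have c [simp]: "cmp A k v w x y z g f \<in> hm A k vw x z"
    if "x \<in> CObj A" "y \<in> CObj A" "z \<in> CObj A" "g \<in> hm A k v y z" "f \<in> hm A k w x y" "vw =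
        vmul v w" for k v w x y z g f vw
    using that cmp_in [OF A] by simp
  have v: "vmul v' (vmul v (vmul v' w)) = vmul v w" for v v' w
    by (simp add: vmul_left_comm)
  \<comment> \<open>At variance \<open>w\<close>, the summand \<open>(v, v')\<close> of the threefold tensor product carries the law for the
    variances \<open>v'\<close>, \<open>v'v\<close> and \<open>vw\<close>; every triple arises in this way because \<open>vv\<close> is covariant.\<close>
  let ?S = "\<lambda>k w v v'. \<forall>h\<in>hm A k v' z t. \<forall>g\<in>hm A k (vmul v' v) y z. \<forall>f\<in>hm A k (vmul v w) x y.
      cmp A k v (vmul v w) x y t (cmp A k v' (vmul v' v) y z t h g) f =
      cmp A k v' (vmul v' w) x z t h (cmp A k (vmul v' v) (vmul v w) x y z g f)"
  have "?L \<longleftrightarrow> (\<forall>k w v v'. ?S k w v v')"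
    by (subst vAr_eq_iff) (simp_all add: T_ball v)
  also have "\<dots> \<longleftrightarrow> (\<forall>k. ?R k)"
  proof (intro iffI allI)
    fix k x1 v w assume *: "\<forall>k w v v'. ?S k w v v'"
    show "\<forall>h\<in>hm A k x1 z t. \<forall>g\<in>hm A k v y z. \<forall>f\<in>hm A k w x y.
           cmp A k x1 (vmul v w) x z t h (cmp A k v w x y z g f) =
           cmp A k (vmul x1 v) w x y t (cmp A k x1 v y z t h g) f"
      \<comment> \<open>The law for (\<open>x1\<close>, \<open>v\<close>, \<open>w\<close>) sits in
        the summand with inner variance \<open>x1\<close> and outer variance
        \<open>vmul x1 v\<close>, at the total variance which is the product of all three.\<close>
      using *[rule_format, of _ k x1 _ "vmul x1 v" _ "vmul x1 (vmul v w)"] by (simp add: v)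
  next
    fix k w v v' assume *: "\<forall>k. ?R k"
    show "?S k w v v'"
      using *[rule_format, of _ k v' _ "vmul v' v" _ "vmul v w"] by (simp add: v)
  qed
  finally show ?thesis .
qed

lemma EC_iff: "pre_contra A \<Longrightarrow> enriched_category M (EC A) \<longleftrightarrow> contra_category A"
  unfolding enriched_category_iff contra_category_iff
  by (simp add: EC_pre EC_unit_iff EC_assoc_iff ball_conj_distrib all_conj_distrib)
    (simp only: ball_all_swap)

lemma EC_bij: "bij_betw EC {A :: ('o, 'u) ccat. contra_category A} {E. enriched_category M E}"
proof (rule bij_betw_byWitness [where f' = CE])
  show "\<forall>A\<in>{A. contra_category A}. CE (EC A) = A"
    by (simp add: CE_EC contra_pre)
  show "\<forall>E\<in>{E. enriched_category M E}. EC (CE E) = E"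
    by (simp add: EC_CE enriched_category_iff)
  show "EC ` {A. contra_category A} \<subseteq> {E. enriched_category M E}"
    by (auto simp: EC_iff contra_pre)
  show "CE ` {E. enriched_category M E} \<subseteq> {A. contra_category A}"
  proof clarsimp
    fix E assume E: "enriched_category M E"
    then have p: "pre_enr E" by (simp add: enriched_category_iff)
    show "contra_category (CE E)"
      using EC_iff [OF CE_pre [OF p]] E by (simp add: EC_CE [OF p])
  qed
qed

section \<open>1-cells: V-functors and 2-functors preserving contravariance\<close>

definition cfar :: "('o, 'u) ccat \<Rightarrow> ('o, 'u) ccat \<Rightarrow> ('o, 'u) cfun \<Rightarrow> 'o \<Rightarrow> 'o \<Rightarrow> 'u sfun \<times> 'u sfun" where
  "cfar A B F x y = varr (chom A x y) (chom B (CFOb F x) (CFOb F y)) (\<lambda>k v. fh F k v x y)"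

definition EF :: "('o, 'u) ccat \<Rightarrow> ('o, 'u) ccat \<Rightarrow> ('o, 'u) cfun \<Rightarrow> ('o, 'u sfun \<times> 'u sfun) efun" where
  "EF A B F = \<lparr>EFOb = CFOb F,
     EFAr = (\<lambda>x y. if x \<in> CObj A \<and> y \<in> CObj A then cfar A B F x y else undefined)\<rparr>"

definition FE :: "('o, 'u) ccat \<Rightarrow> ('o, 'u sfun \<times> 'u sfun) efun \<Rightarrow> ('o, 'u) cfun" where
  "FE A G = \<lparr>CFOb = EFOb G,
     CFHom = (\<lambda>v x y. if x \<in> CObj A \<and> y \<in> CObj A then mor (prj v (EFAr G x y)) else undefined)\<rparr>"

lemma EF_sel [simp]: "EFOb (EF A B F) = CFOb F"
  "x \<in> CObj A \<Longrightarrow> y \<in> CObj A \<Longrightarrow> EFAr (EF A B F) x y = cfar A B F x y"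
  by (simp_all add: EF_def)

lemma cfar_st [simp]: "vsrc (cfar A B F x y) = chom A x y"
  "vtrg (cfar A B F x y) = chom B (CFOb F x) (CFOb F y)"
  by (simp_all add: cfar_def)

lemma cfar_act [simp]: "f \<in> hm A k v x y \<Longrightarrow> act k v (cfar A B F x y) f = fh F k v x y f"
  by (simp add: cfar_def hm_def)

lemma cfar_vAr:
  assumes A: "pre_contra A" and B: "pre_contra B" and F: "pre_cfun A B F"
    and x: "x \<in> CObj A" "y \<in> CObj A"
  shows "vAr (cfar A B F x y)"
  unfolding cfar_def
  using functor_eta [OF pre_CFHom [OF F x]] pre_CFHom [OF F x] pre_CFOb [OF F] x
  by (intro varr_vArI) (simp_all add: chom_vcat [OF A] chom_vcat [OF B] fh_def)

lemma prj_cfar: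
  assumes F: "pre_cfun A B F" and x: "x \<in> CObj A" "y \<in> CObj A"
  shows "mor (prj v (cfar A B F x y)) = CFHom F v x y"
  using functor_eta [OF pre_CFHom [OF F x]] by (simp add: cfar_def prj_varr fh_def)

definition pre_efun :: "('o, 'u) ccat \<Rightarrow> ('o, 'u) ccat \<Rightarrow> ('o, 'u sfun \<times> 'u sfun) efun \<Rightarrow> bool" where
  "pre_efun A B G \<longleftrightarrow> EFOb G \<in> CObj A \<rightarrow>\<^sub>E CObj B \<and>
     (\<forall>x\<in>CObj A. \<forall>y\<in>CObj A. vAr (EFAr G x y) \<and> vsrc (EFAr G x y) = chom A x y \<and>
        vtrg (EFAr G x y) = chom B (EFOb G x) (EFOb G y)) \<and>
     (\<forall>x y. \<not> (x \<in> CObj A \<and> y \<in> CObj A) \<longrightarrow> EFAr G x y = undefined)"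

lemma enriched_functor_iff:
  "enriched_functor M (EC A) (EC B) G \<longleftrightarrow> pre_efun A B G \<and>
     (\<forall>x\<in>CObj A. EFAr G x x \<diamondop>\<^bsub>M\<^esub> gel (chom A x x) (CId A x) =
         gel (chom B (EFOb G x) (EFOb G x)) (CId B (EFOb G x))) \<and>
     (\<forall>x\<in>CObj A. \<forall>y\<in>CObj A. \<forall>z\<in>CObj A. EFAr G x z \<diamondop>\<^bsub>M\<^esub> ccmp A x y z =
        ccmp B (EFOb G x) (EFOb G y) (EFOb G z) \<diamondop>\<^bsub>M\<^esub> (EFAr G y z \<odot>\<^bsub>M\<^esub> EFAr G x y))"
proof (cases "EFOb G \<in> CObj A \<rightarrow>\<^sub>E CObj B")
  \<comment> \<open>\<open>EC B\<close> yields the hom-objects \<open>chom\<close> only at objects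
    of \<open>B\<close>, so its data can be unfolded once \<open>G\<close> is known to map into
    them. Otherwise both sides are false.\<close>
  case True
  then have "EFOb G x \<in> CObj B" if "x \<in> CObj A" for x using that by auto
  then show ?thesis
    using True by (auto simp: enriched_functor_def pre_efun_def arr_between_M)
qed (simp add: enriched_functor_def pre_efun_def)

lemma EF_pre:
  assumes A: "pre_contra A" and B: "pre_contra B" and F: "pre_cfun A B F"
  shows "pre_efun A B (EF A B F)"
  using F cfar_vAr [OF assms] unfolding pre_efun_def pre_cfun_def by (auto simp: EF_def)

lemma FE_pre: "pre_efun A B G \<Longrightarrow> pre_cfun A B (FE A G)"
  unfolding pre_cfun_def
proof (intro conjI allI ballI)
  fix v x y assume G: "pre_efun A B G" and x: "x \<in> CObj A" "y \<in> CObj A"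
  then show "is_functor (CHom A v x y) (CHom B v (CFOb (FE A G) x) (CFOb (FE A G) y))
      (CFHom (FE A G) v x y)"
    using vAr_functor [of "EFAr G x y" v] by (simp add: pre_efun_def FE_def)
qed (auto simp: FE_def pre_efun_def)

lemma FE_EF: "pre_cfun A B F \<Longrightarrow> FE A (EF A B F) = F"
  by (rule cfun.equality) (auto simp: FE_def EF_def fun_eq_iff prj_cfar pre_CFHom_ext)

lemma EF_FE:
  assumes A: "pre_contra A" and B: "pre_contra B" and G: "pre_efun A B G"
  shows "EF A B (FE A G) = G"
proof (rule efun.equality)
  have "cfar A B (FE A G) x y = EFAr G x y" if x: "x \<in> CObj A" "y \<in> CObj A" for x y
  proof (rule vAr_eqI)
    have s: "vAr (EFAr G x y)" "vsrc (EFAr G x y) = chom A x y" "vtrg (EFAr G x y) =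
        chom B (EFOb G x) (EFOb G y)"
      using G x by (simp_all add: pre_efun_def)
    show "vAr (EFAr G x y)" "vAr (cfar A B (FE A G) x y)"
      using s cfar_vAr [OF A B FE_pre [OF G] x] by simp_all
    show "vsrc (cfar A B (FE A G) x y) = vsrc (EFAr G x y)" "vtrg (cfar A B (FE A G) x y) =
        vtrg (EFAr G x y)"
      by (simp_all add: s FE_def)
    fix k v t assume "t \<in> cel k (prj v (vsrc (EFAr G x y)))"
    then show "act k v (cfar A B (FE A G) x y) t = act k v (EFAr G x y) t"
      using x by (simp add: s cel_CHom) (simp add: FE_def fh_def act_def)
  qed
  then show "EFAr (EF A B (FE A G)) = EFAr G"
    using G by (auto simp: EF_def fun_eq_iff pre_efun_def)
qed (simp_all add: EF_def FE_def)

lemma gel_eq_iff: "gel X a = gel X b \<longleftrightarrow> a = b"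
  by (metis gel_act kind.case(1))

text \<open>The only point beyond evaluation is that \<open>F\<close> preserves identities, which
  settles kind \<open>ArK\<close>.\<close>

lemma act_gel:
  assumes "vAr F" "a \<in> Ob (prj Covar (vsrc F))"
  shows "F \<diamondop>\<^bsub>M\<^esub> gel (vsrc F) a = gel (vtrg F) (act ObK Covar F a)"
proof (rule vAr_eqI)
  show "vAr (F \<diamondop>\<^bsub>M\<^esub> gel (vsrc F) a)" "vAr (gel (vtrg F) (act ObK Covar F a))"
    using assms by simp_all
  fix k v t assume "t \<in> cel k (prj v (vsrc (gel (vtrg F) (act ObK Covar F a))))"
  then have "v = Covar" "t = u" by (simp_all split: if_splits)
  then show "act k v (F \<diamondop>\<^bsub>M\<^esub> gel (vsrc F) a) t = act k v (gel (vtrg F) (act ObK Covar F a)) t"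
    using assms act_Idt [OF assms] by (cases k) (simp_all add: gel_act)
qed (use assms in simp_all)

lemma EF_iff:
  assumes A: "pre_contra A" and B: "pre_contra B" and F: "pre_cfun A B F"
  shows "enriched_functor M (EC A) (EC B) (EF A B F) \<longleftrightarrow> contra_functor A B F"
proof -
  note v = cfar_vAr [OF A B F]
  note [simp] = v chom_vcat [OF A] chom_vcat [OF B] ccmp_vAr [OF A] ccmp_vAr [OF B] cel_CHom
    pre_CFOb [OF F] fh_in [OF F] cmp_in [OF A] EF_pre [OF A B F] F
  have 1: "cfar A B F x x \<diamondop>\<^bsub>M\<^esub> gel (chom A x x) (CId A x) =
      gel (chom B (CFOb F x) (CFOb F x)) (CId B (CFOb F x)) \<longleftrightarrow> fh F ObK Covar x x (CId A x) =
          CId B (CFOb F x)"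
    if "x \<in> CObj A" for x
  proof -
    have i: "CId A x \<in> hm A ObK Covar x x" by (rule pre_CId [OF A that])
    then have "CId A x \<in> Ob (prj Covar (vsrc (cfar A B F x x)))"
      by (simp only: cfar_st prj_chom hm_def cel.simps)
    from act_gel [OF v [OF that that] this]
    have "cfar A B F x x \<diamondop>\<^bsub>M\<^esub> gel (chom A x x) (CId A x) =
        gel (chom B (CFOb F x) (CFOb F x)) (fh F ObK Covar x x (CId A x))"
      by (simp only: cfar_st cfar_act [OF i])
    then show ?thesis by (simp only: gel_eq_iff)
  qed
  have 2: "cfar A B F x z \<diamondop>\<^bsub>M\<^esub> ccmp A x y z = ccmp B (CFOb F x) (CFOb F y) (CFOb F z) \<diamondop>\<^bsub>M\<^esub>
      (cfar A B F y z \<odot>\<^bsub>M\<^esub> cfar A B F x y)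
    \<longleftrightarrow> (\<forall>k v w. \<forall>g\<in>hm A k v y z. \<forall>f\<in>hm A k w x y.
        fh F k (vmul v w) x z (cmp A k v w x y z g f) =
        cmp B k v w (CFOb F x) (CFOb F y) (CFOb F z) (fh F k v y z g) (fh F k w x y f))" (is "?L \<longleftrightarrow>
            (\<forall>k v w. ?R k v w)")
    if [simp]: "x \<in> CObj A" "y \<in> CObj A" "z \<in> CObj A" for x y z
  proof -
    have c [simp]: "cmp A k v (vmul v w) x y z g f \<in> hm A k w x z"
      if "g \<in> hm A k v y z" "f \<in> hm A k (vmul v w) x y" for k v w g f
      using that cmp_in [OF A, of x y z g k v f "vmul v w"] by simp
    have "?L \<longleftrightarrow> (\<forall>k w v. \<forall>g\<in>hm A k v y z. \<forall>f\<in>hm A k (vmul v w) x y.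
        fh F k w x z (cmp A k v (vmul v w) x y z g f) =
        cmp B k v (vmul v w) (CFOb F x) (CFOb F y) (CFOb F z) (fh F k v y z g) (fh F k (vmul v w) x y f))"
      (is "_ \<longleftrightarrow> (\<forall>k w v. ?S k w v)")
      by (subst vAr_eq_iff) (simp_all add: T_ball)
    \<comment> \<open>For fixed \<open>v\<close> the map from \<open>w\<close> to vw is a bijection
      of variances, so the summands at all total variances account for every pair of
      variances.\<close>
    also have "\<dots> \<longleftrightarrow> (\<forall>k v w. ?R k v w)"
    proof (intro iffI allI)
      fix k v w assume *: "\<forall>k w v. ?S k w v"
      show "?R k v w" using *[rule_format, of _ k v _ "vmul v w"] by simp
    next
      fix k w v assume *: "\<forall>k v w. ?R k v w"
      show "?S k w v" using *[rule_format, of _ k v _ "vmul v w"] by simp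
    qed
    finally show ?thesis .
  qed
  show ?thesis
    unfolding enriched_functor_iff contra_functor_iff
    by (simp add: 1 2) (simp only: ball_all_swap)
qed

lemma EF_bij:
  assumes A: "pre_contra A" and B: "pre_contra B"
  shows "bij_betw (EF A B) {F. contra_functor A B F} {G. enriched_functor M (EC A) (EC B) G}"
proof (rule bij_betw_byWitness [where f' = "FE A"])
  have e: "pre_efun A B G" if "enriched_functor M (EC A) (EC B) G" for G
    using that by (simp add: enriched_functor_iff)
  show "\<forall>F\<in>{F. contra_functor A B F}. FE A (EF A B F) = F"
    by (auto intro!: FE_EF contra_pre_cfun)
  show "\<forall>G\<in>{G. enriched_functor M (EC A) (EC B) G}. EF A B (FE A G) = G"
    using EF_FE [OF A B] e by auto
  show "EF A B ` {F. contra_functor A B F} \<subseteq> {G. enriched_functor M (EC A) (EC B) G}"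
    by (auto simp: EF_iff [OF A B contra_pre_cfun])
  show "FE A ` {G. enriched_functor M (EC A) (EC B) G} \<subseteq> {F. contra_functor A B F}"
    using EF_iff [OF A B FE_pre] EF_FE [OF A B] e by auto
qed

section \<open>2-cells: V-natural and 2-natural transformations\<close>

definition EN :: "('o, 'u) ccat \<Rightarrow> ('o, 'u) ccat \<Rightarrow> ('o, 'u) cfun \<Rightarrow> ('o, 'u) cfun \<Rightarrow>
    ('o \<Rightarrow> 'u) \<Rightarrow> 'o \<Rightarrow> 'u sfun \<times> 'u sfun" where
  "EN A B F F' \<alpha> = (\<lambda>x\<in>CObj A. gel (chom B (CFOb F x) (CFOb F' x)) (\<alpha> x))"

text \<open>The inverse unitors send \<open>f\<close> to \<open>enc Covar u f\<close> and to
  \<open>enc v f u\<close>, and a global element sends \<open>u\<close> to the named object or its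
  identity. The two legs of V-naturality thus evaluate to \<alpha> after F(f) and F'(f) after
  \<alpha>.\<close>

lemma EN_iff:
  assumes A: "pre_contra A" and B: "pre_contra B" and F: "pre_cfun A B F" and F': "pre_cfun A B F'"
    and i: "\<And>x. x \<in> CObj A \<Longrightarrow> \<alpha> x \<in> hm B ObK Covar (CFOb F x) (CFOb F' x)" and e: "\<alpha> \<in> extensional (CObj A)"
  shows "enriched_nat M (EC A) (EC B) (EF A B F) (EF A B F') (EN A B F F' \<alpha>) \<longleftrightarrow> contra_nat A B F F' \<alpha>"
proof -
  have [simp]: "\<alpha> x \<in> Ob (CHom B Covar (CFOb F x) (CFOb F' x))" if "x \<in> CObj A" for x
    using i [OF that] by (simp add: hm_def)
  note [simp] = cfar_vAr [OF A B F] cfar_vAr [OF A B F'] chom_vcat [OF A] chom_vcat [OF B]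
      ccmp_vAr [OF A] ccmp_vAr [OF B] cel_CHom
    pre_CFOb [OF F] pre_CFOb [OF F'] fh_in [OF F] fh_in [OF F'] i el_in [OF B]
  have "ccmp B (CFOb F x) (CFOb F y) (CFOb F' y) \<diamondop>\<^bsub>M\<^esub>
      (gel (chom B (CFOb F y) (CFOb F' y)) (\<alpha> y) \<odot>\<^bsub>M\<^esub> cfar A B F x y)
          \<diamondop>\<^bsub>M\<^esub> inv_ar (base M) (lun M (chom A x y)) =
        ccmp B (CFOb F x) (CFOb F' x) (CFOb F' y) \<diamondop>\<^bsub>M\<^esub>
            (cfar A B F' x y \<odot>\<^bsub>M\<^esub> gel (chom B (CFOb F x) (CFOb F' x)) (\<alpha> x))
          \<diamondop>\<^bsub>M\<^esub> inv_ar (base M) (run M (chom A x y)) \<longleftrightarrow>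
     (\<forall>k v. \<forall>f\<in>hm A k v x y.
        cmp B k Covar v (CFOb F x) (CFOb F y) (CFOb F' y) (el B k (CFOb F y) (CFOb F' y) (\<alpha> y))
            (fh F k v x y f) =
        cmp B k v Covar (CFOb F x) (CFOb F' x) (CFOb F' y) (fh F' k v x y f)
            (el B k (CFOb F x) (CFOb F' x) (\<alpha> x)))"
    if [simp]: "x \<in> CObj A" "y \<in> CObj A" for x y
    by (subst vAr_eq_iff) simp_all
  then show ?thesis
    unfolding enriched_nat_def contra_nat_iff
    using e by (simp add: EN_def arr_between_M) (simp only: ball_all_swap)
qed

definition EA :: "('o, 'u) ccat \<Rightarrow> ('o, 'u) ccat \<Rightarrow> ('o, 'u) ccell \<Rightarrow> ('o, 'u sfun \<times> 'u sfun) ecell" where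
  "EA A B \<alpha> = \<lparr>src = EF A B (src \<alpha>), mor = EN A B (src \<alpha>) (trg \<alpha>) (mor \<alpha>), trg = EF A B (trg \<alpha>)\<rparr>"

definition AE :: "('o, 'u) ccat \<Rightarrow> ('o, 'u sfun \<times> 'u sfun) ecell \<Rightarrow> ('o, 'u) ccell" where
  "AE A \<beta> = \<lparr>src = FE A (src \<beta>), mor = (\<lambda>x\<in>CObj A. act ObK Covar (mor \<beta> x) u), trg = FE A (trg \<beta>)\<rparr>"

definition enat :: "('o, 'u) ccat \<Rightarrow> ('o, 'u) ccat \<Rightarrow> ('o, 'u sfun \<times> 'u sfun) ecell \<Rightarrow> bool" where
  "enat A B \<alpha> \<longleftrightarrow> enriched_functor M (EC A) (EC B) (src \<alpha>) \<and> enriched_functor M (EC A) (EC B) (trg \<alpha>) \<and>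
     enriched_nat M (EC A) (EC B) (src \<alpha>) (trg \<alpha>) (mor \<alpha>)"

lemma EA_enat:
  assumes A: "pre_contra A" and B: "pre_contra B" and \<alpha>: "cnat A B \<alpha>"
  shows "enat A B (EA A B \<alpha>)"
  using \<alpha> EN_iff [OF A B contra_pre_cfun [OF cnat_fun(1) [OF \<alpha>]]
      contra_pre_cfun [OF cnat_fun(2) [OF \<alpha>]] cnat_in [OF \<alpha>] cnat_ext [OF \<alpha>]]
  by (simp add: enat_def EA_def cnat_def EF_iff [OF A B contra_pre_cfun])

lemma AE_EA:
  assumes \<alpha>: "cnat A B \<alpha>"
  shows "AE A (EA A B \<alpha>) = \<alpha>"
  using FE_EF [OF contra_pre_cfun [OF cnat_fun(1) [OF \<alpha>]]]
      FE_EF [OF contra_pre_cfun [OF cnat_fun(2) [OF \<alpha>]]] cnat_ext [OF \<alpha>]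
  by (intro arrow.equality) (auto simp: AE_def EA_def EN_def fun_eq_iff extensional_def)

lemma EA_AE:
  fixes A B :: "('o, 'u) ccat"
  assumes A: "pre_contra A" and B: "pre_contra B" and \<beta>: "enat A B \<beta>"
  shows "EA A B (AE A \<beta>) = \<beta>" "cnat A B (AE A \<beta>)"
proof -
  have G: "enriched_functor M (EC A) (EC B) (src \<beta>)" "enriched_functor M (EC A) (EC B) (trg \<beta>)"
    and n: "enriched_nat M (EC A) (EC B) (src \<beta>) (trg \<beta>) (mor \<beta>)"
    using \<beta> by (simp_all add: enat_def)
  have p: "pre_efun A B (src \<beta>)" "pre_efun A B (trg \<beta>)" using G by (simp_all add: enriched_functor_iff)
  have ob: "EFOb (src \<beta>) x \<in> CObj B" "EFOb (trg \<beta>) x \<in> CObj B" if "x \<in> CObj A" for x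
    using that p by (auto simp: pre_efun_def)
  have m: "vAr (mor \<beta> x)" "vsrc (mor \<beta> x) = V_unit u" "vtrg (mor \<beta> x) =
      chom B (EFOb (src \<beta>) x) (EFOb (trg \<beta>) x)"
    if "x \<in> CObj A" for x
    using n that ob [OF that] by (auto simp: enriched_nat_def arr_between_M)
  have e: "mor \<beta> \<in> extensional (CObj A)" using n by (simp add: enriched_nat_def)
  have [simp]: "CFOb (FE A H) = EFOb H" for H :: "('o, 'u sfun \<times> 'u sfun) efun" by (simp add: FE_def)
  show 1: "EA A B (AE A \<beta>) = \<beta>"
    using EF_FE [OF A B p(1)] EF_FE [OF A B p(2)] gel_surj(2) [OF m] e
    by (intro arrow.equality) (auto simp: AE_def EA_def EN_def fun_eq_iff extensional_def)
  have f: "contra_functor A B (FE A (src \<beta>))" "contra_functor A B (FE A (trg \<beta>))"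
    using EF_iff [OF A B FE_pre [OF p(1)]] EF_iff [OF A B FE_pre [OF p(2)]] EF_FE [OF A B p(1)]
        EF_FE [OF A B p(2)] G
    by simp_all
  have i: "mor (AE A \<beta>) x \<in> hm B ObK Covar (CFOb (FE A (src \<beta>)) x) (CFOb (FE A (trg \<beta>)) x)"
      if "x \<in> CObj A" for x
    using gel_surj(1) [OF m, OF that that that] that by (simp add: AE_def hm_def)
  have "contra_nat A B (FE A (src \<beta>)) (FE A (trg \<beta>)) (mor (AE A \<beta>)) \<longleftrightarrow>
      enriched_nat M (EC A) (EC B) (EF A B (FE A (src \<beta>))) (EF A B (FE A (trg \<beta>)))
        (EN A B (FE A (src \<beta>)) (FE A (trg \<beta>)) (mor (AE A \<beta>)))"
    by (rule EN_iff [OF A B FE_pre [OF p(1)] FE_pre [OF p(2)] i, symmetric])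
        (auto simp: AE_def extensional_def)
  \<comment> \<open>The first claim, read on components, turns the equivalence into the given
    naturality of \<beta>.\<close>
  also have "EN A B (FE A (src \<beta>)) (FE A (trg \<beta>)) (mor (AE A \<beta>)) = mor \<beta>"
    using arg_cong [OF 1, of mor] by (simp add: EA_def) (simp add: AE_def)
  finally show "cnat A B (AE A \<beta>)"
    using f n EF_FE [OF A B p(1)] EF_FE [OF A B p(2)] by (simp add: cnat_def) (simp add: AE_def)
qed

lemma EA_bij:
  assumes A: "pre_contra A" and B: "pre_contra B"
  shows "bij_betw (EA A B) {\<alpha>. cnat A B \<alpha>} {\<beta>. enat A B \<beta>}"
  by (rule bij_betw_byWitness [where f' = "AE A"]) (auto simp: AE_EA EA_AE [OF A B] EA_enat [OF A B])

section \<open>Compatibility with identities and compositions\<close>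

lemma ecat_hom_eq: "ecat_hom M (EC A) (EC B) =
    mk_cat {F. enriched_functor M (EC A) (EC B) F} {\<alpha>. enat A B \<alpha>} src trg
     (\<lambda>F. \<lparr>src = F, mor = (\<lambda>x\<in>CObj A. EId (EC B) (EFOb F x)), trg = F\<rparr>)
     (\<lambda>\<beta> \<alpha>. \<lparr>src = src \<alpha>,
              mor = (\<lambda>x\<in>CObj A. ecomp_elt M (EC B) (EFOb (src \<alpha>) x) (EFOb (src \<beta>) x) (EFOb (trg \<beta>) x)
                                  (mor \<beta> x) (mor \<alpha> x)),
              trg = trg \<beta>\<rparr>)"
  by (simp add: ecat_hom_def enat_def)

text \<open>The inverse left unitor of the unit sends \<open>u\<close> to
  \<open>enc Covar u u\<close>, where the tensor of the two global elements gives the pair of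
  \<open>b\<close> and \<open>a\<close> in the covariant summand.\<close>

lemma ecomp_elt_gel:
  assumes B: "pre_contra B" and [simp]: "x \<in> CObj B" "y \<in> CObj B" "z \<in> CObj B"
    and b: "b \<in> hm B ObK Covar y z" and a: "a \<in> hm B ObK Covar x y"
  shows "ecomp_elt M (EC B) x y z (gel (chom B y z) b) (gel (chom B x y) a) =
    gel (chom B x z) (cmp B ObK Covar Covar x y z b a)"
proof -
  note [simp] = chom_vcat [OF B] ccmp_vAr [OF B]
  have [simp]: "b \<in> Ob (CHom B Covar y z)" "a \<in> Ob (CHom B Covar x y)"
    using a b by (simp_all add: hm_def)
  have c: "cmp B ObK Covar Covar x y z b a \<in> hm B ObK Covar x z"
    using cmp_in [OF B _ _ _ b a] by simp
  then have [simp]: "cmp B ObK Covar Covar x y z b a \<in> Ob (CHom B Covar x z)"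
    by (simp add: hm_def)
  show ?thesis
    unfolding ecomp_elt_def
    by (rule vAr_eqI) (auto simp: el_in [OF B] a b el_cmp [OF B] split: if_splits)
qed

lemma EF_cid:
  assumes A: "contra_category A"
  shows "EF A A (cid_fun A) = eid_fun M (EC A)"
proof (rule efun.equality)
  have "cfar A A (cid_fun A) x y = mid M (chom A x y)" if x: "x \<in> CObj A" "y \<in> CObj A" for x y
    using cfar_vAr [OF contra_pre [OF A] contra_pre [OF A] contra_pre_cfun [OF cid_fun [OF A]] x]
      chom_vcat [OF contra_pre [OF A] x] x
    by (intro vAr_eqI) (auto simp: cel_CHom)
  then show "EFAr (EF A A (cid_fun A)) = EFAr (eid_fun M (EC A))"
    by (auto simp: EF_def eid_fun_def fun_eq_iff)
qed (simp_all add: EF_def eid_fun_def cid_fun_def)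

lemma EF_ccomp:
  assumes A: "contra_category A" and B: "contra_category B" and C: "contra_category C"
    and F: "contra_functor A B F" and G: "contra_functor B C G"
  shows "ecomp_fun M (EC A) (EF B C G) (EF A B F) = EF A C (ccomp_fun A G F)"
proof (rule efun.equality)
  note pA = contra_pre [OF A] and pB = contra_pre [OF B] and pC = contra_pre [OF C]
  have "cfar B C G (CFOb F x) (CFOb F y) \<diamondop>\<^bsub>M\<^esub> cfar A B F x y = cfar A C (ccomp_fun A G F) x y"
    if x: "x \<in> CObj A" "y \<in> CObj A" for x y
    using cfar_vAr [OF pA pB contra_pre_cfun [OF F] x]
        cfar_vAr [OF pB pC contra_pre_cfun [OF G], of "CFOb F x" "CFOb F y"]
      cfar_vAr [OF pA pC contra_pre_cfun [OF ccomp_fun [OF A F G]] x] x cfun_in [OF F]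
    by (intro vAr_eqI) (auto simp: cel_CHom)
  then show "EFAr (ecomp_fun M (EC A) (EF B C G) (EF A B F)) = EFAr (EF A C (ccomp_fun A G F))"
    using cfun_in(1) [OF F] by (auto simp: EF_def ecomp_fun_def fun_eq_iff)
qed (simp_all add: EF_def ecomp_fun_def ccomp_fun_def)

lemma EA_sel [simp]: "src (EA A B \<alpha>) = EF A B (src \<alpha>)" "trg (EA A B \<alpha>) = EF A B (trg \<alpha>)"
  "x \<in> CObj A \<Longrightarrow> mor (EA A B \<alpha>) x = gel (chom B (CFOb (src \<alpha>) x) (CFOb (trg \<alpha>) x)) (mor \<alpha> x)"
  by (simp_all add: EA_def EN_def)

lemma ECat_sel: "TObj (ECat M) = {A. enriched_category M A}" "THom (ECat M) =
    ecat_hom M" "TId (ECat M) = eid_fun M"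
  "TComp (ECat M) A B C = mk_fun (prod_cat (ecat_hom M B C) (ecat_hom M A B))
        (\<lambda>(G, F). ecomp_fun M A G F)
        (\<lambda>(\<beta>, \<alpha>). let F = src \<alpha>; F' = trg \<alpha>; G = src \<beta>; G' = trg \<beta> in
           \<lparr>src = ecomp_fun M A G F,
            mor = (\<lambda>x\<in>EObj A.
                     ecomp_elt M C (EFOb G (EFOb F x)) (EFOb G (EFOb F' x)) (EFOb G' (EFOb F' x))
                       (mor \<beta> (EFOb F' x)) (EFAr G (EFOb F x) (EFOb F' x) \<diamondop>\<^bsub>M\<^esub> mor \<alpha> x)),
            trg = ecomp_fun M A G' F'\<rparr>)"
  by (simp_all add: ECat_def)

lemma EA_cvid:
  assumes B: "contra_category B" and F: "contra_functor A B F"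
  shows "\<lparr>src = EF A B F, mor = (\<lambda>x\<in>CObj A. EId (EC B) (EFOb (EF A B F) x)), trg = EF A B F\<rparr> =
      EA A B (cvid A B F)"
  using cfun_in(1) [OF F] by (auto simp: EA_def EN_def cvid_def)

lemma EA_cvcomp:
  assumes B: "contra_category B" and \<beta>: "cnat A B \<beta>" and \<alpha>: "cnat A B \<alpha>" and st: "src \<beta> = trg \<alpha>"
  shows "\<lparr>src = EF A B (src \<alpha>), mor = (\<lambda>x\<in>CObj A. ecomp_elt M (EC B) (CFOb (src \<alpha>) x) (CFOb (src \<beta>) x)
      (CFOb (trg \<beta>) x)
       (mor (EA A B \<beta>) x) (mor (EA A B \<alpha>) x)), trg = EF A B (trg \<beta>)\<rparr> = EA A B (cvcomp A B \<beta> \<alpha>)"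
proof -
  note [simp] = cfun_in(1) [OF cnat_fun(1) [OF \<alpha>]] cfun_in(1) [OF cnat_fun(2) [OF \<alpha>]]
      cfun_in(1) [OF cnat_fun(2) [OF \<beta>]]
  have "ecomp_elt M (EC B) (CFOb (src \<alpha>) x) (CFOb (src \<beta>) x) (CFOb (trg \<beta>) x) (mor (EA A B \<beta>) x)
      (mor (EA A B \<alpha>) x) =
    mor (EA A B (cvcomp A B \<beta> \<alpha>)) x" if x: "x \<in> CObj A" for x
    using x cnat_in [OF \<alpha> x] cnat_in [OF \<beta> x]
    by (simp add: st) (rule ecomp_elt_gel [OF contra_pre [OF B]]; simp)
  then show ?thesis
    by (intro arrow.equality) (simp_all add: EA_def EN_def fun_eq_iff restrict_def)
qed

lemma EA_chcomp:
  assumes A: "contra_category A" and B: "contra_category B" and C: "contra_category C"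
    and \<beta>: "cnat B C \<beta>" and \<alpha>: "cnat A B \<alpha>"
  shows "\<lparr>src = ecomp_fun M (EC A) (EF B C (src \<beta>)) (EF A B (src \<alpha>)),
     mor = (\<lambda>x\<in>CObj A. ecomp_elt M (EC C) (CFOb (src \<beta>) (CFOb (src \<alpha>) x)) (CFOb (src \<beta>) (CFOb (trg \<alpha>) x))
        (CFOb (trg \<beta>) (CFOb (trg \<alpha>) x)) (mor (EA B C \<beta>) (CFOb (trg \<alpha>) x))
        (EFAr (EF B C (src \<beta>)) (CFOb (src \<alpha>) x) (CFOb (trg \<alpha>) x) \<diamondop>\<^bsub>M\<^esub> mor (EA A B \<alpha>) x)),
     trg = ecomp_fun M (EC A) (EF B C (trg \<beta>)) (EF A B (trg \<alpha>))\<rparr> = EA A C (chcomp A C \<beta> \<alpha>)"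
proof -
  note F = cnat_fun [OF \<alpha>] and G = cnat_fun [OF \<beta>]
  note pA = contra_pre [OF A] and pB = contra_pre [OF B] and pC = contra_pre [OF C]
  note [simp] = cfun_in [OF F(1)] cfun_in [OF F(2)] cfun_in [OF G(1)] cfun_in [OF G(2)]
  have "ecomp_elt M (EC C) (CFOb (src \<beta>) (CFOb (src \<alpha>) x)) (CFOb (src \<beta>) (CFOb (trg \<alpha>) x))
        (CFOb (trg \<beta>) (CFOb (trg \<alpha>) x)) (mor (EA B C \<beta>) (CFOb (trg \<alpha>) x))
        (EFAr (EF B C (src \<beta>)) (CFOb (src \<alpha>) x) (CFOb (trg \<alpha>) x) \<diamondop>\<^bsub>M\<^esub> mor (EA A B \<alpha>) x) =
    mor (EA A C (chcomp A C \<beta> \<alpha>)) x" if x [simp]: "x \<in> CObj A" for x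
  proof -
    \<comment> \<open>By \<open>act_gel\<close>, composing the action of the source of \<beta> with
      a component of \<alpha> names the image of that component, which is the inner factor of the
      horizontal composite.\<close>
    have 1: "EFAr (EF B C (src \<beta>)) (CFOb (src \<alpha>) x) (CFOb (trg \<alpha>) x) \<diamondop>\<^bsub>M\<^esub> mor (EA A B \<alpha>) x =
        gel (chom C (CFOb (src \<beta>) (CFOb (src \<alpha>) x)) (CFOb (src \<beta>) (CFOb (trg \<alpha>) x)))
          (fh (src \<beta>) ObK Covar (CFOb (src \<alpha>) x) (CFOb (trg \<alpha>) x) (mor \<alpha> x))"
      using act_gel [OF cfar_vAr [OF pB pC contra_pre_cfun [OF G(1)]], of "CFOb (src \<alpha>) x"
          "CFOb (trg \<alpha>) x" "mor \<alpha> x"]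
        cnat_in [OF \<alpha> x] by simp (simp add: hm_def)
    show ?thesis
      unfolding 1
      using cnat_in [OF \<alpha> x] cnat_in [OF \<beta>, of "CFOb (trg \<alpha>) x"]
      by simp (rule ecomp_elt_gel [OF pC]; simp)
  qed
  then show ?thesis
    using EF_ccomp [OF A B C F(1) G(1)] EF_ccomp [OF A B C F(2) G(2)]
    by (intro arrow.equality) (simp_all add: EA_def EN_def fun_eq_iff restrict_def)
qed

text \<open>The conditions are the bijections and compatibilities established for each kind of cell.
  The two truncation conditions hold because homs and compositions of V-categories are built by
  \<open>mk_cat\<close> and \<open>mk_fun\<close>.\<close>

lemma two_iso_EC: "two_iso (CCat :: (('o, 'u) ccat, ('o, 'u) cfun, ('o, 'u) ccell) twocat)
    (ECat M) EC EF EA"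
proof (unfold_locales, goal_cases)
  case 1
  show ?case by (rule two_category_CCat)
next
  case 2
  show ?case using EC_bij by (simp add: CCat_eq ECat_sel)
next
  case (3 A B)
  then show ?case using EF_bij [OF contra_pre contra_pre, of A B]
    by (simp add: CCat_eq ECat_sel ccat_hom_eq ecat_hom_eq)
next
  case (4 A B)
  then show ?case using EA_bij [OF contra_pre contra_pre, of A B]
    by (simp add: CCat_eq ECat_sel ccat_hom_eq ecat_hom_eq)
next
  case (5 A B \<alpha>)
  then show ?case using EA_enat [OF contra_pre contra_pre, of A B \<alpha>]
    by (simp add: CCat_eq ECat_sel ccat_hom_eq ecat_hom_eq)
next
  case (6 A B \<alpha>)
  then show ?case using EA_enat [OF contra_pre contra_pre, of A B \<alpha>]
    by (simp add: CCat_eq ECat_sel ccat_hom_eq ecat_hom_eq)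
next
  case (7 A B F)
  then show ?case using EA_cvid [of B A F] EF_iff [OF contra_pre contra_pre contra_pre_cfun, of A B F]
    by (simp add: CCat_eq ECat_sel ccat_hom_eq ecat_hom_eq)
next
  case (8 A B \<beta> \<alpha>)
  then show ?case
    using EA_cvcomp [of B A \<beta> \<alpha>] EA_enat [OF contra_pre contra_pre, of A B \<alpha>]
        EA_enat [OF contra_pre contra_pre, of A B \<beta>]
    by (simp add: CCat_eq ECat_sel ccat_hom_eq ecat_hom_eq)
next
  case 9
  show ?case by (simp add: ECat_sel ecat_hom_def norm_mk_cat)
next
  case (10 A)
  then show ?case by (simp add: CCat_eq ECat_sel EF_cid)
next
  case (11 A B C G F)
  then show ?case
    using EF_ccomp [of A B C F G] EF_iff [OF contra_pre contra_pre contra_pre_cfun, of A B F]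
      EF_iff [OF contra_pre contra_pre contra_pre_cfun, of B C G]
    by (simp add: CCat_eq ECat_sel ccat_hom_eq ecat_hom_eq)
next
  case (12 A B C \<beta> \<alpha>)
  then show ?case
    using EA_chcomp [of A B C \<beta> \<alpha>] EA_enat [OF contra_pre contra_pre, of A B \<alpha>]
      EA_enat [OF contra_pre contra_pre, of B C \<beta>]
    by (simp add: CCat_eq ECat_sel ccat_hom_eq ecat_hom_eq Let_def)
next
  case 13
  show ?case unfolding ECat_sel by (rule mk_fun_idem)
qed

end

theorem theorem5p2:
  fixes e :: "('u \<times> 'u) + ('u \<times> 'u) \<Rightarrow> 'u" and u :: 'u
  assumes "inj e"
  shows "monoidal_category (V e u) \<and>
         two_equivalent
           (CCat :: (('o, 'u) ccat, ('o, 'u) cfun, ('o, 'u) ccell) twocat)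
           (ECat (V e u) :: (('o, 'u scat \<times> 'u scat, 'u sfun \<times> 'u sfun) ecat,
              ('o, 'u sfun \<times> 'u sfun) efun, ('o, 'u sfun \<times> 'u sfun) ecell) twocat)"
proof -
  interpret V_data e u by (rule V_data.intro) (rule assms)
  show ?thesis
    using monoidal_category_V two_iso.two_equivalent [OF two_iso_EC] by blast
qed

end
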